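(* Let $\mathfrak g=A_{2n}^{(2)}$ with $n\ge1$, and $1\le r\le n$. Then the virtual $U_q'(A_{2n}^{(2)})$-crystal $V^{r,1}$ is aligned, and as a $U_q(C_n)$-crystal $$V^{r,1}\cong\bigoplus_{k=0}^rV(\overline\Lambda_k).$$ Moreover, for $0\le k\le r$ the $U_q(C_n)$-crystal embedding $\iota_{\overline\Lambda_k}:V(\overline\Lambda_k)\to V^{r,1}$ is given by $\iota_{\overline\Lambda_k}=i_{r-1,1}\circ i_{r-2,1}\circ\cdots\circ i_{k,1}$.
   Context: TYPE A CRYSTALS. $\varnothing$ means "undefined"; $\epsilon_i(b)=\max\{m:e_i^m(b)\ne\varnothing\}$, $\varphi_i(b)=\max\{m:f_i^m(b)\ne\varnothing\}$. Tensor convention: $f_i(b_2\otimes b_1)=f_i(b_2)\otimes b_1$ if $\epsilon_i(b_2)\ge\varphi_i(b_1)$ and $b_2\otimes f_i(b_1)$ otherwise; $e_i(b_2\otimes b_1)=e_i(b_2)\otimes b_1$ if $\epsilon_i(b_2)>\varphi_i(b_1)$ and $b_2\otimes e_i(b_1)$ otherwise. Letters are $[2n]$ with $f_i^A(i)=i+1$ ($1\le i\le 2n-1$), all other values $\varnothing$; words are tensor products of letters; a semistandard tableau is identified with its column-reading word $c_1c_2\cdots$, $c_j$ being the strictly decreasing word of the $j$-th column. $\mathbb P(w)$ is the Schensted tableau of $w$ (the unique semistandard tableau Knuth equivalent to $w$). $B_A^{r,1}$ is the set of strictly decreasing words (columns) of length $r$ in $[2n]$ ($0\le r\le 2n$);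 on it $f_0^A$ removes the letter $2n$ and adds the letter $1$ when $2n$ occurs and $1$ does not (and is $\varnothing$ otherwise), and $e_0^A$ is the inverse; extend to tensor products by the tensor rule. VIRTUAL CRYSTALS of type $A_{2n}^{(2)}$ (Dynkin diagram labeled so that removing vertex $0$ gives $C_n$ and $\alpha_0$ is the shortest simple root). Virtual operators: $e_0=e_0^A$, $e_i=e_{2n-i}^Ae_i^A$ ($1\le i\le n-1$), $e_n=(e_n^A)^2$, and similarly $f_i$. Virtual weight: $\Psi(\mathrm{wt}(b))=\mathrm{wt}_A(b)$, where $\Psi(\overline\Lambda_i)=\overline\Lambda_i^A+\overline\Lambda_{2n-i}^A$ for $i<n$ and $\Psi(\overline\Lambda_n)=2\overline\Lambda_n^A$. Ambient crystal: $\widehat V^{r,1}=B_A^{2n-r,1}\otimes B_A^{r,1}$ for all $1\le r\le n$. $V^{r,1}\subset\widehat V^{r,1}$ is the subset generated by the virtual operators $e_i,f_i$, $0\le i\le n$, from $\bigl((2n-r)\cdots21\bigr)\otimes\bigl(r\cdots21\bigr)$. For $0\le k\le n$ (with $\overline\Lambda_0=0$), $V(\overline\Lambda_k)$ is the subset of the crystal of semistandard tableaux in $[2n]$ with two columns of heights $2n-k$ and $k$, generated by the virtual operators $e_i,f_i$ with $1\le i\le n$ only, from the tableau whose $i$-th row consists of letters $i$; it is isomorphic to the crystal $B(\overline\Lambda_k)$ of the irreducible $U_q(C_n)$-module of highest weight $\overline\Lambda_k$ (Baker). A two-column tableau with columns $u,v$ is viewed as $u\otimes v\in B_A^{2n-k,1}\otimes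 B_A^{k,1}$. $\iota_{\overline\Lambda_k}:V(\overline\Lambda_k)\to V^{r,1}$ is the map sending $b'$ to the unique $b\in\widehat V^{r,1}$ with $\mathbb P(b)=b'$. For $0\le r<n$, $i_{r,1}:B_A^{2n-r,1}\otimes B_A^{r,1}\to B_A^{2n-r-1,1}\otimes B_A^{r+1,1}$ is the unique embedding of $U_q(A_{2n-1})$-crystals: $i_{r,1}(u\otimes v)=v'\otimes u'$ with $\mathbb P(uv)=\mathbb P(v'u')$ (the empty composition, for $k=r$, being the inclusion). $V^{r,1}$ is aligned if for all $b\in V^{r,1}$: $\varphi_i^A(b)=\varphi_{2n-i}^A(b)$ and $\epsilon_i^A(b)=\epsilon_{2n-i}^A(b)$ for $1\le i\le n-1$, and $\varphi_n^A(b),\epsilon_n^A(b)$ are even. *)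

theory Defs
  imports "HOL-Library.FuncSet"
begin

text \<open>Crystal operators have type \<open>nat \<Rightarrow> 'b \<Rightarrow> 'b option\<close>; ``undefined'' is \<open>None\<close>.\<close>

definition iter :: "('b \<Rightarrow> 'b option) \<Rightarrow> nat \<Rightarrow> 'b \<Rightarrow> 'b option" where
  "iter g m b = ((\<lambda>x. Option.bind x g) ^^ m) (Some b)"

text \<open>\<open>depth g b\<close> is \<open>\<epsilon>\<^sub>i(b)\<close> for \<open>g = e\<^sub>i\<close> and \<open>\<phi>\<^sub>i(b)\<close> for \<open>g = f\<^sub>i\<close>.
  In all crystals below the maximum is over a finite nonempty set.\<close>

definition depth :: "('b \<Rightarrow> 'b option) \<Rightarrow> 'b \<Rightarrow> nat" where
  "depth g b = Max {m. iter g m b \<noteq> None}"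

record ('b, 'w) crystal =
  Elts :: "'b set"
  Eop :: "nat \<Rightarrow> 'b \<Rightarrow> 'b option"
  Fop :: "nat \<Rightarrow> 'b \<Rightarrow> 'b option"
  Wt :: "'b \<Rightarrow> 'w"

definition crystal_embedding ::
  "nat set \<Rightarrow> ('b, 'w) crystal \<Rightarrow> ('c, 'w) crystal \<Rightarrow> ('b \<Rightarrow> 'c) \<Rightarrow> bool" where
  "crystal_embedding I X Y \<psi> \<longleftrightarrow>
     \<psi> ` Elts X \<subseteq> Elts Y \<and> inj_on \<psi> (Elts X) \<and>
     (\<forall>b\<in>Elts X. Wt Y (\<psi> b) = Wt X b) \<and>
     (\<forall>b\<in>Elts X. \<forall>i\<in>I.
        Eop Y i (\<psi> b) = map_option \<psi> (Eop X i b) \<and>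
        Fop Y i (\<psi> b) = map_option \<psi> (Fop X i b) \<and>
        depth (Eop Y i) (\<psi> b) = depth (Eop X i) b \<and>
        depth (Fop Y i) (\<psi> b) = depth (Fop X i) b)"

definition crystal_isomorphic ::
  "nat set \<Rightarrow> ('b, 'w) crystal \<Rightarrow> ('c, 'w) crystal \<Rightarrow> bool" where
  "crystal_isomorphic I X Y \<longleftrightarrow>
     (\<exists>\<psi>. crystal_embedding I X Y \<psi> \<and> \<psi> ` Elts X = Elts Y)"

definition direct_sum :: "nat set \<Rightarrow> (nat \<Rightarrow> ('b, 'w) crystal) \<Rightarrow> (nat \<times> 'b, 'w) crystal" where
  "direct_sum K X =
     \<lparr> Elts = Sigma K (\<lambda>k. Elts (X k)),
       Eop = (\<lambda>i (k, b). map_option (Pair k) (Eop (X k) i b)),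
       Fop = (\<lambda>i (k, b). map_option (Pair k) (Fop (X k) i b)),
       Wt = (\<lambda>(k, b). Wt (X k) b) \<rparr>"

text \<open>The tensor rule, in the convention
  \<open>f\<^sub>i(b\<^sub>2 \<otimes> b\<^sub>1) = f\<^sub>i(b\<^sub>2) \<otimes> b\<^sub>1\<close> iff \<open>\<epsilon>\<^sub>i(b\<^sub>2) \<ge> \<phi>\<^sub>i(b\<^sub>1)\<close>. The arguments \<open>e2, f2\<close>
  and \<open>e1, f1\<close> are the operators (for one fixed \<open>i\<close>) on the left and the right factor; the
  pair \<open>(b2, b1)\<close> stands for \<open>b\<^sub>2 \<otimes> b\<^sub>1\<close>.\<close>

definition tensor_f ::
  "('b \<Rightarrow> 'b option) \<Rightarrow> ('b \<Rightarrow> 'b option) \<Rightarrow> ('c \<Rightarrow> 'c option) \<Rightarrow> 'b \<times> 'c \<Rightarrow> ('b \<times> 'c) option" where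
  "tensor_f e2 f2 f1 = (\<lambda>(b2, b1).
     if depth e2 b2 \<ge> depth f1 b1 then map_option (\<lambda>b. (b, b1)) (f2 b2)
     else map_option (\<lambda>b. (b2, b)) (f1 b1))"

definition tensor_e ::
  "('b \<Rightarrow> 'b option) \<Rightarrow> ('c \<Rightarrow> 'c option) \<Rightarrow> ('c \<Rightarrow> 'c option) \<Rightarrow> 'b \<times> 'c \<Rightarrow> ('b \<times> 'c) option" where
  "tensor_e e2 e1 f1 = (\<lambda>(b2, b1).
     if depth e2 b2 > depth f1 b1 then map_option (\<lambda>b. (b, b1)) (e2 b2)
     else map_option (\<lambda>b. (b2, b)) (e1 b1))"

type_synonym word = "nat list"

definition letter_f :: "nat \<Rightarrow> nat \<Rightarrow> nat \<Rightarrow> nat option" where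
  "letter_f n i x = (if 1 \<le> i \<and> i \<le> 2*n - 1 \<and> x = i then Some (i + 1) else None)"

definition letter_e :: "nat \<Rightarrow> nat \<Rightarrow> nat \<Rightarrow> nat option" where
  "letter_e n i x = (if 1 \<le> i \<and> i \<le> 2*n - 1 \<and> x = i + 1 then Some i else None)"

text \<open>A word \<open>x\<^sub>1 x\<^sub>2 \<dots> x\<^sub>m\<close> is \<open>x\<^sub>1 \<otimes> (x\<^sub>2 \<otimes> \<dots>)\<close>; the operators on words of
  length \<open>m\<close> are defined by recursion on \<open>m\<close>.\<close>

primrec word_f_len :: "nat \<Rightarrow> nat \<Rightarrow> nat \<Rightarrow> word \<Rightarrow> word option" where
  "word_f_len n i 0 = (\<lambda>w. None)"
| "word_f_len n i (Suc m) = (\<lambda>w. map_option (\<lambda>(x, v). x # v)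
     (tensor_f (letter_e n i) (letter_f n i) (word_f_len n i m) (hd w, tl w)))"

primrec word_e_len :: "nat \<Rightarrow> nat \<Rightarrow> nat \<Rightarrow> word \<Rightarrow> word option" where
  "word_e_len n i 0 = (\<lambda>w. None)"
| "word_e_len n i (Suc m) = (\<lambda>w. map_option (\<lambda>(x, v). x # v)
     (tensor_e (letter_e n i) (word_e_len n i m) (word_f_len n i m) (hd w, tl w)))"

definition word_f :: "nat \<Rightarrow> nat \<Rightarrow> word \<Rightarrow> word option" where
  "word_f n i w = word_f_len n i (length w) w"

definition word_e :: "nat \<Rightarrow> nat \<Rightarrow> word \<Rightarrow> word option" where
  "word_e n i w = word_e_len n i (length w) w"

text \<open>Weights of type $A_{2n-1}$ are given by their coefficients on the fundamental weights
  \<open>\<Lambda>\<^sub>1\<^sup>A, \<dots>\<close>; the letter \<open>x\<close> has weight \<open>\<Lambda>\<^sub>x\<^sup>A - \<Lambda>\<^sub>x\<^sub>-\<^sub>1\<^sup>A\<close>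
  (with \<open>\<Lambda>\<^sub>0\<^sup>A\<close> and the weight of index $2n$ both zero).\<close>

definition wt_A :: "nat \<Rightarrow> word \<Rightarrow> nat \<Rightarrow> int" where
  "wt_A n w = (\<lambda>i. if 1 \<le> i \<and> i \<le> 2*n - 1
     then int (count_list w i) - int (count_list w (i + 1)) else 0)"

text \<open>A semistandard tableau is a list of its (nonempty) columns from left to right, each
  written as a strictly decreasing word, i.e. read from bottom to top; hence \<open>rev\<close> in the
  condition that the rows weakly increase.\<close>

definition semistandard :: "word list \<Rightarrow> bool" where
  "semistandard cs \<longleftrightarrow>
     (\<forall>c\<in>set cs. c \<noteq> [] \<and> sorted_wrt (>) c) \<and>
     (\<forall>j. Suc j < length cs \<longrightarrow>
        length (cs ! Suc j) \<le> length (cs ! j) \<and>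
        (\<forall>i < length (cs ! Suc j). rev (cs ! j) ! i \<le> rev (cs ! Suc j) ! i))"

definition tableau_word :: "word \<Rightarrow> bool" where
  "tableau_word t \<longleftrightarrow> (\<exists>cs. semistandard cs \<and> t = concat cs)"

inductive knuth :: "word \<Rightarrow> word \<Rightarrow> bool" where
  refl: "knuth w w"
| sym: "knuth v w \<Longrightarrow> knuth w v"
| trans: "knuth u v \<Longrightarrow> knuth v w \<Longrightarrow> knuth u w"
| yzx: "x < y \<Longrightarrow> y \<le> z \<Longrightarrow> knuth (u @ [y, z, x] @ v) (u @ [y, x, z] @ v)"
| xzy: "x \<le> y \<Longrightarrow> y < z \<Longrightarrow> knuth (u @ [x, z, y] @ v) (u @ [z, x, y] @ v)"

text \<open>The Schensted tableau of \<open>w\<close>, identified with its column-reading word.\<close>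

definition schensted :: "word \<Rightarrow> word" where
  "schensted w = (THE t. tableau_word t \<and> knuth w t)"

definition columns :: "nat \<Rightarrow> nat \<Rightarrow> word set" where
  "columns n s = {u. sorted_wrt (>) u \<and> set u \<subseteq> {1..2*n} \<and> length u = s}"

definition col_f :: "nat \<Rightarrow> nat \<Rightarrow> word \<Rightarrow> word option" where
  "col_f n i u =
     (if i = 0 then (if 2*n \<in> set u \<and> 1 \<notin> set u then Some (removeAll (2*n) u @ [1]) else None)
      else word_f n i u)"

definition col_e :: "nat \<Rightarrow> nat \<Rightarrow> word \<Rightarrow> word option" where
  "col_e n i u =
     (if i = 0 then (if 1 \<in> set u \<and> 2*n \<notin> set u then Some (2*n # removeAll 1 u) else None)
      else word_e n i u)"

definition tens_f :: "nat \<Rightarrow> nat \<Rightarrow> word \<times> word \<Rightarrow> (word \<times> word) option" where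
  "tens_f n i = tensor_f (col_e n i) (col_f n i) (col_f n i)"

definition tens_e :: "nat \<Rightarrow> nat \<Rightarrow> word \<times> word \<Rightarrow> (word \<times> word) option" where
  "tens_e n i = tensor_e (col_e n i) (col_e n i) (col_f n i)"

definition to_word :: "word \<times> word \<Rightarrow> word" where
  "to_word b = fst b @ snd b"

definition ambient :: "nat \<Rightarrow> nat \<Rightarrow> (word \<times> word) set" where
  "ambient n r = columns n (2*n - r) \<times> columns n r"

definition ambient_crystal :: "nat \<Rightarrow> nat \<Rightarrow> (word \<times> word, nat \<Rightarrow> int) crystal" where
  "ambient_crystal n r =
     \<lparr> Elts = ambient n r, Eop = tens_e n, Fop = tens_f n, Wt = (\<lambda>b. wt_A n (to_word b)) \<rparr>"

text \<open>Virtual operators built from type $A$ operators \<open>g\<close> (all \<open>e\<close> or all \<open>f\<close>).\<close>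

definition virtual :: "nat \<Rightarrow> (nat \<Rightarrow> 'b \<Rightarrow> 'b option) \<Rightarrow> nat \<Rightarrow> 'b \<Rightarrow> 'b option" where
  "virtual n g i b =
     (if i = 0 then g 0 b
      else if i < n then Option.bind (g i b) (g (2*n - i))
      else if i = n then Option.bind (g n b) (g n)
      else None)"

inductive_set generated ::
  "nat set \<Rightarrow> (nat \<Rightarrow> 'b \<Rightarrow> 'b option) \<Rightarrow> (nat \<Rightarrow> 'b \<Rightarrow> 'b option) \<Rightarrow> 'b \<Rightarrow> 'b set"
  for I :: "nat set" and e f :: "nat \<Rightarrow> 'b \<Rightarrow> 'b option" and b0 :: 'b where
  start: "b0 \<in> generated I e f b0"
| e_step: "b \<in> generated I e f b0 \<Longrightarrow> i \<in> I \<Longrightarrow> e i b = Some b' \<Longrightarrow> b' \<in> generated I e f b0"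
| f_step: "b \<in> generated I e f b0 \<Longrightarrow> i \<in> I \<Longrightarrow> f i b = Some b' \<Longrightarrow> b' \<in> generated I e f b0"

text \<open>Weights of type $C_n$ are given by their coefficients on \<open>\<Lambda>\<^sub>1, \<dots>, \<Lambda>\<^sub>n\<close>.\<close>

definition fund_A :: "nat \<Rightarrow> nat \<Rightarrow> int" where
  "fund_A i = (\<lambda>j. if j = i then 1 else 0)"

definition Psi_fund :: "nat \<Rightarrow> nat \<Rightarrow> nat \<Rightarrow> int" where
  "Psi_fund n i = (if i < n then (\<lambda>j. fund_A i j + fund_A (2*n - i) j) else (\<lambda>j. 2 * fund_A n j))"

definition Psi :: "nat \<Rightarrow> (nat \<Rightarrow> int) \<Rightarrow> nat \<Rightarrow> int" where
  "Psi n \<mu> = (\<lambda>j. \<Sum>i = 1..n. \<mu> i * Psi_fund n i j)"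

definition virtual_wt :: "nat \<Rightarrow> word \<Rightarrow> nat \<Rightarrow> int" where
  "virtual_wt n w = (THE \<mu>. (\<forall>i. i \<notin> {1..n} \<longrightarrow> \<mu> i = 0) \<and> Psi n \<mu> = wt_A n w)"

definition top_column :: "nat \<Rightarrow> word" where
  "top_column s = rev [1..<Suc s]"

text \<open>\<open>V\<^bsup>r,1\<^esup>\<close>; for its structure of $U_q(C_n)$-crystal use the index set \<open>{1..n}\<close>.\<close>

definition V :: "nat \<Rightarrow> nat \<Rightarrow> (word \<times> word, nat \<Rightarrow> int) crystal" where
  "V n r =
     \<lparr> Elts = generated {0..n} (virtual n (tens_e n)) (virtual n (tens_f n))
                (top_column (2*n - r), top_column r),
       Eop = virtual n (tens_e n), Fop = virtual n (tens_f n),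
       Wt = (\<lambda>b. virtual_wt n (to_word b)) \<rparr>"

text \<open>\<open>V(\<Lambda>\<^sub>k)\<close>; its elements are two-column tableaux, identified with their column-reading
  words.\<close>

definition V_Lambda :: "nat \<Rightarrow> nat \<Rightarrow> (word, nat \<Rightarrow> int) crystal" where
  "V_Lambda n k =
     \<lparr> Elts = generated {1..n} (virtual n (word_e n)) (virtual n (word_f n))
                (top_column (2*n - k) @ top_column k),
       Eop = virtual n (word_e n), Fop = virtual n (word_f n),
       Wt = virtual_wt n \<rparr>"

text \<open>A tableau with columns \<open>u, v\<close> of heights $2n-k$ and $k$, viewed as \<open>u \<otimes> v\<close>.\<close>

definition as_tensor :: "nat \<Rightarrow> nat \<Rightarrow> word \<Rightarrow> word \<times> word" where
  "as_tensor n k t = (take (2*n - k) t, drop (2*n - k) t)"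

definition aligned :: "nat \<Rightarrow> nat \<Rightarrow> bool" where
  "aligned n r \<longleftrightarrow> (\<forall>b\<in>Elts (V n r).
     (\<forall>i\<in>{1..n - 1}.
        depth (tens_f n i) b = depth (tens_f n (2*n - i)) b \<and>
        depth (tens_e n i) b = depth (tens_e n (2*n - i)) b) \<and>
     even (depth (tens_f n n) b) \<and> even (depth (tens_e n n) b))"

text \<open>One formula serves for all the maps \<open>V(\<Lambda>\<^sub>k) \<rightarrow> V\<^bsup>r,1\<^esup>\<close>, \<open>0 \<le> k \<le> r\<close>; the tableau \<open>t\<close> determines \<open>k\<close>.\<close>

definition iota :: "nat \<Rightarrow> nat \<Rightarrow> word \<Rightarrow> word \<times> word" where
  "iota n r t = (THE b. b \<in> ambient n r \<and> schensted (to_word b) = t)"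

text \<open>The embedding \<open>i\<^bsub>r,1\<^esub>\<close> of $U_q(A_{2n-1})$-crystals; \<open>extensional\<close> pins down the
  irrelevant values outside the domain.\<close>

definition i_map :: "nat \<Rightarrow> nat \<Rightarrow> word \<times> word \<Rightarrow> word \<times> word" where
  "i_map n r = (THE \<psi>. \<psi> \<in> extensional (ambient n r) \<and>
     crystal_embedding {1..2*n - 1} (ambient_crystal n r) (ambient_crystal n (r + 1)) \<psi> \<and>
     (\<forall>b\<in>ambient n r. schensted (to_word (\<psi> b)) = schensted (to_word b)))"

text \<open>The composite \<open>i\<^bsub>r-1,1\<^esub> \<circ> \<dots> \<circ> i\<^bsub>k,1\<^esub>\<close>, applied to tableaux.\<close>

definition i_composite :: "nat \<Rightarrow> nat \<Rightarrow> nat \<Rightarrow> word \<Rightarrow> word \<times> word" where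
  "i_composite n k r t = fold (i_map n) [k..<r] (as_tensor n k t)"

end

theory Submission
  imports Defs "HOL-Library.Sublist"
begin


text \<open>
  An element of \<open>V n r\<close> is a pair of columns, that is, of subsets of \<open>{1..2n}\<close>. Two independent
  arguments are combined.

  The first one determines the set \<open>V n r\<close>. Group the letters into pairs \<open>i\<close>, \<open>2n + 1 - i\<close>. Only five of
  the sixteen patterns in which two columns can meet such a pair occur, so that an element becomes
  a word of length \<open>n\<close> in five states. The words that occur are the \<open>admissible\<close> ones, which are given by
  a parenthesis condition, and on them the virtual operators are local rewritings
  (\<open>virtual_enc\<close>). From these tables one reads off that admissible words are closed under all
  operators, that they are aligned (\<open>aligned_enc\<close>), and that the highest weight words for the
  indices \<open>1, \<dots>, n\<close> are the words \<open>hw k r\<close> with \<open>0 \<le> k \<le> r\<close> (\<open>highest_weight_word\<close>). The number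
  \<open>r - k\<close> is an invariant of the component, and the operator of index \<open>0\<close> leads from each component to
  the next (\<open>hw_in_V\<close>). Hence \<open>V n r\<close> is the disjoint union of \<open>r + 1\<close> components \<open>comp n k r\<close>.

  The second argument compares \<open>comp n k r\<close> with the crystal of highest weight \<open>\<Lambda>\<^sub>k\<close>, which is
  \<open>comp n k k\<close>, without any formula for the maps. Type $A$ operators respect Knuth equivalence
  (\<open>knuth_crystal_sim\<close>), and a pair of columns of known heights is determined by its Knuth class
  (\<open>knuth_columns_unique\<close>): the class determines the content and, for every \<open>x\<close>, the longest strictly
  decreasing subsequence with letters at most \<open>x\<close>, and from these numbers the columns can be
  reconstructed. So a map between pairs of columns that preserves Knuth classes automatically
  commutes with all operators. Such maps exist because one letter can be moved from the first
  column to the second within the Knuth class as long as the first column is longer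
  (\<open>knuth_raise\<close>). Therefore \<open>i_map\<close>, its composites and \<open>iota\<close> all send a pair to the unique pair of the
  required heights in its class (\<open>transport\<close>). The highest weight words \<open>hw k r\<close> and \<open>hw k k\<close> are Knuth
  equivalent (\<open>kn_hw\<close>), so these maps carry \<open>comp n k k\<close> onto \<open>comp n k r\<close>. Moving letters in the
  opposite direction also shows that every class in question contains a tableau, and the same
  invariants show that it is unique, as the definition of \<open>schensted\<close> presupposes.
\<close>

section \<open>Crystal operators and string lengths\<close>

text \<open>The axioms of a seminormal crystal for a single index, with string lengths given by functions
  that can be computed. The function \<open>depth\<close>, a maximum over iterates, is recovered in
  \<open>regular_depth\<close>.\<close>

definition regular ::
  "'b set \<Rightarrow> ('b \<Rightarrow> 'b option) \<Rightarrow> ('b \<Rightarrow> 'b option) \<Rightarrow> ('b \<Rightarrow> nat) \<Rightarrow> ('b \<Rightarrow> nat) \<Rightarrow> bool" where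
  "regular S e f eps phi \<longleftrightarrow> (\<forall>b\<in>S.
     (f b = None \<longleftrightarrow> phi b = 0) \<and> (e b = None \<longleftrightarrow> eps b = 0) \<and>
     (\<forall>c. f b = Some c \<longrightarrow> c \<in> S \<and> e c = Some b \<and> phi b = Suc (phi c) \<and> eps c = Suc (eps b)) \<and>
     (\<forall>c. e b = Some c \<longrightarrow> c \<in> S \<and> f c = Some b \<and> eps b = Suc (eps c) \<and> phi c = Suc (phi b)))"

lemma iter_0 [simp]: "iter g 0 b = Some b"
  by (simp add: iter_def)

lemma iter_Suc: "iter g (Suc m) b = Option.bind (g b) (iter g m)"
proof -
  have "((\<lambda>x. Option.bind x g) ^^ m) None = None"
    by (induction m) simp_all
  then show ?thesis
    by (cases "g b") (simp_all add: iter_def funpow_Suc_right del: funpow.simps(2))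
qed

lemma depth_eqI:
  assumes step: "\<And>c. c \<in> S \<Longrightarrow> g c = None \<longleftrightarrow> p c = 0"
    "\<And>c d. c \<in> S \<Longrightarrow> g c = Some d \<Longrightarrow> d \<in> S \<and> p c = Suc (p d)"
    and "b \<in> S"
  shows "depth g b = p b"
proof -
  have "iter g m b \<noteq> None \<longleftrightarrow> m \<le> p b" for m using \<open>b \<in> S\<close>
  proof (induction m arbitrary: b)
    case (Suc m)
    show ?case
    proof (cases "g b")
      case None
      then show ?thesis using step(1)[OF Suc.prems] by (simp add: iter_Suc)
    next
      case (Some d)
      then show ?thesis using step(2)[OF Suc.prems Some] Suc.IH[of d] by (simp add: iter_Suc)
    qed
  qed simp
  then have "{m. iter g m b \<noteq> None} = {..p b}" by (simp only: atMost_def)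
  then show ?thesis unfolding depth_def by (simp add: Max_eq_iff)
qed

lemma regularD:
  assumes "regular S e f eps phi" and "b \<in> S"
  shows "f b = None \<longleftrightarrow> phi b = 0" and "e b = None \<longleftrightarrow> eps b = 0"
    and "f b = Some c \<Longrightarrow> c \<in> S \<and> e c = Some b \<and> phi b = Suc (phi c) \<and> eps c = Suc (eps b)"
    and "e b = Some c \<Longrightarrow> c \<in> S \<and> f c = Some b \<and> eps b = Suc (eps c) \<and> phi c = Suc (phi b)"
  using assms unfolding regular_def by blast+

lemma regular_depth:
  assumes "regular S e f eps phi" and "b \<in> S"
  shows "depth f b = phi b" and "depth e b = eps b"
proof -
  show "depth f b = phi b"
    by (rule depth_eqI[of S]) (use regularD[OF assms(1)] assms(2) in blast)+
  show "depth e b = eps b"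
    by (rule depth_eqI[of S]) (use regularD[OF assms(1)] assms(2) in blast)+
qed

lemma regularI:
  assumes "\<And>b. b \<in> S \<Longrightarrow> f b = None \<longleftrightarrow> phi b = 0"
    and "\<And>b. b \<in> S \<Longrightarrow> e b = None \<longleftrightarrow> eps b = 0"
    and "\<And>b c. b \<in> S \<Longrightarrow> f b = Some c \<Longrightarrow> c \<in> S \<and> e c = Some b \<and> phi b = Suc (phi c) \<and> eps c = Suc (eps b)"
    and "\<And>b c. b \<in> S \<Longrightarrow> e b = Some c \<Longrightarrow> c \<in> S \<and> f c = Some b \<and> eps b = Suc (eps c) \<and> phi c = Suc (phi b)"
  shows "regular S e f eps phi"
  unfolding regular_def using assms by blast

text \<open>The sign of \<open>eps2 b2 - phi1 b1\<close> decides which factor an operator hits. After an \<open>f\<close>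
  the inverse \<open>e\<close> falls on the same factor, because one rule compares with \<open>\<ge>\<close>, the other with
  \<open>>\<close>, and the step changes the difference by one.\<close>

lemma regular_tensor:
  assumes r2: "regular S2 e2 f2 eps2 phi2" and r1: "regular S1 e1 f1 eps1 phi1"
  shows "regular (S2 \<times> S1) (tensor_e e2 e1 f1) (tensor_f e2 f2 f1)
    (\<lambda>(b2, b1). eps1 b1 + (eps2 b2 - phi1 b1)) (\<lambda>(b2, b1). phi2 b2 + (phi1 b1 - eps2 b2))"
    (is "regular _ ?e ?f ?eps ?phi")
proof (rule regularI)
  have d: "b \<in> S2 \<Longrightarrow> depth e2 b = eps2 b" "c \<in> S1 \<Longrightarrow> depth f1 c = phi1 c" for b c
    using regular_depth[OF r2] regular_depth[OF r1] by auto
  fix b assume "b \<in> S2 \<times> S1"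
  then obtain b2 b1 where b: "b = (b2, b1)" "b2 \<in> S2" "b1 \<in> S1" by blast
  note R2 = regularD[OF r2 b(2)] and R1 = regularD[OF r1 b(3)]
  show "?f b = None \<longleftrightarrow> ?phi b = 0"
    by (simp add: b tensor_f_def d R1(1) R2(1))
  show "?e b = None \<longleftrightarrow> ?eps b = 0"
    by (simp add: b tensor_e_def d R1(2) R2(2))
  fix c
  show "c \<in> S2 \<times> S1 \<and> ?e c = Some b \<and> ?phi b = Suc (?phi c) \<and> ?eps c = Suc (?eps b)" if c: "?f b = Some c"
  proof (cases "phi1 b1 \<le> eps2 b2")
    case True
    then obtain c2 where c2: "f2 b2 = Some c2" "c = (c2, b1)"
      using c by (auto simp: b tensor_f_def d)
    show ?thesis using R2(3)[OF c2(1)] True b c2(2) by (simp add: tensor_e_def d)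
  next
    case False
    then obtain c1 where c1: "f1 b1 = Some c1" "c = (b2, c1)"
      using c by (auto simp: b tensor_f_def d)
    show ?thesis using R1(3)[OF c1(1)] False b c1(2) by (simp add: tensor_e_def d)
  qed
  show "c \<in> S2 \<times> S1 \<and> ?f c = Some b \<and> ?eps b = Suc (?eps c) \<and> ?phi c = Suc (?phi b)" if c: "?e b = Some c"
  proof (cases "phi1 b1 < eps2 b2")
    case True
    then obtain c2 where c2: "e2 b2 = Some c2" "c = (c2, b1)"
      using c by (auto simp: b tensor_e_def d)
    show ?thesis using R2(4)[OF c2(1)] True b c2(2) by (simp add: tensor_f_def d)
  next
    case False
    then obtain c1 where c1: "e1 b1 = Some c1" "c = (b2, c1)"
      using c by (auto simp: b tensor_e_def d)
    show ?thesis using R1(4)[OF c1(1)] False b c1(2) by (simp add: tensor_f_def d)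
  qed
qed

text \<open>A map that commutes with the operators sends defined iterates to defined iterates and
  undefined ones to undefined ones.\<close>

lemma depth_intertwine:
  assumes "\<And>c. c \<in> S \<Longrightarrow> h (\<psi> c) = map_option \<psi> (g c)"
    and "\<And>c d. c \<in> S \<Longrightarrow> g c = Some d \<Longrightarrow> d \<in> S" and "b \<in> S"
  shows "depth h (\<psi> b) = depth g b"
proof -
  have "iter h m (\<psi> b) = None \<longleftrightarrow> iter g m b = None" for m using \<open>b \<in> S\<close>
  proof (induction m arbitrary: b)
    case (Suc m)
    then show ?case using assms(1,2) by (cases "g b") (auto simp: iter_Suc)
  qed simp
  then show ?thesis by (simp add: depth_def)
qed

section \<open>Words as iterated tensor products\<close>

text \<open>Together with \<open>leps\<close>, \<open>wphi\<close> and \<open>weps\<close> below these are the string lengths of letters and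
  words, obtained by unrolling the formula for tensor products.\<close>

definition lphi :: "nat \<Rightarrow> nat \<Rightarrow> nat \<Rightarrow> nat" where
  "lphi n i x = of_bool (1 \<le> i \<and> i \<le> 2*n - 1 \<and> x = i)"

definition leps :: "nat \<Rightarrow> nat \<Rightarrow> nat \<Rightarrow> nat" where
  "leps n i x = of_bool (1 \<le> i \<and> i \<le> 2*n - 1 \<and> x = i + 1)"

primrec wphi :: "nat \<Rightarrow> nat \<Rightarrow> word \<Rightarrow> nat" where
  "wphi n i [] = 0"
| "wphi n i (x # v) = lphi n i x + (wphi n i v - leps n i x)"

primrec weps :: "nat \<Rightarrow> nat \<Rightarrow> word \<Rightarrow> nat" where
  "weps n i [] = 0"
| "weps n i (x # v) = weps n i v + (leps n i x - wphi n i v)"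

lemma regular_letter: "regular UNIV (letter_e n i) (letter_f n i) (leps n i) (lphi n i)"
  by (rule regularI) (auto simp: letter_e_def letter_f_def leps_def lphi_def split: if_splits)

text \<open>The operators on words are defined for one length at a time, and so is regularity proved. It
  evaluates the \<open>depth\<close> in the tensor rule, which gives the recursions \<open>word_f_Cons\<close> and
  \<open>word_e_Cons\<close>.\<close>

lemma regular_word_len:
  "regular {w. length w = m} (word_e_len n i m) (word_f_len n i m) (weps n i) (wphi n i)"
proof (induction m)
  case 0
  then show ?case by (simp add: regular_def)
next
  case (Suc m)
  show ?case
  proof (rule regularI)
    fix b :: word assume "b \<in> {w. length w = Suc m}"
    then obtain x v where b: "b = x # v" "length v = m" by (cases b) auto
    then have "(x, v) \<in> UNIV \<times> {w. length w = m}" by simp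
    note T = regularD[OF regular_tensor[OF regular_letter Suc.IH] this, of n i]
    show "word_f_len n i (Suc m) b = None \<longleftrightarrow> wphi n i b = 0" using T(1) b by simp
    show "word_e_len n i (Suc m) b = None \<longleftrightarrow> weps n i b = 0" using T(2) b by simp
    fix c
    show "c \<in> {w. length w = Suc m} \<and> word_e_len n i (Suc m) c = Some b \<and>
        wphi n i b = Suc (wphi n i c) \<and> weps n i c = Suc (weps n i b)"
      if c: "word_f_len n i (Suc m) b = Some c"
    proof -
      obtain y v' where "tensor_f (letter_e n i) (letter_f n i) (word_f_len n i m) (x, v) = Some (y, v')"
        "c = y # v'" using c b by auto
      then show ?thesis using T(3)[of "(y, v')"] b by simp
    qed
    show "c \<in> {w. length w = Suc m} \<and> word_f_len n i (Suc m) c = Some b \<and>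
        weps n i b = Suc (weps n i c) \<and> wphi n i c = Suc (wphi n i b)"
      if c: "word_e_len n i (Suc m) b = Some c"
    proof -
      obtain y v' where "tensor_e (letter_e n i) (word_e_len n i m) (word_f_len n i m) (x, v) = Some (y, v')"
        "c = y # v'" using c b by auto
      then show ?thesis using T(4)[of "(y, v')"] b by simp
    qed
  qed
qed

lemma regular_word: "regular UNIV (word_e n i) (word_f n i) (weps n i) (wphi n i)"
proof (rule regularI)
  fix b c :: word
  have "b \<in> {w. length w = length b}" by simp
  note T = regularD[OF regular_word_len this, of n i]
  show "word_f n i b = None \<longleftrightarrow> wphi n i b = 0" "word_e n i b = None \<longleftrightarrow> weps n i b = 0"
    using T(1,2) by (simp_all add: word_f_def word_e_def)
  show "word_f n i b = Some c \<Longrightarrow> c \<in> UNIV \<and> word_e n i c = Some b \<and>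
      wphi n i b = Suc (wphi n i c) \<and> weps n i c = Suc (weps n i b)"
    using T(3)[of c] by (simp add: word_f_def word_e_def)
  show "word_e n i b = Some c \<Longrightarrow> c \<in> UNIV \<and> word_f n i c = Some b \<and>
      weps n i b = Suc (weps n i c) \<and> wphi n i c = Suc (wphi n i b)"
    using T(4)[of c] by (simp add: word_f_def word_e_def)
qed

lemma word_f_Nil [simp]: "word_f n i [] = None" and word_e_Nil [simp]: "word_e n i [] = None"
  by (simp_all add: word_f_def word_e_def)

lemma word_f_Cons [simp]: "word_f n i (x # v) =
    (if wphi n i v \<le> leps n i x then map_option (\<lambda>y. y # v) (letter_f n i x)
     else map_option ((#) x) (word_f n i v))"
  using regular_depth[OF regular_letter[of n i], of x]
    regular_depth[OF regular_word_len[of "length v" n i], of v]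
  by (simp add: word_f_def tensor_f_def option.map_comp o_def)

lemma word_e_Cons [simp]: "word_e n i (x # v) =
    (if wphi n i v < leps n i x then map_option (\<lambda>y. y # v) (letter_e n i x)
     else map_option ((#) x) (word_e n i v))"
  using regular_depth[OF regular_letter[of n i], of x]
    regular_depth[OF regular_word_len[of "length v" n i], of v]
  by (simp add: word_e_def tensor_e_def option.map_comp o_def)

lemma weps_wphi_append:
  "wphi n i (u @ v) = wphi n i u + (wphi n i v - weps n i u)"
  "weps n i (u @ v) = weps n i v + (weps n i u - wphi n i v)"
  by (induction u) auto

text \<open>Associativity of the tensor product: a word may be cut into two factors at any place. This is
  what makes the operators on pairs of columns agree with those on the concatenated words.\<close>

lemma word_f_append: "word_f n i (u @ v) =
    (if wphi n i v \<le> weps n i u then map_option (\<lambda>u'. u' @ v) (word_f n i u)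
     else map_option ((@) u) (word_f n i v))"
proof (induction u)
  case (Cons x u)
  have "leps n i x \<noteq> 0 \<Longrightarrow> letter_f n i x = None" by (auto simp: leps_def letter_f_def)
  moreover have "wphi n i u = 0 \<longleftrightarrow> word_f n i u = None"
    using regularD(1)[OF regular_word] by simp
  ultimately show ?case using Cons
    by (auto simp: weps_wphi_append option.map_comp o_def)
next
  case Nil
  have "wphi n i v = 0 \<longleftrightarrow> word_f n i v = None"
    using regularD(1)[OF regular_word] by simp
  then show ?case by (cases "word_f n i v") auto
qed

lemma word_e_append: "word_e n i (u @ v) =
    (if wphi n i v < weps n i u then map_option (\<lambda>u'. u' @ v) (word_e n i u)
     else map_option ((@) u) (word_e n i v))"
proof (induction u)
  case (Cons x u)
  then show ?case
    by (auto simp: weps_wphi_append option.map_comp o_def)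
next
  case Nil
  then show ?case by (cases "word_e n i v") auto
qed

section \<open>Columns as sets of letters\<close>

definition col :: "nat set \<Rightarrow> word" where
  "col U = rev (sorted_list_of_set U)"

lemma set_col [simp]: "finite U \<Longrightarrow> set (col U) = U"
  by (simp add: col_def)

lemma length_col [simp]: "length (col U) = card U"
  by (simp add: col_def)

lemma sorted_col [simp]: "sorted_wrt (>) (col U)"
  using strict_sorted_list_of_set[of U] by (simp add: col_def sorted_wrt_rev)

lemma sorted_gt_unique:
  fixes u v :: word
  assumes "sorted_wrt (>) u" "sorted_wrt (>) v" "set u = set v" shows "u = v"
proof -
  have "sorted_wrt (<) (rev u)" "sorted_wrt (<) (rev v)"
    using assms by (simp_all add: sorted_wrt_rev)
  then have "rev u = rev v" using assms(3) by (metis set_rev strict_sorted_equal)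
  then show ?thesis by simp
qed

lemma col_set: "sorted_wrt (>) u \<Longrightarrow> col (set u) = u"
  by (rule sorted_gt_unique) auto

lemma columns_col: "U \<subseteq> {1..2*n} \<Longrightarrow> card U = s \<Longrightarrow> col U \<in> columns n s"
  using finite_subset[of U "{1..2*n}"] by (auto simp: columns_def)

lemma columnsE:
  assumes "u \<in> columns n s"
  obtains U where "U \<subseteq> {1..2*n}" "card U = s" "u = col U" "finite U"
proof
  show "set u \<subseteq> {1..2*n}" "u = col (set u)" "finite (set u)" 
    using assms by (auto simp: columns_def col_set)
  show "card (set u) = s" using assms length_col[of "set u"] col_set[of u] by (simp add: columns_def)
qed

text \<open>In a strictly decreasing word \<open>Suc i\<close> stands immediately to the left of \<open>i\<close> if both occur, and
  then the two letters cancel in the tensor rule. So at most one letter can change.\<close>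

lemma word_ops_column:
  assumes "sorted_wrt (>) w" and "1 \<le> i" and "i \<le> 2*n - 1"
  shows "wphi n i w = of_bool (i \<in> set w \<and> Suc i \<notin> set w)"
    and "weps n i w = of_bool (Suc i \<in> set w \<and> i \<notin> set w)"
    and "word_f n i w = (if i \<in> set w \<and> Suc i \<notin> set w
           then Some (map (\<lambda>y. if y = i then Suc i else y) w) else None)"
    and "word_e n i w = (if Suc i \<in> set w \<and> i \<notin> set w
           then Some (map (\<lambda>y. if y = Suc i then i else y) w) else None)"
proof -
  have "wphi n i w = of_bool (i \<in> set w \<and> Suc i \<notin> set w) \<and>
     weps n i w = of_bool (Suc i \<in> set w \<and> i \<notin> set w) \<and>
     word_f n i w = (if i \<in> set w \<and> Suc i \<notin> set w
           then Some (map (\<lambda>y. if y = i then Suc i else y) w) else None) \<and>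
     word_e n i w = (if Suc i \<in> set w \<and> i \<notin> set w
           then Some (map (\<lambda>y. if y = Suc i then i else y) w) else None)"
    using assms(1)
  proof (induction w)
    case (Cons x v)
    have id: "i \<notin> set v \<Longrightarrow> map (\<lambda>y. if y = i then Suc i else y) v = v"
      "Suc i \<notin> set v \<Longrightarrow> map (\<lambda>y. if y = Suc i then i else y) v = v"
      by (auto intro!: map_idI)
    consider "x = i" | "x = Suc i" | "x \<noteq> i" "x \<noteq> Suc i" by blast
    then show ?case
    proof cases
      case 1
      then have "i \<notin> set v" "Suc i \<notin> set v" using Cons.prems by auto
      then show ?thesis using Cons 1 assms(2,3) id
        by (auto simp: lphi_def leps_def letter_f_def letter_e_def)
    next
      case 2
      then have "Suc i \<notin> set v" using Cons.prems by auto
      then show ?thesis using Cons 2 assms(2,3) id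
        by (auto simp: lphi_def leps_def letter_f_def letter_e_def)
    next
      case 3
      then show ?thesis using Cons
        by (auto simp: lphi_def leps_def letter_f_def letter_e_def)
    qed
  qed auto
  then show "wphi n i w = of_bool (i \<in> set w \<and> Suc i \<notin> set w)"
    and "weps n i w = of_bool (Suc i \<in> set w \<and> i \<notin> set w)"
    and "word_f n i w = (if i \<in> set w \<and> Suc i \<notin> set w
           then Some (map (\<lambda>y. if y = i then Suc i else y) w) else None)"
    and "word_e n i w = (if Suc i \<in> set w \<and> i \<notin> set w
           then Some (map (\<lambda>y. if y = Suc i then i else y) w) else None)"
    by blast+
qed

lemma sorted_gt_map_replace:
  fixes w :: word
  assumes "sorted_wrt (>) w" "b \<notin> set w" "\<forall>y\<in>set w. y \<noteq> a \<longrightarrow> (y < a \<longleftrightarrow> y < b)"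
  shows "sorted_wrt (>) (map (\<lambda>y. if y = a then b else y) w)"
  unfolding sorted_wrt_map
proof (rule sorted_wrt_mono_rel[OF _ assms(1)])
  fix x y assume xy: "x \<in> set w" "y \<in> set w" "x > y"
  then have "x \<noteq> b" "x \<noteq> a \<Longrightarrow> x < a \<longleftrightarrow> x < b" "y \<noteq> a \<Longrightarrow> y < a \<longleftrightarrow> y < b"
    using assms(2,3) by auto
  then show "(if x = a then b else x) > (if y = a then b else y)" using xy by auto
qed

text \<open>The operators of index \<open>i\<close> exchange the letters \<open>src n i\<close> and \<open>Suc i\<close>; for \<open>i = 0\<close> these are
  \<open>2n\<close> and \<open>1\<close>. In this form the affine index needs no separate treatment for pairs of columns.\<close>

definition src :: "nat \<Rightarrow> nat \<Rightarrow> nat" where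
  "src n i = (if i = 0 then 2*n else i)"

definition col_phi :: "nat \<Rightarrow> nat \<Rightarrow> nat set \<Rightarrow> nat" where
  "col_phi n i U = of_bool (src n i \<in> U \<and> Suc i \<notin> U)"

definition col_eps :: "nat \<Rightarrow> nat \<Rightarrow> nat set \<Rightarrow> nat" where
  "col_eps n i U = of_bool (Suc i \<in> U \<and> src n i \<notin> U)"

lemma col_f_col:
  assumes U: "U \<subseteq> {1..2*n}" and i: "i \<le> 2*n - 1" "n \<ge> 1"
  shows "col_f n i (col U) = (if src n i \<in> U \<and> Suc i \<notin> U
     then Some (col (insert (Suc i) (U - {src n i}))) else None)"
proof (cases "src n i \<in> U \<and> Suc i \<notin> U")
  case True
  have fin: "finite U" using U finite_subset by blast
  show ?thesis
  proof (cases "i = 0")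
    case i0: True
    have ge: "1 < y" if "y \<in> U" for y
      using that U True i0 by (metis One_nat_def atLeastAtMost_iff le_neq_implies_less subsetD)
    have "removeAll (2*n) (col U) @ [1] = col (insert 1 (U - {2*n}))"
      by (rule sorted_gt_unique)
        (use fin True i0 ge in \<open>auto simp: sorted_wrt_append removeAll_filter_not_eq sorted_wrt_filter src_def\<close>)
    then show ?thesis using True i0 fin by (simp add: col_f_def src_def)
  next
    case False
    have "map (\<lambda>y. if y = i then Suc i else y) (col U) = col (insert (Suc i) (U - {i}))"
    proof (rule sorted_gt_unique)
      show "sorted_wrt (>) (map (\<lambda>y. if y = i then Suc i else y) (col U))"
        by (rule sorted_gt_map_replace) (use True False fin in \<open>auto simp: src_def less_Suc_eq\<close>)
    qed (use True False fin in \<open>auto simp: src_def\<close>)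
    then show ?thesis using True False fin word_ops_column(3)[of "col U" i n] i
      by (simp add: col_f_def src_def)
  qed
next
  case F: False
  have fin: "finite U" using U finite_subset by blast
  then show ?thesis using F word_ops_column(3)[of "col U" i n] i
    by (cases "i = 0") (auto simp: col_f_def src_def)
qed

lemma col_e_col:
  assumes U: "U \<subseteq> {1..2*n}" and i: "i \<le> 2*n - 1" "n \<ge> 1"
  shows "col_e n i (col U) = (if Suc i \<in> U \<and> src n i \<notin> U
     then Some (col (insert (src n i) (U - {Suc i}))) else None)"
proof (cases "Suc i \<in> U \<and> src n i \<notin> U")
  case True
  have fin: "finite U" using U finite_subset by blast
  show ?thesis
  proof (cases "i = 0")
    case i0: True
    have le: "y \<in> U \<Longrightarrow> y < 2*n" for y using U True i0 
      by (metis atLeastAtMost_iff le_neq_implies_less src_def subsetD)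
    have "2*n # removeAll 1 (col U) = col (insert (2*n) (U - {1}))"
      by (rule sorted_gt_unique)
        (use fin U True i0 le in \<open>auto simp: removeAll_filter_not_eq sorted_wrt_filter src_def\<close>)
    then show ?thesis using True i0 fin by (simp add: col_e_def src_def)
  next
    case False
    have "map (\<lambda>y. if y = Suc i then i else y) (col U) = col (insert i (U - {Suc i}))"
    proof (rule sorted_gt_unique)
      show "sorted_wrt (>) (map (\<lambda>y. if y = Suc i then i else y) (col U))"
        by (rule sorted_gt_map_replace) (use True False fin in \<open>auto simp: src_def less_Suc_eq\<close>)
    qed (use True False fin in \<open>auto simp: src_def\<close>)
    then show ?thesis using True False fin word_ops_column(4)[of "col U" i n] i
      by (simp add: col_e_def src_def)
  qed
next
  case F: False
  have fin: "finite U" using U finite_subset by blast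
  then show ?thesis using F word_ops_column(4)[of "col U" i n] i
    by (cases "i = 0") (auto simp: col_e_def src_def)
qed

lemma regular_columns:
  assumes i: "i \<le> 2*n - 1" "n \<ge> 1"
  shows "regular (columns n s) (col_e n i) (col_f n i) (\<lambda>u. col_eps n i (set u)) (\<lambda>u. col_phi n i (set u))"
proof (rule regularI)
  fix b assume "b \<in> columns n s"
  then obtain U where U: "U \<subseteq> {1..2*n}" "card U = s" "b = col U" "finite U" by (elim columnsE)
  have ne: "src n i \<noteq> Suc i" "src n i \<in> {1..2*n}" "Suc i \<in> {1..2*n}" using i by (auto simp: src_def)
  show "col_f n i b = None \<longleftrightarrow> col_phi n i (set b) = 0"
    using U(4) by (simp add: col_f_col[OF U(1) i] U(3) col_phi_def)
  show "col_e n i b = None \<longleftrightarrow> col_eps n i (set b) = 0"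
    using U(4) by (simp add: col_e_col[OF U(1) i] U(3) col_eps_def)
  fix c
  show "c \<in> columns n s \<and> col_e n i c = Some b \<and> col_phi n i (set b) = Suc (col_phi n i (set c)) \<and>
      col_eps n i (set c) = Suc (col_eps n i (set b))" if "col_f n i b = Some c"
  proof -
    define U' where "U' = insert (Suc i) (U - {src n i})"
    have *: "src n i \<in> U" "Suc i \<notin> U" and c: "c = col U'"
      using that by (auto simp: col_f_col[OF U(1) i] U(3) U'_def split: if_splits)
    have U': "U' \<subseteq> {1..2*n}" "finite U'" "src n i \<notin> U'" "Suc i \<in> U'"
      using U ne by (auto simp: U'_def)
    have "card U > 0" using U * by (auto simp: card_gt_0_iff)
    then have "card U' = s" using U * by (simp add: U'_def)
    moreover have "insert (src n i) (U' - {Suc i}) = U" using * by (auto simp: U'_def)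
    ultimately show ?thesis using U' * U(4) columns_col[OF U'(1)]
      by (simp add: c col_e_col[OF U'(1) i] U(3) col_eps_def col_phi_def)
  qed
  show "c \<in> columns n s \<and> col_f n i c = Some b \<and> col_eps n i (set b) = Suc (col_eps n i (set c)) \<and>
      col_phi n i (set c) = Suc (col_phi n i (set b))" if "col_e n i b = Some c"
  proof -
    define U' where "U' = insert (src n i) (U - {Suc i})"
    have *: "Suc i \<in> U" "src n i \<notin> U" and c: "c = col U'"
      using that by (auto simp: col_e_col[OF U(1) i] U(3) U'_def split: if_splits)
    have U': "U' \<subseteq> {1..2*n}" "finite U'" "Suc i \<notin> U'" "src n i \<in> U'"
      using U ne by (auto simp: U'_def)
    have "card U > 0" using U * by (auto simp: card_gt_0_iff)
    then have "card U' = s" using U * by (simp add: U'_def)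
    moreover have "insert (Suc i) (U' - {src n i}) = U" using * by (auto simp: U'_def)
    ultimately show ?thesis using U' * U(4) columns_col[OF U'(1)]
      by (simp add: c col_f_col[OF U'(1) i] U(3) col_eps_def col_phi_def)
  qed
qed

lemma regular_ambient:
  assumes "i \<le> 2*n - 1" "n \<ge> 1"
  shows "regular (ambient n r) (tens_e n i) (tens_f n i)
    (\<lambda>(u, v). col_eps n i (set v) + (col_eps n i (set u) - col_phi n i (set v)))
    (\<lambda>(u, v). col_phi n i (set u) + (col_phi n i (set v) - col_eps n i (set u)))"
  unfolding ambient_def tens_e_def tens_f_def
  by (rule regular_tensor regular_columns assms)+

lemma tens_col:
  assumes U: "A \<subseteq> {1..2*n}" and V: "B \<subseteq> {1..2*n}" and i: "i \<le> 2*n - 1" "n \<ge> 1"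
  shows "tens_f n i (col A, col B) =
      (if col_phi n i B \<le> col_eps n i A
       then if src n i \<in> A \<and> Suc i \<notin> A then Some (col (insert (Suc i) (A - {src n i})), col B) else None
       else Some (col A, col (insert (Suc i) (B - {src n i}))))"
    and "tens_e n i (col A, col B) =
      (if col_phi n i B < col_eps n i A
       then Some (col (insert (src n i) (A - {Suc i})), col B)
       else if Suc i \<in> B \<and> src n i \<notin> B then Some (col A, col (insert (src n i) (B - {Suc i}))) else None)"
proof -
  have fin: "finite A" "finite B" using U V finite_subset by blast+
  have "depth (col_e n i) (col A) = col_eps n i A" "depth (col_f n i) (col B) = col_phi n i B"
    using regular_depth[OF regular_columns[OF i]] columns_col[OF U] columns_col[OF V] fin
    by auto
  note D = this
  have "\<not> col_phi n i B \<le> col_eps n i A \<Longrightarrow> src n i \<in> B \<and> Suc i \<notin> B"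
    by (rule ccontr) (simp add: col_phi_def)
  then show "tens_f n i (col A, col B) =
      (if col_phi n i B \<le> col_eps n i A
       then if src n i \<in> A \<and> Suc i \<notin> A then Some (col (insert (Suc i) (A - {src n i})), col B) else None
       else Some (col A, col (insert (Suc i) (B - {src n i}))))"
    by (simp add: tens_f_def tensor_f_def D col_f_col[OF U i] col_f_col[OF V i])
  have "col_phi n i B < col_eps n i A \<Longrightarrow> Suc i \<in> A \<and> src n i \<notin> A"
    by (rule ccontr) (simp add: col_eps_def)
  then show "tens_e n i (col A, col B) =
      (if col_phi n i B < col_eps n i A
       then Some (col (insert (src n i) (A - {Suc i})), col B)
       else if Suc i \<in> B \<and> src n i \<notin> B then Some (col A, col (insert (src n i) (B - {Suc i}))) else None)"
    by (simp add: tens_e_def tensor_e_def D col_e_col[OF U i] col_e_col[OF V i])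
qed

lemma to_word_tens:
  assumes "b \<in> ambient n r" "1 \<le> i" "i \<le> 2*n - 1"
  shows "word_f n i (to_word b) = map_option to_word (tens_f n i b)"
    and "word_e n i (to_word b) = map_option to_word (tens_e n i b)"
proof -
  obtain u v where b: "b = (u, v)" by fastforce
  have d: "depth (col_e n i) u = weps n i u" "depth (col_f n i) v = wphi n i v" 
    using assms(2) regular_depth[OF regular_word, of u n i] regular_depth[OF regular_word, of v n i]
    by (simp_all add: col_e_def col_f_def[abs_def] col_e_def[abs_def] depth_def iter_def)
  show "word_f n i (to_word b) = map_option to_word (tens_f n i b)"
    "word_e n i (to_word b) = map_option to_word (tens_e n i b)"
    using assms(2) b d
    by (auto simp: to_word_def word_f_append word_e_append tens_f_def tens_e_def tensor_f_def tensor_e_def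
        option.map_comp o_def col_e_def[abs_def] col_f_def[abs_def])
qed

lemma tens_ambient:
  assumes "b \<in> ambient n r" "i \<le> 2*n - 1" "n \<ge> 1"
  shows "tens_f n i b = Some c \<Longrightarrow> c \<in> ambient n r \<and> tens_e n i c = Some b"
    and "tens_e n i b = Some c \<Longrightarrow> c \<in> ambient n r \<and> tens_f n i c = Some b"
  using regularD(3,4)[OF regular_ambient[OF assms(2,3)] assms(1)] by blast+

lemma depth_tens:
  assumes "b \<in> ambient n r" "1 \<le> i" "i \<le> 2*n - 1"
  shows "depth (tens_f n i) b = wphi n i (to_word b)"
    and "depth (tens_e n i) b = weps n i (to_word b)"
proof -
  have n: "n \<ge> 1" using assms by auto
  have "depth (word_f n i) (to_word b) = depth (tens_f n i) b"
    by (rule depth_intertwine[of "ambient n r"])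
      (use to_word_tens tens_ambient assms n in blast)+
  then show "depth (tens_f n i) b = wphi n i (to_word b)"
    using regular_depth[OF regular_word] by simp
  have "depth (word_e n i) (to_word b) = depth (tens_e n i) b"
    by (rule depth_intertwine[of "ambient n r"])
      (use to_word_tens tens_ambient assms n in blast)+
  then show "depth (tens_e n i) b = weps n i (to_word b)"
    using regular_depth[OF regular_word] by simp
qed


section \<open>Knuth equivalence and its invariants\<close>

lemma knuth_context: "knuth w w' \<Longrightarrow> knuth (p @ w @ q) (p @ w' @ q)"
proof (induction rule: knuth.induct)
  case (yzx x y z u v)
  then show ?case using knuth.yzx[of x y z "p @ u" "v @ q"] by simp
next
  case (xzy x y z u v)
  then show ?case using knuth.xzy[of x y z "p @ u" "v @ q"] by simp
qed (blast intro: knuth.refl knuth.sym knuth.trans)+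

lemma knuth_count: "knuth w w' \<Longrightarrow> count_list w y = count_list w' y"
  by (induction rule: knuth.induct) auto

text \<open>Letters above a bound can be dropped: in an elementary relation the letter \<open>z\<close> is dropped
  no later than \<open>x\<close> and \<open>y\<close>, and without it both sides are the same word.\<close>

lemma knuth_filter_le: "knuth w w' \<Longrightarrow> knuth (filter (\<lambda>y. y \<le> m) w) (filter (\<lambda>y. y \<le> m) w')"
proof (induction rule: knuth.induct)
  case (yzx x y z u v)
  then show ?case using knuth.yzx[of x y z "filter (\<lambda>y. y \<le> m) u" "filter (\<lambda>y. y \<le> m) v"]
    by (auto intro: knuth.refl)
next
  case (xzy x y z u v)
  then show ?case using knuth.xzy[of x y z "filter (\<lambda>y. y \<le> m) u" "filter (\<lambda>y. y \<le> m) v"]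
    by (auto intro: knuth.refl)
qed (blast intro: knuth.refl knuth.sym knuth.trans)+

subsection \<open>Monotone subsequences\<close>

definition has_seq :: "(nat \<Rightarrow> nat \<Rightarrow> bool) \<Rightarrow> word \<Rightarrow> nat \<Rightarrow> bool" where
  "has_seq R w m \<longleftrightarrow> (\<exists>s. subseq s w \<and> sorted_wrt R s \<and> length s = m)"

text \<open>As a factor of any word, \<open>a\<close> can be exchanged for \<open>a'\<close> without shortening the longest
  \<open>R\<close>-chains: whatever part of a chain lies in \<open>a\<close> has a substitute in \<open>a'\<close> that fits the same
  neighbours.\<close>

definition replaceable :: "(nat \<Rightarrow> nat \<Rightarrow> bool) \<Rightarrow> word \<Rightarrow> word \<Rightarrow> bool" where
  "replaceable R a a' \<longleftrightarrow> (\<forall>s. subseq s a \<and> sorted_wrt R s \<longrightarrow>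
     (\<exists>s'. subseq s' a' \<and> sorted_wrt R s' \<and> length s' = length s \<and>
       (\<forall>c. (\<forall>y\<in>set s. R c y) \<longrightarrow> (\<forall>y\<in>set s'. R c y)) \<and>
       (\<forall>c. (\<forall>y\<in>set s. R y c) \<longrightarrow> (\<forall>y\<in>set s'. R y c))))"

lemma has_seq_replace:
  assumes "replaceable R a a'" and "has_seq R (u @ a @ v) m"
  shows "has_seq R (u @ a' @ v) m"
proof -
  obtain s where s: "subseq s (u @ a @ v)" "sorted_wrt R s" "length s = m"
    using assms(2) by (auto simp: has_seq_def)
  obtain s1 s23 where 1: "s = s1 @ s23" "subseq s1 u" "subseq s23 (a @ v)"
    using s(1) by (rule subseq_appendE)
  obtain s2 s3 where 2: "s23 = s2 @ s3" "subseq s2 a" "subseq s3 v"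
    using 1(3) by (rule subseq_appendE)
  have s': "s = s1 @ s2 @ s3" using 1 2 by simp
  have "subseq s2 a \<and> sorted_wrt R s2" using s(2) 2(2) by (simp add: s' sorted_wrt_append)
  from assms(1)[unfolded replaceable_def, rule_format, OF this]
  obtain t where t: "subseq t a'" "sorted_wrt R t" "length t = length s2"
    "\<forall>c. (\<forall>y\<in>set s2. R c y) \<longrightarrow> (\<forall>y\<in>set t. R c y)"
    "\<forall>c. (\<forall>y\<in>set s2. R y c) \<longrightarrow> (\<forall>y\<in>set t. R y c)"
    by (elim exE conjE)
  have "subseq (s1 @ t @ s3) (u @ a' @ v)"
    by (rule list_emb_append_mono[OF 1(2) list_emb_append_mono[OF t(1) 2(3)]])
  moreover have "sorted_wrt R (s1 @ t @ s3)"
  proof -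
    have S: "sorted_wrt R s1" "sorted_wrt R s2" "sorted_wrt R s3" "\<forall>x\<in>set s1. \<forall>y\<in>set s2. R x y"
      "\<forall>x\<in>set s1. \<forall>y\<in>set s3. R x y" "\<forall>x\<in>set s2. \<forall>y\<in>set s3. R x y"
      using s(2) by (auto simp: s' sorted_wrt_append)
    have "\<forall>x\<in>set s1. \<forall>y\<in>set t. R x y" using S(4) t(4) by blast
    moreover have "\<forall>x\<in>set t. \<forall>y\<in>set s3. R x y" using S(6) t(5) by blast
    ultimately show ?thesis using S t(2) by (simp add: sorted_wrt_append ball_Un)
  qed
  moreover have "length (s1 @ t @ s3) = m" using s(3) t(3) s' by simp
  ultimately show ?thesis unfolding has_seq_def by blast
qed

lemma subseq3:
  "subseq s [a, b, c] \<longleftrightarrow> s \<in> {[], [a], [b], [c], [a, b], [a, c], [b, c], [a, b, c]}"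
  unfolding in_set_subseqs[symmetric] by (auto simp: Let_def simp del: in_set_subseqs)

lemma replaceable3I:
  assumes "\<And>s. s \<in> {[], [a], [b], [c], [a, b], [a, c], [b, c], [a, b, c]} \<Longrightarrow> sorted_wrt R s \<Longrightarrow>
       g s \<in> {[], [a'], [b'], [c'], [a', b'], [a', c'], [b', c'], [a', b', c']} \<and>
       sorted_wrt R (g s) \<and> length (g s) = length s \<and>
       (\<forall>d. (\<forall>y\<in>set s. R d y) \<longrightarrow> (\<forall>y\<in>set (g s). R d y)) \<and>
       (\<forall>d. (\<forall>y\<in>set s. R y d) \<longrightarrow> (\<forall>y\<in>set (g s). R y d))"
  shows "replaceable R [a, b, c] [a', b', c']"
  unfolding replaceable_def subseq3 by (intro allI impI, elim conjE, rule exI, rule assms)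

text \<open>The only chains that are lost contain both exchanged letters. The third letter \<open>y\<close> lies between
  them in value and can take the place of one of them.\<close>

lemma replaceable_yzx:
  fixes x y z :: nat
  assumes "x < y" "y \<le> z"
  shows "replaceable (>) [y, z, x] [y, x, z]"
    "replaceable (>) [y, x, z] [y, z, x]"
    "replaceable (\<le>) [y, z, x] [y, x, z]"
    "replaceable (\<le>) [y, x, z] [y, z, x]"
proof -
  show "replaceable (>) [y, z, x] [y, x, z]"
    by (rule replaceable3I[where g = "\<lambda>s. if s = [z, x] then [y, x] else s"], elim insertE emptyE; use assms in \<open>simp; fail\<close>)
  show "replaceable (>) [y, x, z] [y, z, x]"
    by (rule replaceable3I[where g = "\<lambda>s. s"], elim insertE emptyE; use assms in \<open>simp; fail\<close>)
  show "replaceable (\<le>) [y, z, x] [y, x, z]"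
    by (rule replaceable3I[where g = "\<lambda>s. s"], elim insertE emptyE; use assms in \<open>simp; fail\<close>)
  show "replaceable (\<le>) [y, x, z] [y, z, x]"
    by (rule replaceable3I[where g = "\<lambda>s. if s = [x, z] then [y, z] else s"], elim insertE emptyE; use assms in \<open>simp; fail\<close>)
qed

lemma replaceable_xzy:
  fixes x y z :: nat
  assumes "x \<le> y" "y < z"
  shows "replaceable (>) [x, z, y] [z, x, y]"
    "replaceable (>) [z, x, y] [x, z, y]"
    "replaceable (\<le>) [x, z, y] [z, x, y]"
    "replaceable (\<le>) [z, x, y] [x, z, y]"
proof -
  show "replaceable (>) [x, z, y] [z, x, y]"
    by (rule replaceable3I[where g = "\<lambda>s. s"], elim insertE emptyE; use assms in \<open>simp; fail\<close>)
  show "replaceable (>) [z, x, y] [x, z, y]"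
    by (rule replaceable3I[where g = "\<lambda>s. if s = [z, x] then [z, y] else s"], elim insertE emptyE; use assms in \<open>simp; fail\<close>)
  show "replaceable (\<le>) [x, z, y] [z, x, y]"
    by (rule replaceable3I[where g = "\<lambda>s. if s = [x, z] then [x, y] else s"], elim insertE emptyE; use assms in \<open>simp; fail\<close>)
  show "replaceable (\<le>) [z, x, y] [x, z, y]"
    by (rule replaceable3I[where g = "\<lambda>s. s"], elim insertE emptyE; use assms in \<open>simp; fail\<close>)
qed

text \<open>The part of Greene's theorem that concerns a single increasing or decreasing subsequence; it
  is all that is needed for words that consist of two columns.\<close>

lemma knuth_has_seq:
  assumes "knuth w w'" and "R = (>) \<or> R = (\<le>)"
  shows "has_seq R w m \<longleftrightarrow> has_seq R w' m"
  using assms(1)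
proof (induction rule: knuth.induct)
  case (yzx x y z u v)
  then show ?case using replaceable_yzx[OF yzx] has_seq_replace assms(2) by blast
next
  case (xzy x y z u v)
  then show ?case using replaceable_xzy[OF xzy] has_seq_replace assms(2) by blast
qed auto

subsection \<open>Decreasing subsequences of a pair of columns\<close>

lemma subseq_col: "S \<subseteq> A \<Longrightarrow> finite A \<Longrightarrow> subseq (col S) (col A)"
proof -
  assume S: "S \<subseteq> A" "finite A"
  then have "filter (\<lambda>y. y \<in> S) (col A) = col S"
    by (intro sorted_gt_unique) (auto simp: sorted_wrt_filter finite_subset)
  then show ?thesis by (metis subseq_filter_left)
qed

lemma subseq_set_subset: "subseq s w \<Longrightarrow> set s \<subseteq> set w"
  by (metis subseq_order.trans subseq_singleton_left subsetI)

lemma sorted_gt_length: "sorted_wrt (>) s \<Longrightarrow> length s = card (set s)" for s :: word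
  by (metis col_set length_col)

lemma filter_le_col: "finite A \<Longrightarrow> filter (\<lambda>y. y \<le> x) (col A) = col (A \<inter> {..x})"
  by (rule sorted_gt_unique) (auto simp: sorted_wrt_filter)

text \<open>The length of a longest strictly decreasing subsequence of \<open>col A @ col B\<close> with letters at most
  \<open>x\<close>. Such a subsequence takes letters of \<open>A\<close> above a threshold and letters of \<open>B\<close> below it, so
  either the last letter is appended from \<open>A\<close> or the whole subsequence lies in \<open>B\<close>.\<close>

primrec decD :: "nat set \<Rightarrow> nat set \<Rightarrow> nat \<Rightarrow> nat" where
  "decD A B 0 = 0"
| "decD A B (Suc x) = max (decD A B x + of_bool (Suc x \<in> A)) (card (B \<inter> {..Suc x}))"

lemma card_atMost_Suc:
  "card (A \<inter> {..Suc x}) = card (A \<inter> {..x}) + of_bool (Suc x \<in> A)"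
proof (cases "Suc x \<in> A")
  case True
  then have "A \<inter> {..Suc x} = insert (Suc x) (A \<inter> {..x})" by auto
  then show ?thesis using True by simp
next
  case False
  then have "A \<inter> {..Suc x} = A \<inter> {..x}" by (auto simp: le_Suc_eq)
  then show ?thesis using False by simp
qed

lemma decD_upper:
  assumes "0 \<notin> A" "0 \<notin> B" "S \<subseteq> A \<inter> {..x}" "T \<subseteq> B \<inter> {..x}" "\<forall>a\<in>S. \<forall>b\<in>T. a > b"
  shows "card S + card T \<le> decD A B x"
  using assms(3-5)
proof (induction x arbitrary: S T)
  case 0
  then have "S = {}" "T = {}" using assms(1,2) by auto
  then show ?case by simp
next
  case (Suc x)
  show ?case
  proof (cases "Suc x \<in> T")
    case True
    have "Suc x < a \<and> a \<le> Suc x" if "a \<in> S" for a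
      using that True Suc.prems(1,3) by blast
    then have "S = {}" by (meson equals0I not_less)
    then show ?thesis using card_mono[of "B \<inter> {..Suc x}" T] Suc.prems(2) by simp
  next
    case False
    then have T: "T \<subseteq> B \<inter> {..x}" using Suc.prems(2) by (auto simp: le_Suc_eq)
    have S: "S - {Suc x} \<subseteq> A \<inter> {..x}" using Suc.prems(1) by (auto simp: le_Suc_eq)
    have IH: "card (S - {Suc x}) + card T \<le> decD A B x"
      by (rule Suc.IH[OF S T]) (use Suc.prems(3) in simp)
    have "finite S" by (rule finite_subset[OF Suc.prems(1)]) simp
    then have "card S = card (S - {Suc x}) + of_bool (Suc x \<in> S)"
      by (cases "Suc x \<in> S") (simp_all add: card.remove[of S "Suc x"] del: card_Diff_insert card_Diff_singleton)
    moreover have "of_bool (Suc x \<in> S) \<le> (of_bool (Suc x \<in> A) :: nat)" using Suc.prems(1) by auto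
    ultimately have "card S + card T \<le> decD A B x + of_bool (Suc x \<in> A)" using IH by linarith
    then show ?thesis by simp
  qed
qed

lemma decD_attained:
  "\<exists>S T. S \<subseteq> A \<inter> {..x} \<and> T \<subseteq> B \<inter> {..x} \<and> (\<forall>a\<in>S. \<forall>b\<in>T. a > b) \<and> card S + card T = decD A B x"
proof (induction x)
  case 0
  show ?case by (intro exI[of _ "{}"]) simp
next
  case (Suc x)
  show ?case
  proof (cases "decD A B x + of_bool (Suc x \<in> A) \<le> card (B \<inter> {..Suc x})")
    case True
    then show ?thesis by (intro exI[of _ "{}"] exI[of _ "B \<inter> {..Suc x}"]) simp
  next
    case False
    obtain S T where ST: "S \<subseteq> A \<inter> {..x}" "T \<subseteq> B \<inter> {..x}" "\<forall>a\<in>S. \<forall>b\<in>T. a > b"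
      "card S + card T = decD A B x" using Suc.IH by blast
    define S' where "S' = S \<union> (if Suc x \<in> A then {Suc x} else {})"
    have "Suc x \<notin> S" using ST(1) by auto
    moreover have "finite S" by (rule finite_subset[OF ST(1)]) simp
    ultimately have "card S' = card S + of_bool (Suc x \<in> A)" by (simp add: S'_def)
    moreover have "S' \<subseteq> A \<inter> {..Suc x}" using ST(1) by (auto simp: S'_def)
    moreover have "T \<subseteq> B \<inter> {..Suc x}" using ST(2) by auto
    moreover have "\<forall>b\<in>T. Suc x > b" using ST(2) by auto
    then have "\<forall>a\<in>S'. \<forall>b\<in>T. a > b" using ST(3) by (simp add: S'_def ball_Un)
    ultimately show ?thesis using ST(4) False by (intro exI[of _ S'] exI[of _ T]) simp
  qed
qed

lemma has_seq_decD:
  assumes "finite A" "finite B" "0 \<notin> A" "0 \<notin> B"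
    and w_def: "w = filter (\<lambda>y. y \<le> x) (col A @ col B)"
  shows "has_seq (>) w (decD A B x)" and "has_seq (>) w m \<Longrightarrow> m \<le> decD A B x"
proof -
  have w: "w = col (A \<inter> {..x}) @ col (B \<inter> {..x})"
    using assms by (simp add: filter_le_col)
  obtain S T where ST: "S \<subseteq> A \<inter> {..x}" "T \<subseteq> B \<inter> {..x}" "\<forall>a\<in>S. \<forall>b\<in>T. a > b"
    "card S + card T = decD A B x"
    using decD_attained[of A x B] by (elim exE conjE)
  have "finite S" by (rule finite_subset[OF ST(1)]) simp
  moreover have "finite T" by (rule finite_subset[OF ST(2)]) simp
  ultimately have "sorted_wrt (>) (col S @ col T)" using ST(3) by (simp add: sorted_wrt_append)
  moreover have "subseq (col S @ col T) w"
    unfolding w using ST by (intro list_emb_append_mono subseq_col) auto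
  ultimately show "has_seq (>) w (decD A B x)"
    unfolding has_seq_def using ST(4) by (intro exI[of _ "col S @ col T"]) simp
  assume "has_seq (>) w m"
  then obtain s t where st: "subseq s (col (A \<inter> {..x}))" "subseq t (col (B \<inter> {..x}))"
    "sorted_wrt (>) (s @ t)" "length s + length t = m"
    unfolding has_seq_def w subseq_append_iff by auto
  have "set s \<subseteq> A \<inter> {..x}" "set t \<subseteq> B \<inter> {..x}"
    using subseq_set_subset[OF st(1)] subseq_set_subset[OF st(2)] assms(1,2) by simp_all
  moreover have "length s = card (set s)" "length t = card (set t)"
    using st(3) sorted_gt_length by (auto simp: sorted_wrt_append)
  ultimately show "m \<le> decD A B x"
    using decD_upper[OF assms(3,4), of "set s" x "set t"] st(3,4) by (auto simp: sorted_wrt_append)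
qed


lemma decD_knuth:
  assumes "knuth (col A @ col B) (col A' @ col B')"
    and "finite A" "finite B" "0 \<notin> A" "0 \<notin> B" "finite A'" "finite B'" "0 \<notin> A'" "0 \<notin> B'"
  shows "decD A B x = decD A' B' x"
proof -
  define w where "w = filter (\<lambda>y. y \<le> x) (col A @ col B)"
  define w' where "w' = filter (\<lambda>y. y \<le> x) (col A' @ col B')"
  have "knuth w w'" unfolding w_def w'_def by (rule knuth_filter_le[OF assms(1)])
  then have "has_seq (>) w m \<longleftrightarrow> has_seq (>) w' m" for m
    using knuth_has_seq by blast
  then show ?thesis
    using has_seq_decD[OF assms(2-5) w_def] has_seq_decD[OF assms(6-9) w'_def] by (intro antisym) blast+
qed

lemma knuth_columns_count:
  assumes "knuth (col A @ col B) (col A' @ col B')"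
    and "finite A" "finite B" "finite A'" "finite B'"
  shows "of_bool (x \<in> A) + of_bool (x \<in> B) = (of_bool (x \<in> A') + of_bool (x \<in> B') :: nat)"
proof -
  have "count_list xs x = of_bool (x \<in> set xs)" if "distinct xs" for xs :: word
    using that by (induction xs) auto
  then have "count_list (col S) x = of_bool (x \<in> S)" if "finite S" for S
    using that by (simp add: col_def)
  then show ?thesis using knuth_count[OF assms(1), of x] assms(2-) by simp
qed

lemma knuth_columns_card:
  assumes "knuth (col A @ col B) (col A' @ col B')"
    and "finite A" "finite B" "finite A'" "finite B'"
  shows "card (A \<inter> {..x}) + card (B \<inter> {..x}) = card (A' \<inter> {..x}) + card (B' \<inter> {..x})"
proof -
  have "length w = length w'" if "knuth w w'" for w w' using that
    by (induction rule: knuth.induct) auto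
  from this[OF knuth_filter_le[OF assms(1), of x]] show ?thesis
    using assms(2-) by (simp add: filter_le_col)
qed

lemma card_le_decD: "0 \<notin> A \<Longrightarrow> 0 \<notin> B \<Longrightarrow> card (A \<inter> {..x}) \<le> decD A B x \<and> card (B \<inter> {..x}) \<le> decD A B x"
  using decD_upper[of A B "A \<inter> {..x}" x "{}"] decD_upper[of A B "{}" x "B \<inter> {..x}"] by simp

text \<open>The columns are recovered from the largest letter downwards. Since the content is known, only
  a letter \<open>Suc x\<close> that occurs once could be placed in two ways. If it were in \<open>A\<close> and in \<open>B'\<close>,
  then \<open>decD\<close> would grow from some \<open>d\<close> to \<open>d + 1\<close> at \<open>Suc x\<close>. For the second pair such a growth means
  that \<open>B'\<close> has \<open>d + 1\<close> letters up to \<open>Suc x\<close>. Then \<open>B\<close> has as many, all of them up to \<open>x\<close>, which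
  contradicts \<open>decD A B x = d\<close>.\<close>

lemma knuth_columns_unique:
  assumes k: "knuth (col A @ col B) (col A' @ col B')"
    and sub: "A \<subseteq> {1..N}" "B \<subseteq> {1..N}" "A' \<subseteq> {1..N}" "B' \<subseteq> {1..N}"
    and card: "card A = card A'"
  shows "A = A' \<and> B = B'"
proof -
  have fin: "finite A" "finite B" "finite A'" "finite B'" and z: "0 \<notin> A" "0 \<notin> B" "0 \<notin> A'" "0 \<notin> B'"
    using sub by (auto intro: finite_subset)
  note D = decD_knuth[OF k fin(1,2) z(1,2) fin(3,4) z(3,4)]
  note C = knuth_columns_count[OF k fin]
  note T = knuth_columns_card[OF k fin]
  have "A \<inter> {..N} = A" "A' \<inter> {..N} = A'" using sub by auto
  then have N: "card (A \<inter> {..N}) = card (A' \<inter> {..N})" using card by simp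
  have le: "card (A \<inter> {..x}) = card (A' \<inter> {..x})" if "x \<le> N" for x
    using that
  proof (induction x rule: inc_induct)
    case base
    then show ?case by (rule N)
  next
    case (step x)
    have "Suc x \<in> A \<longleftrightarrow> Suc x \<in> A'" 
      using step.IH C[of "Suc x"] T[of "Suc x"] T[of x] D[of "Suc x"] D[of x] card_le_decD[OF z(1,2), of x]
        card_le_decD[OF z(3,4), of x]
      by (cases "Suc x \<in> A"; cases "Suc x \<in> B"; cases "Suc x \<in> A'"; cases "Suc x \<in> B'")
        (simp_all add: card_atMost_Suc)
    then show ?case using step.IH by (simp add: card_atMost_Suc)
  qed
  have "x \<in> A \<longleftrightarrow> x \<in> A'" for x
  proof (cases "x \<in> {1..N}")
    case True
    then obtain y where "x = Suc y" "y \<le> N" "Suc y \<le> N" by (cases x) auto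
    then show ?thesis using le[of y] le[of "Suc y"]
      by (cases "Suc y \<in> A"; cases "Suc y \<in> A'") (simp_all add: card_atMost_Suc)
  qed (use sub in auto)
  then have A: "A = A'" by blast
  then have "x \<in> B \<longleftrightarrow> x \<in> B'" for x using C[of x] by (cases "x \<in> B"; cases "x \<in> B'") simp_all
  then show ?thesis using A by blast
qed

subsection \<open>Two-column tableaux\<close>

text \<open>Semistandardness of the tableau with columns \<open>A\<close> and \<open>B\<close>, expressed by counting instead of
  comparing rows; counts are easier to maintain when letters change columns.\<close>

definition ballot :: "nat set \<Rightarrow> nat set \<Rightarrow> bool" where
  "ballot A B \<longleftrightarrow> (\<forall>x. card (B \<inter> {..x}) \<le> card (A \<inter> {..x}))"

text \<open>In a tableau the first column is a longest decreasing subsequence. Conversely, if \<open>B\<close> has more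
  letters than \<open>A\<close> up to some \<open>x\<close>, these letters together with those of \<open>A\<close> above \<open>x\<close> form a
  subsequence longer than the first column.\<close>

lemma ballot_iff_decD:
  assumes "A \<subseteq> {1..N}" "B \<subseteq> {1..N}"
  shows "ballot A B \<longleftrightarrow> decD A B N = card A"
proof -
  have z: "0 \<notin> A" "0 \<notin> B" and N: "A \<inter> {..N} = A" "B \<inter> {..N} = B" using assms by auto
  show ?thesis
  proof
    assume b: "ballot A B"
    have "decD A B x = card (A \<inter> {..x})" for x
    proof (induction x)
      case 0
      have "A \<inter> {..0} = {}" using z by auto
      then show ?case by simp
    next
      case (Suc x)
      then show ?case using b[unfolded ballot_def, rule_format, of "Suc x"]
        by (simp add: card_atMost_Suc[of A])
    qed
    then show "decD A B N = card A" using N by simp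
  next
    assume D: "decD A B N = card A"
    have mono: "decD A B x + card (A \<inter> {..N}) \<le> decD A B N + card (A \<inter> {..x})" if "x \<le> N" for x
      using that
    proof (induction x rule: inc_induct)
      case (step x)
      then show ?case by (simp add: card_atMost_Suc[of A])
    qed simp
    have le: "card (B \<inter> {..x}) \<le> card (A \<inter> {..x})" if "x \<le> N" for x
      using mono[OF that] D N card_le_decD[OF z, of x] by simp
    have "card (B \<inter> {..x}) \<le> card (A \<inter> {..x})" for x
    proof (cases "x \<le> N")
      case False
      then have "A \<inter> {..x} = A" "B \<inter> {..x} = B" using assms by auto
      then show ?thesis using le[of N] N by simp
    qed (rule le)
    then show "ballot A B" by (simp add: ballot_def)
  qed
qed

lemma card_set_atMost:
  fixes r :: word
  assumes "distinct r"
  shows "card (set r \<inter> {..x}) = card {i. i < length r \<and> r ! i \<le> x}"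
proof -
  have "set r \<inter> {..x} = set (filter (\<lambda>y. y \<le> x) r)" by auto
  also have "card \<dots> = length (filter (\<lambda>y. y \<le> x) r)"
    by (rule distinct_card) (use assms in simp)
  finally show ?thesis by (simp only: length_filter_conv_card)
qed

text \<open>If the entry of \<open>A\<close> in row \<open>i\<close> exceeded that of \<open>B\<close>, then up to the latter entry there would be
  \<open>i + 1\<close> letters of \<open>B\<close> but at most \<open>i\<close> letters of \<open>A\<close> (rows counted from zero).\<close>

lemma ballot_tableau:
  assumes "ballot A B" "finite A" "finite B" "A \<noteq> {}"
  shows "tableau_word (col A @ col B)"
proof -
  \<comment> \<open>The columns of a tableau are nonempty, so an empty second column is left out.\<close>
  define cs where "cs = (if B = {} then [col A] else [col A, col B])"
  have ne: "col A \<noteq> []" "B \<noteq> {} \<Longrightarrow> col B \<noteq> []"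
    using assms length_col[of A] length_col[of B] by (metis card_gt_0_iff length_greater_0_conv)+
  have r: "rev (col S) = sorted_list_of_set S" for S by (simp add: col_def)
  obtain x where "\<forall>y\<in>A \<union> B. y \<le> x"
    using assms(2,3) by (meson finite_Un finite_nat_set_iff_bounded_le)
  then have "A \<inter> {..x} = A" "B \<inter> {..x} = B" by auto
  then have len: "card B \<le> card A" using assms(1)[unfolded ballot_def, rule_format, of x] by simp
  have rows: "sorted_list_of_set A ! i \<le> sorted_list_of_set B ! i" (is "?a ! i \<le> ?b ! i") if i: "i < card B" for i
  proof (rule ccontr)
    assume neg: "\<not> ?a ! i \<le> ?b ! i"
    have "{..i} \<subseteq> {j. j < length ?b \<and> ?b ! j \<le> ?b ! i}"
      using i by (auto simp: sorted_nth_mono)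
    then have "Suc i \<le> card (B \<inter> {..?b ! i})"
      using card_set_atMost[of ?b "?b ! i"] assms(3) card_mono[of "{j. j < length ?b \<and> ?b ! j \<le> ?b ! i}" "{..i}"]
      by simp
    moreover have "{j. j < length ?a \<and> ?a ! j \<le> ?b ! i} \<subseteq> {..<i}"
    proof
      fix j assume j: "j \<in> {j. j < length ?a \<and> ?a ! j \<le> ?b ! i}"
      show "j \<in> {..<i}"
      proof (rule ccontr)
        assume "j \<notin> {..<i}"
        then have "?a ! i \<le> ?a ! j" using j by (intro sorted_nth_mono) auto
        then show False using j neg by simp
      qed
    qed
    then have "card (A \<inter> {..?b ! i}) \<le> i"
      using card_set_atMost[of ?a "?b ! i"] assms(2) card_mono[of "{..<i}" "{j. j < length ?a \<and> ?a ! j \<le> ?b ! i}"]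
      by simp
    ultimately show False using assms(1)[unfolded ballot_def, rule_format, of "?b ! i"] by linarith
  qed
  have "semistandard cs"
    using ne len rows by (simp add: semistandard_def cs_def r)
  moreover have "concat cs = col A @ col B" by (simp add: cs_def col_def)
  ultimately show ?thesis unfolding tableau_word_def by metis
qed

lemma sorted_wrt_subseq: "subseq s w \<Longrightarrow> sorted_wrt R w \<Longrightarrow> sorted_wrt R s"
proof (induction rule: list_emb.induct)
  case (list_emb_Cons2 x y xs ys)
  then show ?case using subseq_set_subset[OF list_emb_Cons2.hyps(2)] by auto
qed simp_all

lemma no_inc_column:
  assumes "subseq s (col A)" "sorted_wrt (\<le>) s"
  shows "length s \<le> 1"
proof (rule ccontr)
  assume "\<not> length s \<le> 1"
  then obtain x y t where s: "s = x # y # t" by (cases s rule: remdups_adj.cases) auto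
  have "sorted_wrt (>) s" using assms(1) sorted_col sorted_wrt_subseq by blast
  then show False using s assms(2) by simp
qed

text \<open>A third column would give a weakly increasing subsequence of length three, the beginning of the
  first row; but each of the two given columns contributes at most one letter to such a
  subsequence.\<close>

lemma tableau_of_columns:
  assumes t: "tableau_word t" and k: "knuth (col A @ col B) t" and sub: "A \<subseteq> {1..N}" "B \<subseteq> {1..N}"
  obtains A' B' where "t = col A' @ col B'" "A' \<subseteq> {1..N}" "B' \<subseteq> {1..N}" "ballot A' B'"
proof -
  have fin: "finite A" "finite B" using sub finite_subset by blast+
  obtain cs where cs: "semistandard cs" "t = concat cs" using t by (auto simp: tableau_word_def)
  have no3: "length cs \<le> 2"
  proof (rule ccontr)
    assume "\<not> length cs \<le> 2"
    then obtain c1 c2 c3 ds where c: "cs = c1 # c2 # c3 # ds"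
      by (metis One_nat_def Suc_1 le_SucI length_Cons list.exhaust list.size(3) nat_le_linear not_less_eq_eq)
    have ne: "c1 \<noteq> []" "c2 \<noteq> []" "c3 \<noteq> []" using cs(1) by (auto simp: semistandard_def c)
    have last: "rev d ! 0 = last d" if "d \<noteq> []" for d :: word
      using that by (simp add: hd_conv_nth[symmetric] hd_rev)
    note rows = cs(1)[unfolded semistandard_def, THEN conjunct2, rule_format]
    have "last c1 \<le> last c2"
      using rows[of 0, THEN conjunct2, rule_format, of 0] ne by (simp add: c last)
    moreover have "last c2 \<le> last c3"
      using rows[of 1, THEN conjunct2, rule_format, of 0] ne by (simp add: c last)
    moreover have "subseq ([last c1] @ [last c2] @ [last c3] @ []) (c1 @ c2 @ c3 @ concat ds)"
      using ne by (intro list_emb_append_mono) (auto simp: subseq_singleton_left)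
    ultimately have "has_seq (\<le>) t 3"
      unfolding has_seq_def using cs(2) c by (intro exI[of _ "[last c1, last c2, last c3]"]) simp
    then have "has_seq (\<le>) (col A @ col B) 3" using knuth_has_seq[OF k] by simp
    then obtain s where s: "subseq s (col A @ col B)" "sorted_wrt (\<le>) s" "length s = 3"
      unfolding has_seq_def by (elim exE conjE)
    obtain s1 s2 where s12: "s = s1 @ s2" "subseq s1 (col A)" "subseq s2 (col B)"
      using s(1) by (rule subseq_appendE)
    have "length s1 \<le> 1" "length s2 \<le> 1"
      using no_inc_column[OF s12(2)] no_inc_column[OF s12(3)] s(2) s12(1) by (simp_all add: sorted_wrt_append)
    then show False using s(3) s12(1) by simp
  qed
  define c1 c2 where "c1 = (if cs = [] then [] else hd cs)" and "c2 = (if length cs < 2 then [] else cs ! 1)"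
  have c: "sorted_wrt (>) c1" "sorted_wrt (>) c2" "t = c1 @ c2" "length c2 \<le> length c1"
    "\<forall>i < length c2. rev c1 ! i \<le> rev c2 ! i"
  proof -
    have cases: "cs = [] \<or> (\<exists>d. cs = [d]) \<or> (\<exists>d d'. cs = [d, d'])"
      using no3 by (cases cs rule: remdups_adj.cases) auto
    then have "sorted_wrt (>) c1 \<and> sorted_wrt (>) c2 \<and> t = c1 @ c2 \<and> length c2 \<le> length c1 \<and>
      (\<forall>i < length c2. rev c1 ! i \<le> rev c2 ! i)"
      using cs by (elim disjE exE) (simp_all add: c1_def c2_def semistandard_def)
    then show "sorted_wrt (>) c1" "sorted_wrt (>) c2" "t = c1 @ c2" "length c2 \<le> length c1"
      "\<forall>i < length c2. rev c1 ! i \<le> rev c2 ! i" by simp_all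
  qed
  \<comment> \<open>Knuth equivalent words have the same letters.\<close>
  have "set t \<subseteq> {1..N}"
  proof -
    have "count_list t y \<noteq> 0 \<longleftrightarrow> count_list (col A @ col B) y \<noteq> 0" for y
      using knuth_count[OF k] by simp
    then have "set t = set (col A @ col B)" unfolding count_list_0_iff by blast
    then show ?thesis using sub fin by simp
  qed
  then have s: "set c1 \<subseteq> {1..N}" "set c2 \<subseteq> {1..N}" using c(3) by simp_all
  have "ballot (set c1) (set c2)"
    unfolding ballot_def
  proof
    fix x
    have d: "distinct (rev c1)" "distinct (rev c2)" using c(1,2)[THEN sorted_gt_length[symmetric], THEN card_distinct] by simp_all
    have "{i. i < length c2 \<and> rev c2 ! i \<le> x} \<subseteq> {i. i < length c1 \<and> rev c1 ! i \<le> x}"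
      using c(4,5) by fastforce
    then have "card {i. i < length c2 \<and> rev c2 ! i \<le> x} \<le> card {i. i < length c1 \<and> rev c1 ! i \<le> x}"
      by (intro card_mono) simp_all
    then show "card (set c2 \<inter> {..x}) \<le> card (set c1 \<inter> {..x})"
      using card_set_atMost[OF d(1)] card_set_atMost[OF d(2)] by simp
  qed
  moreover have "t = col (set c1) @ col (set c2)" using c(1-3) by (simp add: col_set)
  ultimately show ?thesis using s that by blast
qed

text \<open>The first column of a tableau has the length of a longest decreasing subsequence, which the
  Knuth class determines; so both tableaux have the same shape and \<open>knuth_columns_unique\<close> applies.\<close>

lemma tableau_unique:
  assumes "tableau_word t" "tableau_word t'" "knuth (col A @ col B) t" "knuth (col A @ col B) t'"
    and sub: "A \<subseteq> {1..N}" "B \<subseteq> {1..N}"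
  shows "t = t'"
proof -
  obtain P Q where t: "t = col P @ col Q" "P \<subseteq> {1..N}" "Q \<subseteq> {1..N}" "ballot P Q"
    using tableau_of_columns[OF assms(1,3) sub] by blast
  obtain P' Q' where t': "t' = col P' @ col Q'" "P' \<subseteq> {1..N}" "Q' \<subseteq> {1..N}" "ballot P' Q'"
    using tableau_of_columns[OF assms(2,4) sub] by blast
  have k: "knuth (col P @ col Q) (col P' @ col Q')"
    using assms(3,4) knuth.sym knuth.trans unfolding t(1) t'(1) by blast
  have "decD P Q N = decD P' Q' N"
    using t t' by (intro decD_knuth[OF k]) (auto intro: finite_subset)
  then have "card P = card P'"
    using ballot_iff_decD[OF t(2,3)] ballot_iff_decD[OF t'(2,3)] t(4) t'(4) by simp
  then show ?thesis
    using knuth_columns_unique[OF k t(2,3) t'(2,3)] t(1) t'(1) by simp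
qed

section \<open>Crystal operators respect Knuth equivalence\<close>

text \<open>The relation that is shown to contain Knuth equivalence. It includes \<open>knuth w w'\<close> itself, since
  in a context the operators may act outside the factors \<open>w\<close> and \<open>w'\<close>.\<close>

definition crystal_sim :: "nat \<Rightarrow> nat \<Rightarrow> word \<Rightarrow> word \<Rightarrow> bool" where
  "crystal_sim n i w w' \<longleftrightarrow> knuth w w' \<and> wphi n i w = wphi n i w' \<and> weps n i w = weps n i w' \<and>
     rel_option knuth (word_f n i w) (word_f n i w') \<and> rel_option knuth (word_e n i w) (word_e n i w')"

lemma crystal_sim_context:
  assumes "crystal_sim n i a a'"
  shows "crystal_sim n i (u @ a @ v) (u @ a' @ v)"
proof -
  have k: "knuth a a'" and p: "wphi n i a = wphi n i a'" "weps n i a = weps n i a'"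
    and f: "rel_option knuth (word_f n i a) (word_f n i a')"
    and e: "rel_option knuth (word_e n i a) (word_e n i a')"
    using assms by (simp_all add: crystal_sim_def)
  have 1: "crystal_sim n i (a @ v) (a' @ v)"
    unfolding crystal_sim_def
  proof (intro conjI)
    show "rel_option knuth (word_f n i (a @ v)) (word_f n i (a' @ v))"
      using f knuth_context[OF k, of "[]"] knuth_context[of _ _ "[]" v]
      by (cases "word_f n i a"; cases "word_f n i a'"; cases "word_f n i v") (simp_all add: word_f_append p)
    show "rel_option knuth (word_e n i (a @ v)) (word_e n i (a' @ v))"
      using e knuth_context[OF k, of "[]"] knuth_context[of _ _ "[]" v]
      by (cases "word_e n i a"; cases "word_e n i a'"; cases "word_e n i v") (simp_all add: word_e_append p)
    show "knuth (a @ v) (a' @ v)" using knuth_context[OF k, of "[]" v] by simp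
  qed (simp_all add: weps_wphi_append p)
  then have k: "knuth (a @ v) (a' @ v)" and p: "wphi n i (a @ v) = wphi n i (a' @ v)" "weps n i (a @ v) = weps n i (a' @ v)"
    and f: "rel_option knuth (word_f n i (a @ v)) (word_f n i (a' @ v))"
    and e: "rel_option knuth (word_e n i (a @ v)) (word_e n i (a' @ v))"
    by (simp_all only: crystal_sim_def)
  show ?thesis
    unfolding crystal_sim_def
  proof (intro conjI)
    show "rel_option knuth (word_f n i (u @ a @ v)) (word_f n i (u @ a' @ v))"
      using f knuth_context[OF k, of _ "[]"] knuth_context[of _ _ u "[]"]
      by (cases "word_f n i (a @ v)"; cases "word_f n i (a' @ v)"; cases "word_f n i u")
        (simp_all add: word_f_append[of n i u] p)
    show "rel_option knuth (word_e n i (u @ a @ v)) (word_e n i (u @ a' @ v))"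
      using e knuth_context[OF k, of _ "[]"] knuth_context[of _ _ u "[]"]
      by (cases "word_e n i (a @ v)"; cases "word_e n i (a' @ v)"; cases "word_e n i u")
        (simp_all add: word_e_append[of n i u] p)
    show "knuth (u @ a @ v) (u @ a' @ v)" using knuth_context[OF k, of u "[]"] by simp
  qed (simp_all add: weps_wphi_append[of n i u] p)
qed

lemma crystal_sim_trivial:
  assumes "\<not> (1 \<le> i \<and> i \<le> 2*n - 1)" "knuth w w'"
  shows "crystal_sim n i w w'"
proof -
  have "wphi n i w = 0 \<and> weps n i w = 0 \<and> word_f n i w = None \<and> word_e n i w = None" for w
    by (induction w) (use assms(1) in \<open>auto simp: lphi_def leps_def letter_f_def letter_e_def\<close>)
  then show ?thesis using assms(2) by (simp add: crystal_sim_def)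
qed

text \<open>Each letter matters only through its position relative to \<open>i\<close> and \<open>Suc i\<close>, so this is a finite
  check. The results are related by an elementary relation of either kind or are equal.\<close>

lemma crystal_sim_elementary:
  shows "x < y \<Longrightarrow> y \<le> z \<Longrightarrow> crystal_sim n i [y, z, x] [y, x, z]"
    and "x \<le> y \<Longrightarrow> y < z \<Longrightarrow> crystal_sim n i [x, z, y] [z, x, y]"
proof -
  have k: "knuth [b, c, a] [b, a, c]" if "a < b" "b \<le> c" for a b c
    using knuth.yzx[OF that, of "[]" "[]"] by simp
  have k': "knuth [a, c, b] [c, a, b]" if "a \<le> b" "b < c" for a b c
    using knuth.xzy[OF that, of "[]" "[]"] by simp
  have tri: "a = i \<or> a = Suc i \<or> (a \<noteq> i \<and> a \<noteq> Suc i \<and> a < i) \<or> (a \<noteq> i \<and> a \<noteq> Suc i \<and> Suc i < a)" for a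
    by linarith
  have L: "lphi n i a = of_bool (a = i)" "leps n i a = of_bool (a = Suc i)"
    "letter_f n i a = (if a = i then Some (Suc i) else None)"
    "letter_e n i a = (if a = Suc i then Some i else None)" if "1 \<le> i \<and> i \<le> 2*n - 1" for a
    using that by (simp_all add: lphi_def leps_def letter_f_def letter_e_def)
  show "crystal_sim n i [y, z, x] [y, x, z]" if xyz: "x < y" "y \<le> z"
  proof (cases "1 \<le> i \<and> i \<le> 2*n - 1")
    case True
    note L = L[OF True]
    show ?thesis
      using tri[of x] tri[of y] tri[of z] xyz
      by - (elim disjE conjE; ((rule FalseE, linarith) | (simp add: crystal_sim_def L k k' knuth.refl)))
  qed (rule crystal_sim_trivial[OF _ k[OF xyz]])
  show "crystal_sim n i [x, z, y] [z, x, y]" if xyz: "x \<le> y" "y < z"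
  proof (cases "1 \<le> i \<and> i \<le> 2*n - 1")
    case True
    note L = L[OF True]
    show ?thesis
      using tri[of x] tri[of y] tri[of z] xyz
      by - (elim disjE conjE; ((rule FalseE, linarith) | (simp add: crystal_sim_def L k k' knuth.refl)))
  qed (rule crystal_sim_trivial[OF _ k'[OF xyz]])
qed

lemma knuth_crystal_sim: "knuth w w' \<Longrightarrow> crystal_sim n i w w'"
proof (induction rule: knuth.induct)
  case (refl w)
  then show ?case by (simp add: crystal_sim_def knuth.refl option.rel_refl)
next
  case (sym v w)
  then show ?case unfolding crystal_sim_def by (auto intro: knuth.sym elim!: option.rel_cases)
next
  case (trans u v w)
  then show ?case unfolding crystal_sim_def by (auto intro: knuth.trans elim!: option.rel_cases)
next
  case (yzx x y z u v)
  then show ?case by (intro crystal_sim_context crystal_sim_elementary)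
next
  case (xzy x y z u v)
  then show ?case by (intro crystal_sim_context crystal_sim_elementary)
qed


section \<open>Moving a letter between two columns\<close>

lemma knuth_insert_upper:
  "sorted_wrt (>) (c @ [b]) \<Longrightarrow> a \<le> b \<Longrightarrow> knuth (a # c @ [b]) (c @ [a, b])"
proof (induction c)
  case Nil
  show ?case by (simp add: knuth.refl)
next
  case (Cons p c)
  obtain q t where q: "c @ [b] = q # t" by (cases "c @ [b]") auto
  have "b \<le> q" 
  proof (cases c)
    case Nil
    then show ?thesis using q by simp
  next
    case (Cons q' c')
    then show ?thesis using q Cons.prems(1) by auto
  qed
  moreover have "q < p" using Cons.prems(1) q by (metis append_Cons list.set_intros(1) sorted_wrt.simps(2))
  ultimately have "knuth (a # p # q # t) (p # a # q # t)"
    using knuth.xzy[of a q p "[]" t] Cons.prems(2) by simp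
  moreover have "knuth (p # a # c @ [b]) (p # c @ [a, b])"
    using knuth_context[OF Cons.IH, of "[p]" "[]"] Cons.prems by simp
  ultimately show ?case using q by (auto intro: knuth.trans)
qed

lemma knuth_insert_lower:
  "sorted_wrt (>) (a # c) \<Longrightarrow> a \<le> b \<Longrightarrow> knuth (a # b # c) (a # c @ [b])"
proof (induction c arbitrary: a)
  case Nil
  show ?case by (simp add: knuth.refl)
next
  case (Cons d c)
  have "knuth (a # b # d # c) (a # d # b # c)"
    using knuth.yzx[of d a b "[]" c] Cons.prems by simp
  moreover have "knuth (a # d # b # c) (a # d # c @ [b])"
    using knuth_context[OF Cons.IH[of d], of "[a]" "[]"] Cons.prems by simp
  ultimately show ?case by (auto intro: knuth.trans)
qed

lemma col_Un:
  assumes "finite S" "finite T" "\<And>s t. s \<in> S \<Longrightarrow> t \<in> T \<Longrightarrow> t < s"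
  shows "col (S \<union> T) = col S @ col T"
  by (rule sorted_gt_unique) (use assms in \<open>simp_all add: sorted_wrt_append\<close>)

lemma col_insert_max:
  assumes "finite T" "\<And>t. t \<in> T \<Longrightarrow> t < a"
  shows "col (insert a T) = a # col T"
  by (rule sorted_gt_unique) (use assms in simp_all)

lemma col_empty [simp]: "col {} = []" and col_single [simp]: "col {x} = [x]"
  by (simp_all add: col_def)

text \<open>Column insertion: \<open>a\<close> takes the place of the least letter \<open>b \<ge> a\<close> of the column, and \<open>b\<close> leaves
  on the right. First \<open>a\<close> passes the letters larger than \<open>b\<close>, then \<open>b\<close> passes the letters
  smaller than \<open>a\<close>.\<close>

lemma knuth_column_insert:
  assumes "finite C" "b \<in> C" "a \<le> b" "\<And>c. c \<in> C \<Longrightarrow> c < a \<or> b \<le> c"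
  shows "knuth (a # col C) (col (insert a (C - {b})) @ [b])"
proof -
  define S T where "S = {c \<in> C. b < c}" and "T = {c \<in> C. c < a}"
  have fin: "finite S" "finite T" using assms(1) by (simp_all add: S_def T_def)
  have "C = S \<union> insert b T" using assms(2-4) by (auto simp: S_def T_def le_less)
  moreover have "col (S \<union> insert b T) = col S @ col (insert b T)"
    by (rule col_Un) (use fin assms(3) in \<open>auto simp: S_def T_def\<close>)
  moreover have "col (insert b T) = b # col T"
    by (rule col_insert_max) (use fin assms(3) in \<open>auto simp: T_def\<close>)
  ultimately have C: "col C = col S @ b # col T" by simp
  have "insert a (C - {b}) = S \<union> insert a T" using assms(2-4) by (auto simp: S_def T_def le_less)
  moreover have "col (S \<union> insert a T) = col S @ col (insert a T)"
    by (rule col_Un) (use fin assms(3) in \<open>auto simp: S_def T_def\<close>)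
  moreover have "col (insert a T) = a # col T"
    by (rule col_insert_max) (use fin in \<open>auto simp: T_def\<close>)
  ultimately have C': "col (insert a (C - {b})) = col S @ a # col T" by simp
  have "sorted_wrt (>) (col S @ [b])" "sorted_wrt (>) (a # col T)"
    using fin by (simp_all add: sorted_wrt_append S_def T_def)
  note U = knuth_insert_upper[OF this(1) assms(3)] and L = knuth_insert_lower[OF this(2) assms(3)]
  show ?thesis
    using knuth_context[OF U, of "[]" "col T"] knuth_context[OF L, of "col S" "[]"]
    unfolding C C' by (simp add: knuth.trans)
qed

text \<open>The letters of \<open>A\<close> are inserted, smallest first, into the column \<open>Q \<union> B\<close>. The counting
  hypothesis provides a letter of \<open>B\<close> to be bumped by each of them, so the larger letters \<open>Q\<close> are
  never touched. Hence the remaining word \<open>w\<close> is the same for all \<open>Q\<close>, which is the point of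
  the order of quantifiers.\<close>

lemma knuth_commute_low:
  assumes "finite A" "finite B" "\<And>m. card (A \<inter> {m..}) \<le> card (B \<inter> {m..})"
  shows "\<exists>w. \<forall>Q. finite Q \<longrightarrow> (\<forall>q\<in>Q. \<forall>y\<in>A \<union> B. y < q) \<longrightarrow> knuth (col A @ col Q @ col B) (col Q @ w)"
  using assms
proof (induction A arbitrary: B rule: finite_linorder_min_induct)
  case empty
  show ?case by (intro exI[of _ "col B"]) (simp add: knuth.refl)
next
  case (insert a A)
  have finA: "finite A" by (rule insert.hyps(1))
  have "(insert a A) \<inter> {a..} = insert a A" using insert.hyps(2) by (auto intro: less_imp_le)
  moreover have "a \<notin> A" using insert.hyps(2) by blast
  ultimately have K: "Suc (card A) \<le> card (B \<inter> {a..})"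
    using insert.prems(2)[of a] finA by simp
  then have ne: "B \<inter> {a..} \<noteq> {}" by (metis card.empty not_less_eq_eq zero_le)
  define b where "b = Min (B \<inter> {a..})"
  have "b \<in> B \<inter> {a..}" using Min_in[OF _ ne] insert.prems(1) by (simp add: b_def)
  then have b: "b \<in> B" "a \<le> b" by simp_all
  have bl: "c < a \<or> b \<le> c" if "c \<in> B" for c
  proof (cases "c < a")
    case False
    then have "c \<in> B \<inter> {a..}" using that by simp
    then show ?thesis unfolding b_def using insert.prems(1) by (intro disjI2 Min_le) simp_all
  qed simp
  define B1 where "B1 = insert a (B - {b})"
  have fin1: "finite B1" using insert.prems(1) by (simp add: B1_def)
  \<comment> \<open>Up to \<open>b\<close> only the number of letters from \<open>a\<close> on matters, since \<open>B\<close> has none in between.\<close>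
  have cond: "card (A \<inter> {m..}) \<le> card (B1 \<inter> {m..})" for m
  proof (cases "m \<le> b")
    case True
    have "(B \<inter> {a..}) - {b} \<subseteq> B1 \<inter> {m..}" using True bl by (force simp: B1_def)
    then have "card ((B \<inter> {a..}) - {b}) \<le> card (B1 \<inter> {m..})" by (intro card_mono) (use fin1 in simp_all)
    moreover have "card ((B \<inter> {a..}) - {b}) = card (B \<inter> {a..}) - 1" using b by simp
    moreover have "card (A \<inter> {m..}) \<le> card A" using finA by (intro card_mono) auto
    ultimately show ?thesis using K by linarith
  next
    case False
    then have "B1 \<inter> {m..} = B \<inter> {m..}" using b by (auto simp: B1_def)
    moreover have "card (A \<inter> {m..}) \<le> card (insert a A \<inter> {m..})" using finA by (intro card_mono) auto
    ultimately show ?thesis using insert.prems(2)[of m] by simp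
  qed
  obtain w where w: "\<forall>Q. finite Q \<longrightarrow> (\<forall>q\<in>Q. \<forall>y\<in>A \<union> B1. y < q) \<longrightarrow> knuth (col A @ col Q @ col B1) (col Q @ w)"
    using insert.IH[OF fin1 cond] by (elim exE)
  have A: "col (insert a A) = col A @ [a]"
    using col_Un[of A "{a}"] finA insert.hyps(2) by simp
  show ?case
  proof (intro exI[of _ "w @ [b]"] allI impI)
    fix Q :: "nat set" assume Q: "finite Q" "\<forall>q\<in>Q. \<forall>y\<in>insert a A \<union> B. y < q"
    have "knuth (a # col (Q \<union> B)) (col (insert a (Q \<union> B - {b})) @ [b])"
    proof (rule knuth_column_insert)
      show "c < a \<or> b \<le> c" if "c \<in> Q \<union> B" for c
      proof (cases "c \<in> B")
        case False
        then have "b < c" using that Q(2) b(1) by blast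
        then show ?thesis by simp
      qed (rule bl)
    qed (use Q insert.prems(1) b in simp_all)
    moreover have "col (Q \<union> B) = col Q @ col B"
      by (rule col_Un) (use Q insert.prems(1) in auto)
    moreover have "b \<notin> Q" "a \<notin> Q" using Q(2) b(1) by blast+
    then have "insert a (Q \<union> B - {b}) = Q \<union> B1" by (auto simp: B1_def)
    moreover have "col (Q \<union> B1) = col Q @ col B1"
      by (rule col_Un) (use Q fin1 in \<open>auto simp: B1_def\<close>)
    ultimately have "knuth (a # col Q @ col B) (col Q @ col B1 @ [b])" by simp
    from knuth_context[OF this, of "col A" "[]"]
    have "knuth (col (insert a A) @ col Q @ col B) (col A @ col Q @ col B1 @ [b])" by (simp add: A)
    moreover have "knuth (col A @ col Q @ col B1) (col Q @ w)"
      using w Q b(1) by (auto simp: B1_def)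
    from knuth_context[OF this, of "[]" "[b]"]
    have "knuth (col A @ col Q @ col B1 @ [b]) (col Q @ w @ [b])" by simp
    ultimately show "knuth (col (insert a A) @ col Q @ col B) (col Q @ w @ [b])" by (rule knuth.trans)
  qed
qed

text \<open>The mirror image of \<open>knuth_commute_low\<close>: the letters of \<open>B\<close> are inserted from the right, largest
  first, into the column \<open>A \<union> Q\<close>, and the small letters \<open>Q\<close> are never touched.\<close>

lemma knuth_commute_high:
  assumes "finite A" "finite B" "\<And>m. card (B \<inter> {..m}) \<le> card (A \<inter> {..m})"
  shows "\<exists>w. \<forall>Q. finite Q \<longrightarrow> (\<forall>q\<in>Q. \<forall>y\<in>A \<union> B. q < y) \<longrightarrow> knuth (col A @ col Q @ col B) (w @ col Q)"
  using assms(2,1,3)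
proof (induction B arbitrary: A rule: finite_linorder_max_induct)
  case empty
  show ?case by (intro exI[of _ "col A"]) (simp add: knuth.refl)
next
  case (insert b B)
  have finB: "finite B" by (rule insert.hyps(1))
  have "(insert b B) \<inter> {..b} = insert b B" using insert.hyps(2) by (auto intro: less_imp_le)
  moreover have "b \<notin> B" using insert.hyps(2) by blast
  ultimately have K: "Suc (card B) \<le> card (A \<inter> {..b})"
    using insert.prems(2)[of b] finB by simp
  then have ne: "A \<inter> {..b} \<noteq> {}" by (metis card.empty not_less_eq_eq zero_le)
  define a where "a = Max (A \<inter> {..b})"
  have "a \<in> A \<inter> {..b}" using Max_in[OF _ ne] by (simp add: a_def)
  then have a: "a \<in> A" "a \<le> b" by simp_all
  have al: "c \<le> a \<or> b < c" if "c \<in> A" for c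
  proof (cases "b < c")
    case False
    then have "c \<in> A \<inter> {..b}" using that by simp
    then show ?thesis unfolding a_def by (intro disjI1 Max_ge) simp_all
  qed simp
  define A1 where "A1 = insert b (A - {a})"
  have fin1: "finite A1" using insert.prems(1) by (simp add: A1_def)
  have cond: "card (B \<inter> {..m}) \<le> card (A1 \<inter> {..m})" for m
  proof (cases "a \<le> m")
    case True
    have "(A \<inter> {..b}) - {a} \<subseteq> A1 \<inter> {..m}" using True al by (force simp: A1_def)
    then have "card ((A \<inter> {..b}) - {a}) \<le> card (A1 \<inter> {..m})" by (intro card_mono) (use fin1 in simp_all)
    moreover have "card ((A \<inter> {..b}) - {a}) = card (A \<inter> {..b}) - 1" using a by simp
    moreover have "card (B \<inter> {..m}) \<le> card B" using finB by (intro card_mono) auto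
    ultimately show ?thesis using K by linarith
  next
    case False
    then have "A1 \<inter> {..m} = A \<inter> {..m}" using a by (auto simp: A1_def)
    moreover have "card (B \<inter> {..m}) \<le> card (insert b B \<inter> {..m})" using finB by (intro card_mono) auto
    ultimately show ?thesis using insert.prems(2)[of m] by simp
  qed
  obtain w where w: "\<forall>Q. finite Q \<longrightarrow> (\<forall>q\<in>Q. \<forall>y\<in>A1 \<union> B. q < y) \<longrightarrow> knuth (col A1 @ col Q @ col B) (w @ col Q)"
    using insert.IH[OF fin1 cond] by (elim exE)
  have B: "col (insert b B) = b # col B"
    using finB insert.hyps(2) by (simp add: col_insert_max)
  show ?case
  proof (intro exI[of _ "a # w"] allI impI)
    fix Q :: "nat set" assume Q: "finite Q" "\<forall>q\<in>Q. \<forall>y\<in>A \<union> insert b B. q < y"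
    have nQ: "b \<notin> Q" "a \<notin> Q" using Q(2) a(1) by blast+
    have "knuth (a # col (A1 \<union> Q)) (col (insert a (A1 \<union> Q - {b})) @ [b])"
    proof (rule knuth_column_insert)
      show "c < a \<or> b \<le> c" if "c \<in> A1 \<union> Q" for c
      proof (cases "c \<in> Q")
        case True
        then have "c < a" using that Q(2) a(1) by blast
        then show ?thesis by simp
      next
        case False
        then show ?thesis using that al by (force simp: A1_def)
      qed
    qed (use Q fin1 a in \<open>simp_all add: A1_def\<close>)
    moreover have "insert a (A1 \<union> Q - {b}) = A \<union> Q"
    proof -
      have "b \<in> A \<Longrightarrow> a = b" using al[of b] a(2) by simp
      then show ?thesis using a nQ by (auto simp: A1_def)
    qed
    moreover have "col (A \<union> Q) = col A @ col Q"
      by (rule col_Un) (use Q insert.prems(1) in auto)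
    moreover have "col (A1 \<union> Q) = col A1 @ col Q"
      by (rule col_Un) (use Q fin1 in \<open>auto simp: A1_def\<close>)
    ultimately have "knuth (col A @ col Q @ [b]) (a # col A1 @ col Q)" by (simp add: knuth.sym)
    from knuth_context[OF this, of "[]" "col B"]
    have "knuth (col A @ col Q @ col (insert b B)) (a # col A1 @ col Q @ col B)" by (simp add: B)
    moreover have "knuth (col A1 @ col Q @ col B) (w @ col Q)"
      using w Q by (auto simp: A1_def)
    from knuth_context[OF this, of "[a]" "[]"]
    have "knuth (a # col A1 @ col Q @ col B) ((a # w) @ col Q)" by simp
    ultimately show "knuth (col A @ col Q @ col (insert b B)) ((a # w) @ col Q)" by (rule knuth.trans)
  qed
qed

text \<open>Both columns are cut at \<open>x\<close>. The letters of \<open>A\<close> below \<open>x\<close> are first moved to the right past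
  the letters of \<open>B\<close> from \<open>x\<close> upwards; then \<open>x\<close> moves to the left past the larger letters of \<open>B\<close>;
  finally the first step is undone without \<open>x\<close>.\<close>

lemma knuth_move:
  assumes fin: "finite A" "finite B" and x: "x \<in> B" "x \<notin> A"
    and above: "\<And>m. card (B \<inter> {x<..m}) \<le> card (A \<inter> {x<..m})"
    and below: "\<And>m. card (A \<inter> {m..<x}) \<le> card (B \<inter> {m..<x})"
  shows "knuth (col A @ col B) (col (insert x A) @ col (B - {x}))"
proof -
  define Ah Al Bh Bl where "Ah = A \<inter> {x<..}" and "Al = A \<inter> {..<x}" and "Bh = B \<inter> {x<..}" and "Bl = B \<inter> {..<x}"
  have f: "finite Ah" "finite Al" "finite Bh" "finite Bl"
    using fin by (simp_all add: Ah_def Al_def Bh_def Bl_def)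
  have lt: "\<forall>y\<in>Ah \<union> Bh. x < y" "\<forall>y\<in>Al \<union> Bl. y < x" by (auto simp: Ah_def Al_def Bh_def Bl_def)
  have "card (Al \<inter> {m..}) \<le> card (Bl \<inter> {m..})" for m
  proof -
    have "Al \<inter> {m..} = A \<inter> {m..<x}" "Bl \<inter> {m..} = B \<inter> {m..<x}" by (auto simp: Al_def Bl_def)
    then show ?thesis using below by simp
  qed
  from knuth_commute_low[OF f(2,4) this] obtain w where
    w: "\<forall>Q. finite Q \<longrightarrow> (\<forall>q\<in>Q. \<forall>y\<in>Al \<union> Bl. y < q) \<longrightarrow> knuth (col Al @ col Q @ col Bl) (col Q @ w)"
    by (elim exE)
  have "card (Bh \<inter> {..m}) \<le> card (Ah \<inter> {..m})" for m
  proof -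
    have "Ah \<inter> {..m} = A \<inter> {x<..m}" "Bh \<inter> {..m} = B \<inter> {x<..m}" by (auto simp: Ah_def Bh_def)
    then show ?thesis using above by simp
  qed
  from knuth_commute_high[OF f(1,3) this] obtain z where
    z: "\<forall>Q. finite Q \<longrightarrow> (\<forall>q\<in>Q. \<forall>y\<in>Ah \<union> Bh. q < y) \<longrightarrow> knuth (col Ah @ col Q @ col Bh) (z @ col Q)"
    by (elim exE)
  have lts: "t < s" if "s \<in> Ah \<union> Bh" "t \<in> Al \<union> Bl" for s t using lt that less_trans by blast
  have "A = Ah \<union> Al" "B = Bh \<union> insert x Bl" "insert x A = Ah \<union> insert x Al" "B - {x} = Bh \<union> Bl"
    using x by (auto simp: Ah_def Al_def Bh_def Bl_def) (metis linorder_neqE_nat)+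
  moreover have "col (Ah \<union> Al) = col Ah @ col Al" "col (Bh \<union> Bl) = col Bh @ col Bl"
    "col (Bh \<union> insert x Bl) = col Bh @ col (insert x Bl)" "col (Ah \<union> insert x Al) = col Ah @ col (insert x Al)"
    by (rule col_Un; use f lt lts in auto)+
  moreover have "col (insert x Bl) = x # col Bl" "col (insert x Al) = x # col Al"
    by (rule col_insert_max; use f lt in auto)+
  ultimately have C: "col A = col Ah @ col Al" "col B = col Bh @ x # col Bl"
    "col (insert x A) = col Ah @ x # col Al" "col (B - {x}) = col Bh @ col Bl" by simp_all
  have Bx: "col (insert x Bh) = col Bh @ [x]" using col_Un[of Bh "{x}"] f lt by simp
  have "knuth (col Al @ col (insert x Bh) @ col Bl) (col (insert x Bh) @ w)"
    by (rule w[rule_format]) (use f lt lts in auto)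
  from knuth_context[OF this, of "col Ah" "[]"]
  have 1: "knuth (col A @ col B) (col Ah @ col Bh @ x # w)" by (simp add: Bx C)
  have "knuth (col Ah @ col {} @ col Bh) (z @ col {})" "knuth (col Ah @ col {x} @ col Bh) (z @ col {x})"
    by (rule z[rule_format]; use lt in auto)+
  then have "knuth (col Ah @ col Bh) z" and h2: "knuth (col Ah @ x # col Bh) (z @ [x])" by simp_all
  from knuth_context[OF this(1), of "[]" "[x]"] have "knuth (col Ah @ col Bh @ [x]) (z @ [x])" by simp
  then have "knuth (col Ah @ col Bh @ [x]) (col Ah @ x # col Bh)" using knuth.trans knuth.sym[OF h2] by blast
  from knuth_context[OF this, of "[]" w] have 2: "knuth (col Ah @ col Bh @ x # w) (col Ah @ x # col Bh @ w)" by simp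
  have "knuth (col Al @ col Bh @ col Bl) (col Bh @ w)"
    by (rule w[rule_format]) (use f lts in auto)
  from knuth_context[OF knuth.sym[OF this], of "col Ah @ [x]" "[]"]
  have 3: "knuth (col Ah @ x # col Bh @ w) (col (insert x A) @ col (B - {x}))" by (simp add: C)
  show ?thesis by (rule knuth.trans[OF 1 knuth.trans[OF 2 3]])
qed

definition excess :: "nat set \<Rightarrow> nat set \<Rightarrow> nat \<Rightarrow> int" where
  "excess A B m = int (card (B \<inter> {..m})) - int (card (A \<inter> {..m}))"

lemma excess_Suc: "excess A B (Suc m) = excess A B m + of_bool (Suc m \<in> B) - of_bool (Suc m \<in> A)"
  by (simp add: excess_def card_atMost_Suc)

text \<open>At the first maximum of the excess of the second column over the first the two counting
  conditions of \<open>knuth_move\<close> hold: above it the excess does not grow, and on every interval that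
  ends just below it the second column has at least as many letters as the first.\<close>

lemma knuth_move_excess:
  assumes fin: "finite A" "finite B"
    and "\<And>m. excess A B m \<le> excess A B (Suc y)"
    and "\<And>m. m \<le> y \<Longrightarrow> excess A B m < excess A B (Suc y)"
    and z: "0 \<notin> A" "0 \<notin> B"
  shows "knuth (col A @ col B) (col (insert (Suc y) A) @ col (B - {Suc y}))"
proof -
  have y: "excess A B y < excess A B (Suc y)" using assms(4) by simp
  then have x: "Suc y \<in> B" "Suc y \<notin> A"
    unfolding excess_Suc by (cases "Suc y \<in> B"; cases "Suc y \<in> A"; simp)+
  have split: "card (S \<inter> {..k}) + card (S \<inter> {k<..m}) = card (S \<inter> {..m})" if "k \<le> m" for S :: "nat set" and k m
  proof -
    have "S \<inter> {..m} = (S \<inter> {..k}) \<union> (S \<inter> {k<..m})" using that by auto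
    moreover have "card ((S \<inter> {..k}) \<union> (S \<inter> {k<..m})) = card (S \<inter> {..k}) + card (S \<inter> {k<..m})"
      by (rule card_Un_disjoint) auto
    ultimately show ?thesis by simp
  qed
  show ?thesis
  proof (rule knuth_move[OF fin x])
    show "card (B \<inter> {Suc y<..m}) \<le> card (A \<inter> {Suc y<..m})" for m
    proof (cases "Suc y \<le> m")
      case True
      then show ?thesis using assms(3)[of m] split[OF True, of A] split[OF True, of B]
        by (simp add: excess_def)
    next
      case False
      then have "{Suc y<..m} = {}" by simp
      then show ?thesis by simp
    qed
    show "card (A \<inter> {m..<Suc y}) \<le> card (B \<inter> {m..<Suc y})" for m
    proof (cases m)
      case 0
      then have "A \<inter> {m..<Suc y} = A \<inter> {..y}" "B \<inter> {m..<Suc y} = B \<inter> {..y}" by auto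
      moreover have "excess A B 0 = 0" using z by (simp add: excess_def)
      then have "0 \<le> excess A B y" using assms(4)[of 0] x unfolding excess_Suc by simp
      ultimately show ?thesis by (simp add: excess_def)
    next
      case (Suc k)
      show ?thesis
      proof (cases "k \<le> y")
        case True
        have "{m..<Suc y} = {k<..y}" using Suc by auto
        moreover have "excess A B k \<le> excess A B y" using assms(4)[OF True] x unfolding excess_Suc by simp
        ultimately show ?thesis using split[OF True, of A] split[OF True, of B] by (simp add: excess_def)
      next
        case False
        then show ?thesis using Suc by simp
      qed
    qed
  qed
qed

lemma excess_beyond:
  assumes "A \<subseteq> {1..N}" "B \<subseteq> {1..N}" "N \<le> m"
  shows "excess A B m = excess A B N"
proof -
  have "A \<inter> {..m} = A" "B \<inter> {..m} = B" "A \<inter> {..N} = A" "B \<inter> {..N} = B" using assms by auto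
  then show ?thesis by (simp add: excess_def)
qed

lemma excess_Max:
  assumes "A \<subseteq> {1..N}" "B \<subseteq> {1..N}"
  defines "M \<equiv> Max (excess A B ` {..N})"
  shows "excess A B m \<le> M" and "\<exists>m\<le>N. excess A B m = M" and "0 \<le> M"
proof -
  show le: "excess A B m \<le> M" for m
  proof (cases "m \<le> N")
    case False
    then have "excess A B m = excess A B N" by (intro excess_beyond[OF assms(1,2)]) simp
    then show ?thesis by (simp add: M_def)
  qed (simp add: M_def)
  have "M \<in> excess A B ` {..N}" unfolding M_def by (rule Max_in) simp_all
  then show "\<exists>m\<le>N. excess A B m = M" by auto
  have "A \<inter> {..0} = {}" "B \<inter> {..0} = {}" using assms(1,2) by auto
  then have "excess A B 0 = 0" by (simp add: excess_def)
  then show "0 \<le> M" using le[of 0] by simp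
qed

text \<open>The letter to be moved sits at the first maximum of the excess, which is positive for columns
  that do not form a tableau.\<close>

lemma knuth_lower:
  assumes sub: "A \<subseteq> {1..N}" "B \<subseteq> {1..N}" and nb: "\<not> ballot A B"
  shows "\<exists>x\<in>B - A. knuth (col A @ col B) (col (insert x A) @ col (B - {x}))"
proof -
  define M where "M = Max (excess A B ` {..N})"
  note M = excess_Max[OF sub, folded M_def]
  obtain m0 where "card (A \<inter> {..m0}) < card (B \<inter> {..m0})" using nb by (auto simp: ballot_def not_le)
  then have "0 < excess A B m0" by (simp add: excess_def)
  then have pos: "0 < M" using M(1)[of m0] by simp
  define x where "x = (LEAST m. excess A B m = M)"
  have x: "excess A B x = M" unfolding x_def using M(2) by (metis (mono_tags, lifting) LeastI)
  have z: "0 \<notin> A" "0 \<notin> B" using sub by auto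
  then have "excess A B 0 = 0" by (simp add: excess_def)
  then obtain y where y: "x = Suc y" using x pos by (cases x) auto
  have lt: "excess A B m < excess A B (Suc y)" if "m \<le> y" for m
  proof -
    have "m < x" using that y by simp
    then have "excess A B m \<noteq> M" unfolding x_def by (rule not_less_Least)
    then show ?thesis using M(1)[of m] x y by simp
  qed
  have "excess A B y < excess A B (Suc y)" by (rule lt) simp
  then have "Suc y \<in> B - A"
    unfolding excess_Suc by (cases "Suc y \<in> B"; cases "Suc y \<in> A"; simp)
  moreover have "knuth (col A @ col B) (col (insert (Suc y) A) @ col (B - {Suc y}))"
  proof (rule knuth_move_excess)
    show "finite A" "finite B" using sub finite_subset by blast+
    show "excess A B m \<le> excess A B (Suc y)" for m using M(1) x y by simp
  qed (use lt z in simp_all)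
  ultimately show ?thesis by blast
qed

text \<open>The inverse of \<open>knuth_lower\<close>: the letter that follows the last maximum of the excess is moved.
  Its move raises the excess by two from there on, so that it becomes the first maximum.\<close>

lemma knuth_raise:
  assumes sub: "A \<subseteq> {1..N}" "B \<subseteq> {1..N}" and c: "card B < card A"
  shows "\<exists>x\<in>A - B. knuth (col A @ col B) (col (A - {x}) @ col (insert x B))"
proof -
  define M where "M = Max (excess A B ` {..N})"
  note M = excess_Max[OF sub, folded M_def]
  define S where "S = {m. m \<le> N \<and> excess A B m = M}"
  have S: "finite S" "S \<noteq> {}" using M(2) by (auto simp: S_def)
  define y where "y = Max S"
  have "y \<in> S" unfolding y_def using S by (rule Max_in)
  then have y: "y \<le> N" "excess A B y = M" by (simp_all add: S_def)
  have "A \<inter> {..N} = A" "B \<inter> {..N} = B" using sub by auto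
  then have neg: "excess A B N < 0" using c by (simp add: excess_def)
  then have "y < N" using y M(3) by (cases "y = N") auto
  have lt: "excess A B m < M" if "y < m" for m
  proof -
    \<comment> \<open>Beyond \<open>N\<close> the excess keeps its value at \<open>N\<close>, which is negative.\<close>
    have "excess A B m \<noteq> M"
    proof (cases "m \<le> N")
      case True
      have "m \<notin> S" using that Max_ge[OF S(1)] unfolding y_def by (meson leD)
      then show ?thesis using True by (simp add: S_def)
    next
      case False
      then show ?thesis using excess_beyond[OF sub, of m] neg M(3) by simp
    qed
    then show ?thesis using M(1)[of m] by simp
  qed
  have d: "excess A B (Suc y) < excess A B y" using lt[of "Suc y"] y by simp
  then have x: "Suc y \<in> A" "Suc y \<notin> B"
    unfolding excess_Suc by (cases "Suc y \<in> B"; cases "Suc y \<in> A"; simp)+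
  define A' B' where "A' = A - {Suc y}" and "B' = insert (Suc y) B"
  have z: "0 \<notin> A" "0 \<notin> B" and fin: "finite A" "finite B" using sub finite_subset by auto
  have e: "excess A' B' m = excess A B m + (if Suc y \<le> m then 2 else 0)" for m
  proof (induction m)
    case 0
    have "A' \<inter> {..0} = {}" "B' \<inter> {..0} = {}" "A \<inter> {..0} = {}" "B \<inter> {..0} = {}"
      using z by (auto simp: A'_def B'_def)
    then show ?case by (simp add: excess_def)
  next
    case (Suc m)
    then show ?case unfolding excess_Suc A'_def B'_def using x
      by (cases "m = y"; cases "y < m"; simp add: not_less Suc_le_eq)
  qed
  have "excess A B (Suc y) = M - 1" using x y by (simp add: excess_Suc)
  then have eS: "excess A' B' (Suc y) = M + 1" by (simp add: e)
  have "knuth (col A' @ col B') (col (insert (Suc y) A') @ col (B' - {Suc y}))"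
  proof (rule knuth_move_excess)
    show "finite A'" "finite B'" "0 \<notin> A'" "0 \<notin> B'" using fin z by (simp_all add: A'_def B'_def)
    show "excess A' B' m \<le> excess A' B' (Suc y)" for m
      unfolding eS using lt[of m] M(1)[of m] by (cases "y < m") (simp_all add: e Suc_le_eq)
    show "excess A' B' m < excess A' B' (Suc y)" if "m \<le> y" for m
      unfolding eS using M(1)[of m] that by (simp add: e)
  qed
  moreover have "insert (Suc y) A' = A" "B' - {Suc y} = B" using x by (auto simp: A'_def B'_def)
  ultimately have "knuth (col A @ col B) (col A' @ col B')" by (simp add: knuth.sym)
  then show ?thesis using x unfolding A'_def B'_def by blast
qed


section \<open>Pairs of columns up to Knuth equivalence\<close>

lemma ambientE:
  assumes "b \<in> ambient n r"
  obtains A B where "b = (col A, col B)" "A \<subseteq> {1..2*n}" "B \<subseteq> {1..2*n}" "card A = 2*n - r" "card B = r"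
    "finite A" "finite B"
proof -
  obtain u v where b: "b = (u, v)" "u \<in> columns n (2*n - r)" "v \<in> columns n r"
    using assms by (auto simp: ambient_def)
  obtain A where A: "A \<subseteq> {1..2*n}" "card A = 2*n - r" "u = col A" "finite A" using b(2) by (rule columnsE)
  obtain B where B: "B \<subseteq> {1..2*n}" "card B = r" "v = col B" "finite B" using b(3) by (rule columnsE)
  show ?thesis by (rule that[of A B]) (use A B b in simp_all)
qed

lemma ambientI:
  "A \<subseteq> {1..2*n} \<Longrightarrow> B \<subseteq> {1..2*n} \<Longrightarrow> card A = 2*n - r \<Longrightarrow> card B = r \<Longrightarrow> (col A, col B) \<in> ambient n r"
  by (simp add: ambient_def columns_col)

abbreviation kn :: "word \<times> word \<Rightarrow> word \<times> word \<Rightarrow> bool" where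
  "kn b c \<equiv> knuth (to_word b) (to_word c)"

lemma kn_sym: "kn b c \<Longrightarrow> kn c b" by (rule knuth.sym)
lemma kn_trans: "kn b c \<Longrightarrow> kn c d \<Longrightarrow> kn b d" by (rule knuth.trans)

lemma kn_inj:
  assumes "b \<in> ambient n r" "c \<in> ambient n r" "kn b c"
  shows "b = c"
proof -
  obtain A B where b: "b = (col A, col B)" "A \<subseteq> {1..2*n}" "B \<subseteq> {1..2*n}" "card A = 2*n - r" 
    using assms(1) by (rule ambientE)
  obtain A' B' where c: "c = (col A', col B')" "A' \<subseteq> {1..2*n}" "B' \<subseteq> {1..2*n}" "card A' = 2*n - r" 
    using assms(2) by (rule ambientE)
  have "A = A' \<and> B = B'"
    by (rule knuth_columns_unique[OF _ b(2,3) c(2,3)]) (use assms(3) b c in \<open>simp_all add: to_word_def\<close>)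
  then show ?thesis using b c by simp
qed

lemma kn_raise:
  assumes "b \<in> ambient n r" "r < n"
  shows "\<exists>c\<in>ambient n (Suc r). kn b c"
proof -
  obtain A B where b: "b = (col A, col B)" "A \<subseteq> {1..2*n}" "B \<subseteq> {1..2*n}" "card A = 2*n - r" "card B = r"
    "finite A" "finite B" using assms(1) by (rule ambientE)
  have "card B < card A" using b(4,5) assms(2) by linarith
  then obtain x where x: "x \<in> A - B" "knuth (col A @ col B) (col (A - {x}) @ col (insert x B))"
    using knuth_raise[OF b(2,3)] by blast
  have "(col (A - {x}), col (insert x B)) \<in> ambient n (Suc r)"
    by (rule ambientI) (use b x(1) in auto)
  then show ?thesis using x(2) b(1) by (intro bexI) (simp_all add: to_word_def)
qed

lemma kn_lower:
  assumes "b \<in> ambient n (Suc r)" "Suc r \<le> 2*n" "\<not> ballot (set (fst b)) (set (snd b))"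
  shows "\<exists>c\<in>ambient n r. kn b c"
proof -
  obtain A B where b: "b = (col A, col B)" "A \<subseteq> {1..2*n}" "B \<subseteq> {1..2*n}" "card A = 2*n - Suc r" "card B = Suc r"
    "finite A" "finite B" using assms(1) by (rule ambientE)
  then obtain x where x: "x \<in> B - A" "knuth (col A @ col B) (col (insert x A) @ col (B - {x}))"
    using knuth_lower[OF b(2,3)] assms(3) by auto
  have "(col (insert x A), col (B - {x})) \<in> ambient n r"
    by (rule ambientI) (use b x(1) assms(2) in auto)
  then show ?thesis using x(2) b(1) by (intro bexI) (simp_all add: to_word_def)
qed

text \<open>Among Knuth equivalent pairs of columns a tableau has the longest first column, because that
  column is a longest decreasing subsequence.\<close>

lemma ballot_le:
  assumes "b \<in> ambient n k" "ballot (set (fst b)) (set (snd b))" "c \<in> ambient n j" "kn b c" "j \<le> 2*n"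
  shows "k \<le> j"
proof -
  obtain A B where b: "b = (col A, col B)" "A \<subseteq> {1..2*n}" "B \<subseteq> {1..2*n}" "card A = 2*n - k" "card B = k"
    "finite A" "finite B" using assms(1) by (rule ambientE)
  obtain A' B' where c: "c = (col A', col B')" "A' \<subseteq> {1..2*n}" "B' \<subseteq> {1..2*n}" "card A' = 2*n - j" "card B' = j"
    "finite A'" "finite B'" using assms(3) by (rule ambientE)
  have z: "0 \<notin> A" "0 \<notin> B" "0 \<notin> A'" "0 \<notin> B'" using b(2,3) c(2,3) by auto
  have "decD A B (2*n) = decD A' B' (2*n)"
    by (rule decD_knuth) (use assms(4) b c z in \<open>simp_all add: to_word_def\<close>)
  moreover have "decD A B (2*n) = card A" using ballot_iff_decD[OF b(2,3)] assms(2) b by simp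
  moreover have "A' \<inter> {..2*n} = A'" "B' \<inter> {..2*n} = B'" using c(2,3) by auto
  then have "card A' \<le> decD A' B' (2*n)" "card B' \<le> decD A' B' (2*n)"
    using card_le_decD[OF z(3,4), of "2*n"] by simp_all
  moreover have "card B \<le> card {1..2*n}" by (rule card_mono) (use b in simp_all)
  ultimately show ?thesis using b(4,5) c(4) assms(5) by simp
qed

text \<open>While the pair is not a tableau, a letter can be moved to the first column; this stops at the
  latest when the second column is empty.\<close>

lemma tableau_exists:
  assumes "b \<in> ambient n r" "r \<le> n" "n \<ge> 1"
  shows "\<exists>k\<le>r. \<exists>c\<in>ambient n k. ballot (set (fst c)) (set (snd c)) \<and> kn b c"
  using assms(1,2)
proof (induction r arbitrary: b)
  case 0
  obtain A B where b: "b = (col A, col B)" "card B = 0" "finite B" using 0(1) by (rule ambientE)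
  then have "set (snd b) = {}" by simp
  then have "ballot (set (fst b)) (set (snd b))" by (simp add: ballot_def)
  then show ?case using 0 knuth.refl by blast
next
  case (Suc r)
  show ?case
  proof (cases "ballot (set (fst b)) (set (snd b))")
    case True
    then show ?thesis using Suc.prems knuth.refl by blast
  next
    case False
    obtain c where c: "c \<in> ambient n r" "kn b c" using kn_lower[OF Suc.prems(1) _ False] Suc.prems(2) by auto
    obtain k d where d: "k \<le> r" "d \<in> ambient n k" "ballot (set (fst d)) (set (snd d))" "kn c d"
      using Suc.IH[OF c(1)] Suc.prems(2) by auto
    have "kn b d" using c(2) d(4) by (rule knuth.trans)
    then show ?thesis using d by (intro exI[of _ k]) auto
  qed
qed

lemma ballot_tableau_word:
  assumes "b \<in> ambient n r" "r \<le> n" "n \<ge> 1" "ballot (set (fst b)) (set (snd b))"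
  shows "tableau_word (to_word b)"
proof -
  obtain A B where b: "b = (col A, col B)" "A \<subseteq> {1..2*n}" "B \<subseteq> {1..2*n}" "card A = 2*n - r" "card B = r"
    "finite A" "finite B" using assms(1) by (rule ambientE)
  have "A \<noteq> {}" using b(4) assms(2,3) by auto
  then show ?thesis using ballot_tableau[of A B] assms(4) b by (simp add: to_word_def)
qed

text \<open>Existence and uniqueness of the tableau in the class of two columns turn the definite
  description in \<open>schensted\<close> into a characterization.\<close>

lemma schensted_iff:
  assumes "b \<in> ambient n r" "r \<le> n" "n \<ge> 1"
  shows "schensted (to_word b) = t \<longleftrightarrow> tableau_word t \<and> knuth (to_word b) t"
proof -
  obtain A B where b: "b = (col A, col B)" "A \<subseteq> {1..2*n}" "B \<subseteq> {1..2*n}" using assms(1) by (rule ambientE)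
  obtain k c where c: "k \<le> r" "c \<in> ambient n k" "ballot (set (fst c)) (set (snd c))" "kn b c"
    using tableau_exists[OF assms] by blast
  have tc: "tableau_word (to_word c) \<and> knuth (to_word b) (to_word c)"
    using ballot_tableau_word[OF c(2) _ assms(3) c(3)] c(1,4) assms(2) by simp
  have uniq: "t = to_word c" if "tableau_word t \<and> knuth (to_word b) t" for t
    by (rule tableau_unique[OF _ _ _ _ b(2,3)]) (use that tc b(1) in \<open>simp_all add: to_word_def\<close>)
  have S: "schensted (to_word b) = to_word c"
    unfolding schensted_def using tc uniq by (rule the_equality)
  show ?thesis
  proof
    assume "schensted (to_word b) = t"
    then show "tableau_word t \<and> knuth (to_word b) t" using S tc by simp
  next
    assume "tableau_word t \<and> knuth (to_word b) t"
    then show "schensted (to_word b) = t" using S uniq by simp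
  qed
qed

lemma schensted_eq_iff:
  assumes "b \<in> ambient n r" "r \<le> n" "c \<in> ambient n s" "s \<le> n" "n \<ge> 1"
  shows "schensted (to_word b) = schensted (to_word c) \<longleftrightarrow> kn b c"
proof -
  define t where "t = schensted (to_word c)"
  have t: "tableau_word t" "knuth (to_word c) t"
    using schensted_iff[OF assms(3,4,5), of t] by (simp_all add: t_def)
  have "schensted (to_word b) = t \<longleftrightarrow> knuth (to_word b) t"
    using schensted_iff[OF assms(1,2,5), of t] t(1) by simp
  also have "\<dots> \<longleftrightarrow> kn b c"
    by (rule iffI) (erule knuth.trans, rule knuth.sym[OF t(2)], erule knuth.trans, rule t(2))
  finally show ?thesis by (simp add: t_def)
qed

subsection \<open>Operators and transport along classes\<close>

lemma kn_ops:
  assumes "b \<in> ambient n r" "c \<in> ambient n s" "kn b c" "1 \<le> i" "i \<le> 2*n - 1"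
  shows "rel_option kn (tens_f n i b) (tens_f n i c)" "rel_option kn (tens_e n i b) (tens_e n i c)"
    and "depth (tens_f n i) b = depth (tens_f n i) c" "depth (tens_e n i) b = depth (tens_e n i) c"
  using knuth_crystal_sim[OF assms(3), of n i] assms
  by (simp_all add: crystal_sim_def to_word_tens depth_tens option.rel_map)

lemma kn_weight: "kn b c \<Longrightarrow> wt_A n (to_word b) = wt_A n (to_word c)"
proof -
  assume "kn b c"
  then have "count_list (to_word b) = count_list (to_word c)" by (intro ext knuth_count)
  then show ?thesis by (simp only: wt_A_def)
qed

text \<open>Knuth equivalent results are equal as soon as they lie in the same ambient crystal.\<close>

lemma kn_intertwine:
  assumes "rel_option kn x y" "\<And>b. x = Some b \<Longrightarrow> \<psi> b \<in> ambient n s \<and> kn b (\<psi> b)"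
    and "\<And>c. y = Some c \<Longrightarrow> c \<in> ambient n s"
  shows "y = map_option \<psi> x"
proof (cases x)
  case None
  then show ?thesis using assms(1) by simp
next
  case (Some b)
  then obtain c where c: "y = Some c" "kn b c" using assms(1) by (cases y) auto
  have "kn b (\<psi> b)" "\<psi> b \<in> ambient n s" using assms(2)[OF Some] by simp_all
  then have "c = \<psi> b" using c(2) assms(3)[OF c(1)] kn_inj kn_trans kn_sym by blast
  then show ?thesis using Some c(1) by simp
qed

text \<open>Operators send equivalent pairs to equivalent pairs, and within one ambient crystal a pair is
  determined by its class. So a map that preserves classes commutes with all operators; no
  formula for the map is needed.\<close>

lemma kn_crystal_embedding:
  assumes "n \<ge> 1" and \<psi>: "\<And>b. b \<in> ambient n r \<Longrightarrow> \<psi> b \<in> ambient n s \<and> kn b (\<psi> b)"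
  shows "crystal_embedding {1..2*n - 1} (ambient_crystal n r) (ambient_crystal n s) \<psi>"
  unfolding crystal_embedding_def ambient_crystal_def
proof (simp, intro conjI ballI)
  show "\<psi> ` ambient n r \<subseteq> ambient n s" using \<psi> by blast
  show "inj_on \<psi> (ambient n r)"
  proof (rule inj_onI)
    fix b c assume bc: "b \<in> ambient n r" "c \<in> ambient n r" "\<psi> b = \<psi> c"
    then have "kn b c" using \<psi>[OF bc(1)] \<psi>[OF bc(2)] knuth.trans knuth.sym by metis
    then show "b = c" using bc kn_inj by blast
  qed
  fix b assume b: "b \<in> ambient n r"
  show "wt_A n (to_word (\<psi> b)) = wt_A n (to_word b)" using \<psi>[OF b] kn_weight[of b "\<psi> b"] by simp
  fix i assume "i \<in> {Suc 0..2*n - Suc 0}"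
  then have i: "1 \<le> i" "i \<le> 2*n - 1" by simp_all
  have \<psi>b: "\<psi> b \<in> ambient n s" "kn b (\<psi> b)" using \<psi>[OF b] by simp_all
  note K = kn_ops[OF b \<psi>b i]
  show "tens_e n i (\<psi> b) = map_option \<psi> (tens_e n i b)"
    by (rule kn_intertwine[OF K(2)]) (use tens_ambient[OF b i(2) assms(1)] tens_ambient[OF \<psi>b(1) i(2) assms(1)] \<psi> in blast)+
  show "tens_f n i (\<psi> b) = map_option \<psi> (tens_f n i b)"
    by (rule kn_intertwine[OF K(1)]) (use tens_ambient[OF b i(2) assms(1)] tens_ambient[OF \<psi>b(1) i(2) assms(1)] \<psi> in blast)+
  show "depth (tens_e n i) (\<psi> b) = depth (tens_e n i) b" "depth (tens_f n i) (\<psi> b) = depth (tens_f n i) b"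
    using K(3,4) by simp_all
qed

definition transport :: "nat \<Rightarrow> nat \<Rightarrow> word \<times> word \<Rightarrow> word \<times> word" where
  "transport n s b = (THE c. c \<in> ambient n s \<and> kn b c)"

lemma transport_eq:
  assumes "c \<in> ambient n s" "kn b c"
  shows "transport n s b = c"
  unfolding transport_def
  by (rule the_equality) (use assms kn_inj knuth.trans knuth.sym in blast)+

text \<open>Classes that meet \<open>ambient n k\<close> also meet \<open>ambient n r\<close> for \<open>k \<le> r \<le> n\<close>, by repeated use of
  \<open>knuth_raise\<close>.\<close>

lemma kn_exists:
  assumes "b \<in> ambient n k" "k \<le> r" "r \<le> n"
  shows "\<exists>c\<in>ambient n r. kn b c"
  using assms(2,3)
proof (induction r rule: dec_induct)
  case base
  then show ?case using assms(1) knuth.refl by blast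
next
  case (step r)
  then obtain c where c: "c \<in> ambient n r" "kn b c" by auto
  obtain d where "d \<in> ambient n (Suc r)" "kn c d" using kn_raise[OF c(1)] step.prems by auto
  then show ?case using c(2) kn_trans by blast
qed

lemma transport_class:
  assumes "b \<in> ambient n k" "k \<le> r" "r \<le> n"
  shows "transport n r b \<in> ambient n r" "kn b (transport n r b)"
  using kn_exists[OF assms] transport_eq by blast+

text \<open>Both conditions in the definition of \<open>i_map\<close> say the same: preserving the tableau is
  preserving the class, and this forces the values and makes the map an embedding.\<close>

lemma i_map_eq:
  assumes "r < n"
  shows "i_map n r = restrict (transport n (Suc r)) (ambient n r)"
  unfolding i_map_def
proof (rule the_equality)
  have n: "n \<ge> 1" using assms by simp
  let ?t = "restrict (transport n (Suc r)) (ambient n r)"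
  have t: "?t b \<in> ambient n (r + 1) \<and> kn b (?t b)" if "b \<in> ambient n r" for b
    using transport_class[OF that, of "Suc r"] assms that by simp
  show "?t \<in> extensional (ambient n r) \<and>
    crystal_embedding {1..2 * n - 1} (ambient_crystal n r) (ambient_crystal n (r + 1)) ?t \<and>
    (\<forall>b\<in>ambient n r. schensted (to_word (?t b)) = schensted (to_word b))"
  proof (intro conjI ballI)
    show "crystal_embedding {1..2 * n - 1} (ambient_crystal n r) (ambient_crystal n (r + 1)) ?t"
      by (rule kn_crystal_embedding[OF n t])
    fix b assume b: "b \<in> ambient n r"
    show "schensted (to_word (?t b)) = schensted (to_word b)"
      using schensted_eq_iff[of "?t b" n "r + 1" b r] t[OF b] b assms n knuth.sym by simp
  qed simp
  fix \<psi> assume \<psi>: "\<psi> \<in> extensional (ambient n r) \<and>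
    crystal_embedding {1..2 * n - 1} (ambient_crystal n r) (ambient_crystal n (r + 1)) \<psi> \<and>
    (\<forall>b\<in>ambient n r. schensted (to_word (\<psi> b)) = schensted (to_word b))"
  then have im: "\<psi> ` ambient n r \<subseteq> ambient n (r + 1)"
    by (simp add: crystal_embedding_def ambient_crystal_def)
  show "\<psi> = ?t"
  proof (rule extensionalityI[of _ "ambient n r"])
    fix b assume b: "b \<in> ambient n r"
    then have 1: "\<psi> b \<in> ambient n (r + 1)" using im by blast
    then have "kn b (\<psi> b)"
      using schensted_eq_iff[OF b _ 1 _ n] \<psi> b assms by simp
    then show "\<psi> b = ?t b" using transport_eq[of "\<psi> b" n "Suc r" b] 1 b by simp
  qed (use \<psi> in simp_all)
qed

lemma i_maps:
  assumes "b \<in> ambient n k" "k \<le> r" "r \<le> n"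
  shows "fold (i_map n) [k..<r] b = transport n r b"
  using assms(2,3)
proof (induction r rule: dec_induct)
  case base
  then show ?case using transport_eq[OF assms(1) knuth.refl] by simp
next
  case (step r)
  then have IH: "fold (i_map n) [k..<r] b = transport n r b" by simp
  note T = transport_class[OF assms(1) step.hyps(1)]
  have r: "r \<le> n" "r < n" using step.prems by simp_all
  have "fold (i_map n) [k..<Suc r] b = i_map n r (transport n r b)"
    using IH step.hyps(1) by simp
  also have "\<dots> = transport n (Suc r) (transport n r b)"
    using i_map_eq[OF r(2)] T(1)[OF r(1)] by simp
  also have "\<dots> = transport n (Suc r) b"
  proof (rule transport_eq)
    show "transport n (Suc r) b \<in> ambient n (Suc r)" using transport_class(1)[OF assms(1), of "Suc r"] step by simp
    show "kn (transport n r b) (transport n (Suc r) b)"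
      using transport_class(2)[OF assms(1), of "Suc r"] T(2)[OF r(1)] step kn_trans kn_sym by (metis le_SucI)
  qed
  finally show ?case .
qed


section \<open>Words in five states\<close>

text \<open>Write \<open>i'\<close> for \<open>2n + 1 - i\<close>, and replace the first column \<open>A\<close> by the set \<open>A\<^sup>*\<close> of all \<open>y\<close> such that
  \<open>y'\<close> is not in \<open>A\<close>. For \<open>i \<le> n\<close> the states say which of \<open>i\<close> and \<open>i'\<close> lie in the two columns \<open>A\<^sup>*\<close> and
  \<open>B\<close>: neither (\<open>Void\<close>), \<open>i\<close> in both (\<open>Pos\<close>), \<open>i'\<close> in both (\<open>Neg\<close>), \<open>i\<close> in \<open>A\<^sup>*\<close> and \<open>i'\<close> in \<open>B\<close>
  (\<open>Op\<close>), \<open>i'\<close> in \<open>A\<^sup>*\<close> and \<open>i\<close> in \<open>B\<close> (\<open>Cl\<close>). The pair \<open>A\<^sup>*, B\<close> is the split form of a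
  Kashiwara--Nakashima column of type $C_n$ when every \<open>Cl\<close> is matched by an \<open>Op\<close>.\<close>

datatype state = Void | Pos | Neg | Op | Cl

text \<open>States in \<open>L\<close> contribute the letter \<open>i\<close>, states in \<open>H\<close> its partner \<open>2n + 1 - i\<close>.\<close>

definition letters_of :: "nat \<Rightarrow> state set \<Rightarrow> state set \<Rightarrow> (nat \<Rightarrow> state) \<Rightarrow> nat set" where
  "letters_of n L H s = {x \<in> {1..n}. s x \<in> L} \<union> {x \<in> {n<..2*n}. s (Suc (2*n) - x) \<in> H}"

definition left :: "nat \<Rightarrow> (nat \<Rightarrow> state) \<Rightarrow> nat set" where
  "left n s = letters_of n {Void, Pos, Op} {Void, Neg, Cl} s"

definition right :: "nat \<Rightarrow> (nat \<Rightarrow> state) \<Rightarrow> nat set" where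
  "right n s = letters_of n {Pos, Cl} {Neg, Op} s"

definition enc :: "nat \<Rightarrow> (nat \<Rightarrow> state) \<Rightarrow> word \<times> word" where
  "enc n s = (col (left n s), col (right n s))"

lemma letters_of_subset: "letters_of n L H s \<subseteq> {1..2*n}"
  by (auto simp: letters_of_def)

lemma letters_of_low: "1 \<le> j \<Longrightarrow> j \<le> n \<Longrightarrow> j \<in> letters_of n L H s \<longleftrightarrow> s j \<in> L"
  by (auto simp: letters_of_def)

lemma letters_of_high: "1 \<le> j \<Longrightarrow> j \<le> n \<Longrightarrow> Suc (2*n) - j \<in> letters_of n L H s \<longleftrightarrow> s j \<in> H"
  by (auto simp: letters_of_def)

lemma letters_of_upd:
  assumes "1 \<le> j" "j \<le> n"
  shows "letters_of n L H (s(j := a)) =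
    (letters_of n L H s - {j, Suc (2*n) - j}) \<union> {x. x = j \<and> a \<in> L \<or> x = Suc (2*n) - j \<and> a \<in> H}"
proof (rule set_eqI)
  fix x
  consider "x = j" | "x = Suc (2*n) - j" | "x \<noteq> j" "x \<noteq> Suc (2*n) - j" by blast
  then show "x \<in> letters_of n L H (s(j := a)) \<longleftrightarrow> x \<in> (letters_of n L H s - {j, Suc (2*n) - j}) \<union>
      {x. x = j \<and> a \<in> L \<or> x = Suc (2*n) - j \<and> a \<in> H}"
  proof cases
    case 1
    then show ?thesis using assms by (auto simp: letters_of_def)
  next
    case 2
    then show ?thesis using assms by (auto simp: letters_of_def)
  next
    case 3
    then have "x \<in> {n<..2*n} \<Longrightarrow> Suc (2*n) - x \<noteq> j" by auto
    then show ?thesis using 3 by (auto simp: letters_of_def)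
  qed
qed

text \<open>The operator on a pair of columns that turns the letter \<open>a\<close> into \<open>b\<close>, with the string lengths of
  the tensor rule spelled out as memberships.\<close>

definition step_f :: "nat \<Rightarrow> nat \<Rightarrow> nat set \<times> nat set \<Rightarrow> (nat set \<times> nat set) option" where
  "step_f a b = (\<lambda>(A, B).
     if (a \<in> B \<and> b \<notin> B) \<longrightarrow> (b \<in> A \<and> a \<notin> A)
     then if a \<in> A \<and> b \<notin> A then Some (insert b (A - {a}), B) else None
     else Some (A, insert b (B - {a})))"

definition step_e :: "nat \<Rightarrow> nat \<Rightarrow> nat set \<times> nat set \<Rightarrow> (nat set \<times> nat set) option" where
  "step_e a b = (\<lambda>(A, B).
     if \<not> (a \<in> B \<and> b \<notin> B) \<and> (b \<in> A \<and> a \<notin> A) then Some (insert a (A - {b}), B)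
     else if b \<in> B \<and> a \<notin> B then Some (A, insert a (B - {b})) else None)"

lemma tens_step:
  assumes U: "A \<subseteq> {1..2*n}" and V: "B \<subseteq> {1..2*n}" and i: "i \<le> 2*n - 1" "n \<ge> 1"
  shows "tens_f n i (col A, col B) = map_option (map_prod col col) (step_f (src n i) (Suc i) (A, B))"
    and "tens_e n i (col A, col B) = map_option (map_prod col col) (step_e (src n i) (Suc i) (A, B))"
proof -
  have "(col_phi n i B \<le> col_eps n i A) = ((src n i \<in> B \<and> Suc i \<notin> B) \<longrightarrow> (Suc i \<in> A \<and> src n i \<notin> A))"
    by (simp add: col_phi_def col_eps_def)
  then show "tens_f n i (col A, col B) = map_option (map_prod col col) (step_f (src n i) (Suc i) (A, B))"
    unfolding tens_col[OF assms] step_f_def by simp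
  have "(col_phi n i B < col_eps n i A) = (\<not> (src n i \<in> B \<and> Suc i \<notin> B) \<and> (Suc i \<in> A \<and> src n i \<notin> A))"
    by (simp add: col_phi_def col_eps_def)
  then show "tens_e n i (col A, col B) = map_option (map_prod col col) (step_e (src n i) (Suc i) (A, B))"
    unfolding tens_col[OF assms] step_e_def by simp
qed

lemma step_subset:
  assumes "a \<in> S" "b \<in> S" "A \<subseteq> S" "B \<subseteq> S"
  shows "step_f a b (A, B) = Some (A', B') \<Longrightarrow> A' \<subseteq> S \<and> B' \<subseteq> S"
    and "step_e a b (A, B) = Some (A', B') \<Longrightarrow> A' \<subseteq> S \<and> B' \<subseteq> S"
  using assms by (auto simp: step_f_def step_e_def split: if_splits)

lemma bind_tens_step:
  assumes A: "A \<subseteq> {1..2*n}" "B \<subseteq> {1..2*n}" and i: "1 \<le> i" "i \<le> 2*n - 1" "1 \<le> k" "k \<le> 2*n - 1"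
  shows "Option.bind (tens_f n i (col A, col B)) (tens_f n k) =
      map_option (map_prod col col) (Option.bind (step_f i (Suc i) (A, B)) (step_f k (Suc k)))"
    and "Option.bind (tens_e n i (col A, col B)) (tens_e n k) =
      map_option (map_prod col col) (Option.bind (step_e i (Suc i) (A, B)) (step_e k (Suc k)))"
proof -
  have n: "n \<ge> 1" using i by simp
  have mem: "i \<in> {1..2*n}" "Suc i \<in> {1..2*n}" using i by auto
  have src: "src n i = i" "src n k = k" using i by (simp_all add: src_def)
  show "Option.bind (tens_f n i (col A, col B)) (tens_f n k) =
      map_option (map_prod col col) (Option.bind (step_f i (Suc i) (A, B)) (step_f k (Suc k)))"
  proof (cases "step_f i (Suc i) (A, B)")
    case None
    then show ?thesis by (simp add: tens_step[OF A i(2) n] src)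
  next
    case (Some P)
    then obtain A' B' where S: "step_f i (Suc i) (A, B) = Some (A', B')" by (cases P) simp
    note sub = step_subset(1)[OF mem A S]
    show ?thesis using tens_step(1)[OF sub[THEN conjunct1] sub[THEN conjunct2] i(4) n] S
      by (simp add: tens_step[OF A i(2) n] src)
  qed
  show "Option.bind (tens_e n i (col A, col B)) (tens_e n k) =
      map_option (map_prod col col) (Option.bind (step_e i (Suc i) (A, B)) (step_e k (Suc k)))"
  proof (cases "step_e i (Suc i) (A, B)")
    case None
    then show ?thesis by (simp add: tens_step[OF A i(2) n] src)
  next
    case (Some P)
    then obtain A' B' where S: "step_e i (Suc i) (A, B) = Some (A', B')" by (cases P) simp
    note sub = step_subset(2)[OF mem A S]
    show ?thesis using tens_step(2)[OF sub[THEN conjunct1] sub[THEN conjunct2] i(4) n] S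
      by (simp add: tens_step[OF A i(2) n] src)
  qed
qed

text \<open>The action of the \<open>i\<close>-th virtual operator on the states at the places \<open>i\<close> and \<open>i + 1\<close>. A single
  \<open>Pos\<close> or \<open>Neg\<close> changes places with any of \<open>Void\<close>, \<open>Op\<close>, \<open>Cl\<close>; the string from \<open>Pos, Neg\<close> to
  \<open>Neg, Pos\<close> passes through \<open>Op, Cl\<close>.\<close>

fun f_pair :: "state \<Rightarrow> state \<Rightarrow> (state \<times> state) option" where
  "f_pair Pos Neg = Some (Op, Cl)"
| "f_pair Op Cl = Some (Neg, Pos)"
| "f_pair Pos Pos = None"
| "f_pair Neg Neg = None"
| "f_pair Pos x = Some (x, Pos)"
| "f_pair x Neg = Some (Neg, x)"
| "f_pair x y = None"

fun e_pair :: "state \<Rightarrow> state \<Rightarrow> (state \<times> state) option" where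
  "e_pair Neg Pos = Some (Op, Cl)"
| "e_pair Op Cl = Some (Pos, Neg)"
| "e_pair Pos Pos = None"
| "e_pair Neg Neg = None"
| "e_pair x Pos = Some (Pos, x)"
| "e_pair Neg x = Some (x, Neg)"
| "e_pair x y = None"

text \<open>Gives the letters \<open>p\<close>, \<open>v\<close> the memberships of the state \<open>a\<close> and the letters \<open>q\<close>, \<open>u\<close> those of the
  state \<open>b\<close>. The letters to have in mind are \<open>p = i\<close>, \<open>q = i + 1\<close> and their partners \<open>v\<close> and \<open>u\<close>.\<close>

definition place :: "nat \<Rightarrow> nat \<Rightarrow> nat \<Rightarrow> nat \<Rightarrow> state set \<Rightarrow> state set \<Rightarrow> nat set \<Rightarrow> state \<Rightarrow> state \<Rightarrow> nat set" where
  "place p q u v L H X a b =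
     (X - {p, q, u, v}) \<union> {x. x = p \<and> a \<in> L \<or> x = q \<and> b \<in> L \<or> x = u \<and> b \<in> H \<or> x = v \<and> a \<in> H}"

lemma place_eqI:
  assumes "X - {p, q, u, v} = Y - {p, q, u, v}" "p \<in> Y \<longleftrightarrow> a \<in> L" "q \<in> Y \<longleftrightarrow> b \<in> L" "u \<in> Y \<longleftrightarrow> b \<in> H" "v \<in> Y \<longleftrightarrow> a \<in> H"
  shows "place p q u v L H X a b = Y"
  using assms unfolding place_def by blast

text \<open>A finite check over the pairs of states. Only the memberships of the four letters matter, so
  the letters are kept abstract.\<close>

lemma steps_pair:
  fixes a b :: state
  defines "L \<equiv> {Void, Pos, Op}" and "H \<equiv> {Void, Neg, Cl}" and "L' \<equiv> {Pos, Cl}" and "H' \<equiv> {Neg, Op}"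
  assumes d: "p \<noteq> q" "p \<noteq> u" "p \<noteq> v" "q \<noteq> u" "q \<noteq> v" "u \<noteq> v"
    and A: "p \<in> A \<longleftrightarrow> a \<in> L" "q \<in> A \<longleftrightarrow> b \<in> L" "u \<in> A \<longleftrightarrow> b \<in> H" "v \<in> A \<longleftrightarrow> a \<in> H"
    and B: "p \<in> B \<longleftrightarrow> a \<in> L'" "q \<in> B \<longleftrightarrow> b \<in> L'" "u \<in> B \<longleftrightarrow> b \<in> H'" "v \<in> B \<longleftrightarrow> a \<in> H'"
  shows "Option.bind (step_f p q (A, B)) (step_f u v) =
      map_option (\<lambda>(a', b'). (place p q u v L H A a' b', place p q u v L' H' B a' b')) (f_pair a b)"
    and "Option.bind (step_e p q (A, B)) (step_e u v) =
      map_option (\<lambda>(a', b'). (place p q u v L H A a' b', place p q u v L' H' B a' b')) (e_pair a b)"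
proof -
  note d' = d d[symmetric]
  show "Option.bind (step_f p q (A, B)) (step_f u v) =
      map_option (\<lambda>(a', b'). (place p q u v L H A a' b', place p q u v L' H' B a' b')) (f_pair a b)"
    by (cases a; cases b; insert A B; simp add: step_f_def d' L_def H_def L'_def H'_def;
        (intro conjI)?; (rule place_eqI[symmetric])?; (simp add: d')?; (blast)?)
  show "Option.bind (step_e p q (A, B)) (step_e u v) =
      map_option (\<lambda>(a', b'). (place p q u v L H A a' b', place p q u v L' H' B a' b')) (e_pair a b)"
    by (cases a; cases b; insert A B; simp add: step_e_def d' L_def H_def L'_def H'_def;
        (intro conjI)?; (rule place_eqI[symmetric])?; (simp add: d')?; (blast)?)
qed

lemma place_twice:
  assumes "p \<noteq> q" "p \<noteq> u" "v \<noteq> q" "v \<noteq> u"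
  shows "place p q u v L H X a b =
    ((X - {p, v}) \<union> {x. x = p \<and> a \<in> L \<or> x = v \<and> a \<in> H} - {q, u}) \<union> {x. x = q \<and> b \<in> L \<or> x = u \<and> b \<in> H}"
  using assms unfolding place_def by blast

lemma place_letters_of:
  assumes "1 \<le> i" "i < n"
  shows "place i (Suc i) (2*n - i) (Suc (2*n - i)) L H (letters_of n L H s) a b =
    letters_of n L H (s(i := a, Suc i := b))"
proof -
  have 1: "Suc (2*n) - i = Suc (2*n - i)" "Suc (2*n) - Suc i = 2*n - i" using assms by auto
  have 2: "i \<noteq> Suc i" "i \<noteq> 2*n - i" "Suc (2*n - i) \<noteq> Suc i" "Suc (2*n - i) \<noteq> 2*n - i" using assms by auto
  have 3: "1 \<le> i" "i \<le> n" "1 \<le> Suc i" "Suc i \<le> n" using assms by auto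
  show ?thesis
    unfolding place_twice[OF 2] letters_of_upd[OF 3(3,4)] letters_of_upd[OF 3(1,2)] 1 ..
qed

primrec ht :: "(nat \<Rightarrow> state) \<Rightarrow> nat \<Rightarrow> int" where
  "ht s 0 = 0"
| "ht s (Suc j) = ht s j + (case s (Suc j) of Cl \<Rightarrow> 1 | Op \<Rightarrow> -1 | _ \<Rightarrow> 0)"

text \<open>Read \<open>Op\<close> and \<open>Cl\<close> as parentheses, so that \<open>ht s n\<close> is the number of \<open>Cl\<close> minus that of \<open>Op\<close>.
  The second condition says that every \<open>Op\<close> is matched; the third one that no \<open>Void\<close> stands inside
  a matched pair or to the left of an unmatched \<open>Cl\<close>. Hence \<open>ht s n\<close> counts the unmatched \<open>Cl\<close>.\<close>

definition admissible :: "nat \<Rightarrow> (nat \<Rightarrow> state) \<Rightarrow> bool" where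
  "admissible n s \<longleftrightarrow> (\<forall>i. i \<notin> {1..n} \<longrightarrow> s i = Void) \<and> (\<forall>j\<le>n. ht s j \<le> ht s n) \<and>
     (\<forall>j\<in>{1..n}. s j = Void \<longrightarrow> ht s j = ht s n)"

lemma admissibleD:
  assumes "admissible n s"
  shows "i \<notin> {1..n} \<Longrightarrow> s i = Void" "j \<le> n \<Longrightarrow> ht s j \<le> ht s n"
    "1 \<le> j \<Longrightarrow> j \<le> n \<Longrightarrow> s j = Void \<Longrightarrow> ht s j = ht s n"
  using assms by (simp_all add: admissible_def)

lemma admissible_pair:
  assumes "admissible n s" "1 \<le> i" "i < n"
  shows "\<not> (s i = Op \<and> s (Suc i) = Void)" "\<not> (s i = Void \<and> s (Suc i) = Cl)"
proof -
  obtain k where k: "i = Suc k" using assms(2) by (cases i) auto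
  show "\<not> (s i = Op \<and> s (Suc i) = Void)"
    using admissibleD(3)[OF assms(1), of "Suc i"] admissibleD(2)[OF assms(1), of k] assms k by auto
  show "\<not> (s i = Void \<and> s (Suc i) = Cl)"
    using admissibleD(3)[OF assms(1), of i] admissibleD(2)[OF assms(1), of "Suc i"] assms k by auto
qed

lemma admissible_last:
  assumes "admissible n s" "1 \<le> n"
  shows "s n \<noteq> Op"
proof
  assume "s n = Op"
  moreover obtain k where "n = Suc k" using assms(2) by (cases n) auto
  ultimately show False using admissibleD(2)[OF assms(1), of k] by simp
qed

definition st_op :: "(state \<Rightarrow> state \<Rightarrow> (state \<times> state) option) \<Rightarrow> nat \<Rightarrow> (nat \<Rightarrow> state) \<Rightarrow> (nat \<Rightarrow> state) option" where
  "st_op g i s = map_option (\<lambda>(a, b). s(i := a, Suc i := b)) (g (s i) (s (Suc i)))"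

definition st_f :: "nat \<Rightarrow> nat \<Rightarrow> (nat \<Rightarrow> state) \<Rightarrow> (nat \<Rightarrow> state) option" where
  "st_f n i s =
    (if i = 0 then (case s 1 of Neg \<Rightarrow> Some (s(1 := Cl)) | Cl \<Rightarrow> Some (s(1 := Pos)) | _ \<Rightarrow> None)
     else if i < n then st_op f_pair i s
     else if s n = Pos then Some (s(n := Neg)) else None)"

definition st_e :: "nat \<Rightarrow> nat \<Rightarrow> (nat \<Rightarrow> state) \<Rightarrow> (nat \<Rightarrow> state) option" where
  "st_e n i s =
    (if i = 0 then (case s 1 of Pos \<Rightarrow> Some (s(1 := Cl)) | Cl \<Rightarrow> Some (s(1 := Neg)) | _ \<Rightarrow> None)
     else if i < n then st_op e_pair i s
     else if s n = Neg then Some (s(n := Pos)) else None)"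

lemma enc_memberships:
  assumes "1 \<le> j" "j \<le> n"
  shows "j \<in> left n s \<longleftrightarrow> s j \<in> {Void, Pos, Op}" "Suc (2*n) - j \<in> left n s \<longleftrightarrow> s j \<in> {Void, Neg, Cl}"
    "j \<in> right n s \<longleftrightarrow> s j \<in> {Pos, Cl}" "Suc (2*n) - j \<in> right n s \<longleftrightarrow> s j \<in> {Neg, Op}"
  unfolding left_def right_def using assms by (simp_all only: letters_of_low letters_of_high)

lemma enc_subset: "left n s \<subseteq> {1..2*n}" "right n s \<subseteq> {1..2*n}"
  unfolding left_def right_def by (rule letters_of_subset)+

lemma virtual_enc_middle:
  assumes i: "1 \<le> i" "i < n"
  shows "virtual n (tens_f n) i (enc n s) = map_option (enc n) (st_f n i s)"
    and "virtual n (tens_e n) i (enc n s) = map_option (enc n) (st_e n i s)"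
proof -
  have eq: "Suc (2*n) - i = Suc (2*n - i)" "Suc (2*n) - Suc i = 2*n - i" using i by auto
  have b: "1 \<le> i" "i \<le> 2*n - 1" "1 \<le> 2*n - i" "2*n - i \<le> 2*n - 1" using i by auto
  have d: "i \<noteq> Suc i" "i \<noteq> 2*n - i" "i \<noteq> Suc (2*n - i)" "Suc i \<noteq> 2*n - i" "Suc i \<noteq> Suc (2*n - i)"
    "2*n - i \<noteq> Suc (2*n - i)" using i by auto
  have i': "1 \<le> Suc i" "Suc i \<le> n" "i \<le> n" using i by auto
  note m = enc_memberships[OF i(1) i'(3), of s, unfolded eq] and m' = enc_memberships[OF i'(1,2), of s, unfolded eq]
  note S = steps_pair[OF d m(1) m'(1) m'(2) m(2) m(3) m'(3) m'(4) m(4)]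
  have P: "place i (Suc i) (2*n - i) (Suc (2*n - i)) {Void, Pos, Op} {Void, Neg, Cl} (left n s) a b = left n (s(i := a, Suc i := b))"
    "place i (Suc i) (2*n - i) (Suc (2*n - i)) {Pos, Cl} {Neg, Op} (right n s) a b = right n (s(i := a, Suc i := b))" for a b
    unfolding left_def right_def by (rule place_letters_of[OF i])+
  show "virtual n (tens_f n) i (enc n s) = map_option (enc n) (st_f n i s)"
    using i unfolding virtual_def st_f_def st_op_def enc_def
    by (simp add: bind_tens_step(1)[OF enc_subset b] S(1) P option.map_comp o_def case_prod_beta enc_def)
  show "virtual n (tens_e n) i (enc n s) = map_option (enc n) (st_e n i s)"
    using i unfolding virtual_def st_e_def st_op_def enc_def
    by (simp add: bind_tens_step(2)[OF enc_subset b] S(2) P option.map_comp o_def case_prod_beta enc_def)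
qed

lemma virtual_enc_end:
  assumes n: "1 \<le> n"
  shows "virtual n (tens_f n) n (enc n s) = map_option (enc n) (st_f n n s)"
    and "virtual n (tens_e n) n (enc n s) = map_option (enc n) (st_e n n s)"
proof -
  have b: "1 \<le> n" "n \<le> 2*n - 1" using n by auto
  have eq: "Suc (2*n) - n = Suc n" by simp
  note m = enc_memberships[OF n order.refl, of s, unfolded eq]
  have U: "left n (s(n := a)) = (left n s - {n, Suc n}) \<union> {x. x = n \<and> a \<in> {Void, Pos, Op} \<or> x = Suc n \<and> a \<in> {Void, Neg, Cl}}"
    "right n (s(n := a)) = (right n s - {n, Suc n}) \<union> {x. x = n \<and> a \<in> {Pos, Cl} \<or> x = Suc n \<and> a \<in> {Neg, Op}}" for a
    unfolding left_def right_def using letters_of_upd[OF n order.refl] by (simp_all only: eq)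
  have ends: "s n = Pos \<Longrightarrow> insert (Suc n) (left n s - {n}) = left n (s(n := Neg))"
    "s n = Pos \<Longrightarrow> insert (Suc n) (right n s - {n}) = right n (s(n := Neg))"
    "s n = Neg \<Longrightarrow> insert n (left n s - {Suc n}) = left n (s(n := Pos))"
    "s n = Neg \<Longrightarrow> insert n (right n s - {Suc n}) = right n (s(n := Pos))"
    unfolding U using m by auto
  have F: "s n = Pos \<Longrightarrow> Option.bind (step_f n (Suc n) (left n s, right n s)) (step_f n (Suc n)) =
      Some (insert (Suc n) (left n s - {n}), insert (Suc n) (right n s - {n}))"
    "s n \<noteq> Pos \<Longrightarrow> Option.bind (step_f n (Suc n) (left n s, right n s)) (step_f n (Suc n)) = None"
    by (cases "s n"; simp add: step_f_def m)+
  have E: "s n = Neg \<Longrightarrow> Option.bind (step_e n (Suc n) (left n s, right n s)) (step_e n (Suc n)) =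
      Some (insert n (left n s - {Suc n}), insert n (right n s - {Suc n}))"
    "s n \<noteq> Neg \<Longrightarrow> Option.bind (step_e n (Suc n) (left n s, right n s)) (step_e n (Suc n)) = None"
    by (cases "s n"; simp add: step_e_def m)+
  show "virtual n (tens_f n) n (enc n s) = map_option (enc n) (st_f n n s)"
    using n unfolding virtual_def st_f_def enc_def
    by (cases "s n = Pos") (simp_all add: bind_tens_step(1)[OF enc_subset b b] F ends(1,2) enc_def)
  show "virtual n (tens_e n) n (enc n s) = map_option (enc n) (st_e n n s)"
    using n unfolding virtual_def st_e_def enc_def
    by (cases "s n = Neg") (simp_all add: bind_tens_step(2)[OF enc_subset b b] E ends(3,4) enc_def)
qed

lemma virtual_enc_zero:
  assumes n: "1 \<le> n"
  shows "virtual n (tens_f n) 0 (enc n s) = map_option (enc n) (st_f n 0 s)"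
    and "virtual n (tens_e n) 0 (enc n s) = map_option (enc n) (st_e n 0 s)"
proof -
  have b: "0 \<le> 2*n - 1" "n \<ge> 1" using n by auto
  have eq: "Suc (2*n) - 1 = 2*n" by simp
  note m = enc_memberships[OF order.refl n, of s, unfolded eq]
  have U: "left n (s(1 := a)) = (left n s - {1, 2*n}) \<union> {x. x = 1 \<and> a \<in> {Void, Pos, Op} \<or> x = 2*n \<and> a \<in> {Void, Neg, Cl}}"
    "right n (s(1 := a)) = (right n s - {1, 2*n}) \<union> {x. x = 1 \<and> a \<in> {Pos, Cl} \<or> x = 2*n \<and> a \<in> {Neg, Op}}" for a
    unfolding left_def right_def using letters_of_upd[OF order.refl n] by (simp_all only: eq)
  have src: "src n 0 = 2*n" by (simp add: src_def)
  have ne: "1 \<noteq> 2*n" by simp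
  have ends: "s 1 = Neg \<Longrightarrow> left n s = left n (s(1 := Cl))"
    "s 1 = Neg \<Longrightarrow> insert 1 (right n s - {2*n}) = right n (s(1 := Cl))"
    "s 1 = Cl \<Longrightarrow> insert 1 (left n s - {2*n}) = left n (s(1 := Pos))"
    "s 1 = Cl \<Longrightarrow> right n s = right n (s(1 := Pos))"
    "s 1 = Pos \<Longrightarrow> insert (2*n) (left n s - {1}) = left n (s(1 := Cl))"
    "s 1 = Pos \<Longrightarrow> right n s = right n (s(1 := Cl))"
    "s 1 = Cl \<Longrightarrow> left n s = left n (s(1 := Neg))"
    "s 1 = Cl \<Longrightarrow> insert (2*n) (right n s - {1}) = right n (s(1 := Neg))"
    unfolding U using m ne by auto
  show "virtual n (tens_f n) 0 (enc n s) = map_option (enc n) (st_f n 0 s)"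
    unfolding virtual_def st_f_def enc_def using m ends(1-4)
    by (cases "s 1") (simp_all add: tens_step(1)[OF enc_subset b] src step_f_def enc_def)
  show "virtual n (tens_e n) 0 (enc n s) = map_option (enc n) (st_e n 0 s)"
    unfolding virtual_def st_e_def enc_def using m ends(5-8)
    by (cases "s 1") (simp_all add: tens_step(2)[OF enc_subset b] src step_e_def enc_def)
qed

lemma virtual_enc:
  assumes "1 \<le> n" "i \<le> n"
  shows "virtual n (tens_f n) i (enc n s) = map_option (enc n) (st_f n i s)"
    and "virtual n (tens_e n) i (enc n s) = map_option (enc n) (st_e n i s)"
proof -
  consider "i = 0" | "1 \<le> i" "i < n" | "i = n" using assms(2) by linarith
  then have "virtual n (tens_f n) i (enc n s) = map_option (enc n) (st_f n i s) \<and>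
    virtual n (tens_e n) i (enc n s) = map_option (enc n) (st_e n i s)"
    by cases (use virtual_enc_zero virtual_enc_middle virtual_enc_end assms in auto)
  then show "virtual n (tens_f n) i (enc n s) = map_option (enc n) (st_f n i s)"
    "virtual n (tens_e n) i (enc n s) = map_option (enc n) (st_e n i s)" by simp_all
qed

lemma f_pair_iff: "f_pair a b = Some (a', b') \<longleftrightarrow> e_pair a' b' = Some (a, b)"
  by (cases a; cases b; cases a'; cases b'; simp)

text \<open>This is not a formal consequence for the virtual operators: the two factors of \<open>e\<^sub>i\<close> and of \<open>f\<^sub>i\<close>
  are applied in the same order, and inverting would reverse it.\<close>

lemma st_inverse:
  assumes "1 \<le> i" "i \<le> n" "st_e n i s = Some t"
  shows "st_f n i t = Some s"
proof (cases "i < n")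
  case True
  then obtain a b where ab: "e_pair (s i) (s (Suc i)) = Some (a, b)" "t = s(i := a, Suc i := b)"
    using assms by (auto simp: st_e_def st_op_def)
  have "f_pair a b = Some (s i, s (Suc i))" using ab(1) f_pair_iff by blast
  then show ?thesis using True assms(1) ab(2) by (simp add: st_f_def st_op_def fun_upd_twist)
next
  case False
  then show ?thesis using assms by (auto simp: st_e_def st_f_def split: if_splits)
qed

subsection \<open>Invariance of admissibility\<close>

abbreviation val :: "state \<Rightarrow> int" where
  "val a \<equiv> (case a of Cl \<Rightarrow> 1 | Op \<Rightarrow> -1 | _ \<Rightarrow> 0)"

lemma ht_upd: "1 \<le> i \<Longrightarrow> ht (s(i := a)) j = (if i \<le> j then ht s j - val (s i) + val a else ht s j)"
  by (induction j) (auto simp: le_Suc_eq)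

text \<open>If the two new states have the same total height as the old ones, only the height at the place
  between them changes.\<close>

lemma admissible_upd2:
  assumes s: "admissible n s" and i: "1 \<le> i" "i < n" and v: "val a + val b = val (s i) + val (s (Suc i))"
    and h: "ht s i - val (s i) + val a \<le> ht s n" "a = Void \<Longrightarrow> ht s i - val (s i) = ht s n" "b = Void \<Longrightarrow> ht s (Suc i) = ht s n"
  shows "admissible n (s(i := a, Suc i := b)) \<and> ht (s(i := a, Suc i := b)) n = ht s n"
proof -
  let ?t = "s(i := a, Suc i := b)"
  have H: "ht ?t j = (if j = i then ht s i - val (s i) + val a else ht s j)" for j
    using i v ht_upd[of "Suc i" "s(i := a)" b j] ht_upd[of i s a j] by (auto simp: le_Suc_eq)
  have n: "ht ?t n = ht s n" using H[of n] i by simp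
  have "ht ?t j \<le> ht ?t n" if "j \<le> n" for j
    using admissibleD(2)[OF s that] h(1) by (simp only: n) (simp add: H)
  moreover have "ht ?t j = ht ?t n" if j: "1 \<le> j" "j \<le> n" "?t j = Void" for j
  proof -
    consider "j = i" | "j = Suc i" | "j \<noteq> i" "j \<noteq> Suc i" by blast
    then show ?thesis
    proof cases
      case 1
      then have a: "a = Void" using j by simp
      have "ht ?t j = ht s i - val (s i) + val a" using H[of j] 1 by simp
      also have "\<dots> = ht s n" using h(2)[OF a] a by simp
      finally show ?thesis using n by simp
    next
      case 2
      then have b: "b = Void" using j by simp
      have "ht ?t j = ht s (Suc i)" using H[of j] 2 by simp
      then show ?thesis using h(3)[OF b] n by simp
    next
      case 3
      then have "ht ?t j = ht s j" "s j = Void" using H[of j] j(3) by simp_all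
      then show ?thesis using admissibleD(3)[OF s j(1,2)] n by simp
    qed
  qed
  moreover have "?t j = Void" if "j \<notin> {1..n}" for j using admissibleD(1)[OF s that] that i by auto
  ultimately show ?thesis using n by (auto simp: admissible_def)
qed

lemma pair_closed:
  assumes s: "admissible n s" and i: "1 \<le> i" "i < n"
    and ab: "f_pair (s i) (s (Suc i)) = Some (a, b) \<or> e_pair (s i) (s (Suc i)) = Some (a, b)"
  shows "admissible n (s(i := a, Suc i := b)) \<and> ht (s(i := a, Suc i := b)) n = ht s n"
proof -
  obtain k where k: "i = Suc k" using i by (cases i) auto
  have H: "ht s (Suc k) = ht s k + val (s i)" "ht s (Suc i) = ht s i + val (s (Suc i))" by (simp_all add: k)
  have le: "ht s k \<le> ht s n" "ht s i \<le> ht s n" "ht s (Suc i) \<le> ht s n"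
    using admissibleD(2)[OF s, of k] admissibleD(2)[OF s, of i] admissibleD(2)[OF s, of "Suc i"] i k
    by (simp_all del: ht.simps)
  have vo: "s i = Void \<Longrightarrow> ht s i = ht s n" "s (Suc i) = Void \<Longrightarrow> ht s (Suc i) = ht s n"
    using admissibleD(3)[OF s, of i] admissibleD(3)[OF s, of "Suc i"] i by (simp_all del: ht.simps)
  have "val a + val b = val (s i) + val (s (Suc i)) \<and> ht s i - val (s i) + val a \<le> ht s n \<and>
    (a = Void \<longrightarrow> ht s i - val (s i) = ht s n) \<and> (b = Void \<longrightarrow> ht s (Suc i) = ht s n)"
    using ab le vo H unfolding k[symmetric] by (cases "s i"; cases "s (Suc i)") auto
  then show ?thesis using admissible_upd2[OF s i] by blast
qed

lemma admissible_upd1: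
  assumes s: "admissible n s" and i: "1 \<le> i" "i \<le> n" and a: "a \<noteq> Void" "s i \<noteq> Void"
    and le: "\<And>j. j \<le> n \<Longrightarrow> ht (s(i := a)) j \<le> ht (s(i := a)) n"
    and vo: "\<And>j. 1 \<le> j \<Longrightarrow> j \<le> n \<Longrightarrow> j \<noteq> i \<Longrightarrow> s j = Void \<Longrightarrow> ht (s(i := a)) j = ht (s(i := a)) n"
  shows "admissible n (s(i := a))"
  unfolding admissible_def
proof (intro conjI allI ballI impI)
  fix j
  show "(s(i := a)) j = Void" if "j \<notin> {1..n}" using admissibleD(1)[OF s that] that i by auto
  show "ht (s(i := a)) j \<le> ht (s(i := a)) n" if "j \<le> n" by (rule le[OF that])
  show "ht (s(i := a)) j = ht (s(i := a)) n" if "j \<in> {1..n}" "(s(i := a)) j = Void"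
    by (rule vo) (use that a in \<open>auto split: if_splits\<close>)
qed

lemma st_closed:
  assumes s: "admissible n s" and i: "1 \<le> i" "i \<le> n" and t: "st_f n i s = Some t \<or> st_e n i s = Some t"
  shows "admissible n t \<and> ht t n = ht s n"
proof (cases "i < n")
  case True
  then obtain a b where "f_pair (s i) (s (Suc i)) = Some (a, b) \<or> e_pair (s i) (s (Suc i)) = Some (a, b)"
    "t = s(i := a, Suc i := b)" using t i(1) by (auto simp: st_f_def st_e_def st_op_def)
  then show ?thesis using pair_closed[OF s i(1) True] by blast
next
  case False
  then have in': "i = n" using i by simp
  obtain a where a: "t = s(n := a)" "a = Pos \<or> a = Neg" "s n = Pos \<or> s n = Neg"
    using t i in' by (auto simp: st_f_def st_e_def split: if_splits)
  have H: "ht (s(n := a)) j = ht s j" for j using ht_upd[of n s a j] a i in' by auto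
  have "admissible n (s(n := a))"
  proof (rule admissible_upd1[OF s _ order.refl])
    show "1 \<le> n" "a \<noteq> Void" "s n \<noteq> Void" using a i in' by auto
    show "ht (s(n := a)) j \<le> ht (s(n := a)) n" if "j \<le> n" for j
      unfolding H by (rule admissibleD(2)[OF s that])
    show "ht (s(n := a)) j = ht (s(n := a)) n" if "1 \<le> j" "j \<le> n" "s j = Void" for j
      unfolding H by (rule admissibleD(3)[OF s that])
  qed
  then show ?thesis using a(1) H by simp
qed

lemma st_closed_zero:
  assumes s: "admissible n s" and n: "1 \<le> n" and t: "st_f n 0 s = Some t \<or> st_e n 0 s = Some t"
  shows "admissible n t"
proof -
  obtain a where a: "t = s(1 := a)" "a \<noteq> Void" "s 1 \<noteq> Void"
    "s 1 = Neg \<and> a = Cl \<or> s 1 = Cl \<and> a = Pos \<or> s 1 = Pos \<and> a = Cl \<or> s 1 = Cl \<and> a = Neg"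
    using t by (auto simp: st_f_def st_e_def split: state.splits)
  define d where "d = val a - val (s 1)"
  have H: "ht (s(1 := a)) j = (if 1 \<le> j then ht s j + d else ht s j)" for j
    using ht_upd[of 1 s a j] by (simp add: d_def)
  have d0: "0 \<le> ht s n + d"
    using a(4) admissibleD(2)[OF s, of 0] admissibleD(2)[OF s, of 1] n by (auto simp: d_def)
  have "admissible n (s(1 := a))"
  proof (rule admissible_upd1[OF s order.refl n a(2,3)])
    show "ht (s(1 := a)) j \<le> ht (s(1 := a)) n" if "j \<le> n" for j
      using admissibleD(2)[OF s that] d0 n H[of j] H[of n] by (cases "j = 0") simp_all
    show "ht (s(1 := a)) j = ht (s(1 := a)) n" if "1 \<le> j" "j \<le> n" "s j = Void" for j
      using admissibleD(3)[OF s that] that n H[of j] H[of n] by simp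
  qed
  then show ?thesis using a(1) by simp
qed

subsection \<open>Alignment\<close>

text \<open>For the two excluded pairs of states one of the equations fails; they do not occur in
  admissible words by \<open>admissible_pair\<close>. For the others this is a finite check.\<close>

lemma pair_align:
  fixes a b :: state
  assumes A: "p \<in> A \<longleftrightarrow> a \<in> {Void, Pos, Op}" "q \<in> A \<longleftrightarrow> b \<in> {Void, Pos, Op}" "u \<in> A \<longleftrightarrow> b \<in> {Void, Neg, Cl}" "v \<in> A \<longleftrightarrow> a \<in> {Void, Neg, Cl}"
    and B: "p \<in> B \<longleftrightarrow> a \<in> {Pos, Cl}" "q \<in> B \<longleftrightarrow> b \<in> {Pos, Cl}" "u \<in> B \<longleftrightarrow> b \<in> {Neg, Op}" "v \<in> B \<longleftrightarrow> a \<in> {Neg, Op}"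
    and ok: "\<not> (a = Op \<and> b = Void)" "\<not> (a = Void \<and> b = Cl)"
  shows "of_bool (p \<in> A \<and> q \<notin> A) + (of_bool (p \<in> B \<and> q \<notin> B) - of_bool (q \<in> A \<and> p \<notin> A)) =
      (of_bool (u \<in> A \<and> v \<notin> A) + (of_bool (u \<in> B \<and> v \<notin> B) - of_bool (v \<in> A \<and> u \<notin> A)) :: nat)"
    and "of_bool (q \<in> B \<and> p \<notin> B) + (of_bool (q \<in> A \<and> p \<notin> A) - of_bool (p \<in> B \<and> q \<notin> B)) =
      (of_bool (v \<in> B \<and> u \<notin> B) + (of_bool (v \<in> A \<and> u \<notin> A) - of_bool (u \<in> B \<and> v \<notin> B)) :: nat)"
  using ok unfolding A B by (cases a; cases b; simp)+

lemma aligned_enc: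
  assumes s: "admissible n s" and amb: "enc n s \<in> ambient n r" and n: "1 \<le> n"
  shows "1 \<le> i \<Longrightarrow> i < n \<Longrightarrow> depth (tens_f n i) (enc n s) = depth (tens_f n (2*n - i)) (enc n s)"
    and "1 \<le> i \<Longrightarrow> i < n \<Longrightarrow> depth (tens_e n i) (enc n s) = depth (tens_e n (2*n - i)) (enc n s)"
    and "even (depth (tens_f n n) (enc n s))" "even (depth (tens_e n n) (enc n s))"
proof -
  have fin: "finite (left n s)" "finite (right n s)"
    by (rule finite_subset[OF enc_subset(1)] finite_subset[OF enc_subset(2)], simp)+
  have D: "depth (tens_f n k) (enc n s) = of_bool (k \<in> left n s \<and> Suc k \<notin> left n s) +
      (of_bool (k \<in> right n s \<and> Suc k \<notin> right n s) - of_bool (Suc k \<in> left n s \<and> k \<notin> left n s))"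
    "depth (tens_e n k) (enc n s) = of_bool (Suc k \<in> right n s \<and> k \<notin> right n s) +
      (of_bool (Suc k \<in> left n s \<and> k \<notin> left n s) - of_bool (k \<in> right n s \<and> Suc k \<notin> right n s))"
    if "1 \<le> k" "k \<le> 2*n - 1" for k
    using regular_depth[OF regular_ambient[OF that(2) n] amb] that(1) fin
    by (simp_all add: enc_def col_phi_def col_eps_def src_def)
  show "depth (tens_f n i) (enc n s) = depth (tens_f n (2*n - i)) (enc n s)"
    "depth (tens_e n i) (enc n s) = depth (tens_e n (2*n - i)) (enc n s)" if i: "1 \<le> i" "i < n"
  proof -
    have eq: "Suc (2*n) - i = Suc (2*n - i)" "Suc (2*n) - Suc i = 2*n - i" using i by auto
    have i': "1 \<le> Suc i" "Suc i \<le> n" "i \<le> n" "i \<le> 2*n - 1" "1 \<le> 2*n - i" "2*n - i \<le> 2*n - 1" using i by auto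
    note m = enc_memberships[OF i(1) i'(3), of s, unfolded eq] and m' = enc_memberships[OF i'(1,2), of s, unfolded eq]
    note S = pair_align[OF m(1) m'(1) m'(2) m(2) m(3) m'(3) m'(4) m(4) admissible_pair[OF s i]]
    show "depth (tens_f n i) (enc n s) = depth (tens_f n (2*n - i)) (enc n s)"
      unfolding D(1)[OF i(1) i'(4)] D(1)[OF i'(5,6)] by (rule S(1))
    show "depth (tens_e n i) (enc n s) = depth (tens_e n (2*n - i)) (enc n s)"
      unfolding D(2)[OF i(1) i'(4)] D(2)[OF i'(5,6)] by (rule S(2))
  qed
  have n': "n \<le> 2*n - 1" using n by simp
  have eq: "Suc (2*n) - n = Suc n" by simp
  note m = enc_memberships[OF n order.refl, of s, unfolded eq]
  show "even (depth (tens_f n n) (enc n s))" "even (depth (tens_e n n) (enc n s))"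
    unfolding D[OF n n'] using admissible_last[OF s n] by (cases "s n"; simp add: m)+
qed

subsection \<open>Highest weight words\<close>

text \<open>The highest weight words for the indices from \<open>1\<close> on: \<open>k\<close> is the index of the fundamental weight,
  \<open>r\<close> the height of the second column.\<close>

definition hw :: "nat \<Rightarrow> nat \<Rightarrow> nat \<Rightarrow> state" where
  "hw k r i = (if 1 \<le> i \<and> i \<le> k then Pos else if k < i \<and> i \<le> r then Cl else Void)"

lemma downward_closed_interval:
  assumes sub: "S \<subseteq> {1..n::nat}" and down: "\<And>i. 1 \<le> i \<Longrightarrow> Suc i \<in> S \<Longrightarrow> i \<in> S"
  shows "\<exists>k\<le>n. S = {1..k}"
proof (cases "S = {}")
  case True
  then show ?thesis by (intro exI[of _ 0]) simp
next
  case False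
  have fin: "finite S" using sub finite_subset by blast
  have m: "Max S \<in> S" using fin False by (rule Max_in)
  have 1: "i \<in> S" if "i \<le> Max S" "1 \<le> i" for i
    using that
  proof (induction i rule: inc_induct)
    case base
    show ?case by (rule m)
  next
    case (step i)
    then show ?case using down[of i] by simp
  qed
  have 2: "i \<le> Max S \<and> 1 \<le> i" if "i \<in> S" for i
    using that fin sub by auto
  have "S = {1..Max S}" by (rule set_eqI) (metis 1 2 atLeastAtMost_iff)
  moreover have "Max S \<le> n" using m sub by auto
  ultimately show ?thesis by blast
qed

text \<open>If no raising operator applies, a \<open>Neg\<close> can only be followed by another \<open>Neg\<close>, hence reaches the
  last place, where \<open>e\<^sub>n\<close> would apply. Likewise an \<open>Op\<close> would reach the last place, where it cannot be
  matched. In the remaining words \<open>Pos\<close> follows only \<open>Pos\<close>, and \<open>Cl\<close> does not follow \<open>Void\<close>.\<close>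

lemma highest_weight_word:
  assumes s: "admissible n s" and n: "1 \<le> n" and hi: "\<And>i. 1 \<le> i \<Longrightarrow> i \<le> n \<Longrightarrow> st_e n i s = None"
  shows "\<exists>k r. k \<le> r \<and> r \<le> n \<and> s = hw k r"
proof -
  have e: "e_pair (s i) (s (Suc i)) = None" if "1 \<le> i" "i < n" for i
    using hi[of i] that by (simp add: st_e_def st_op_def)
  have last: "s n \<noteq> Neg" "s n \<noteq> Op" using hi[of n] n admissible_last[OF s n] by (auto simp: st_e_def)
  have noNeg: "s i \<noteq> Neg" if "1 \<le> i" "i \<le> n" for i
    using that(2,1)
  proof (induction i rule: inc_induct)
    case (step i)
    then have "s (Suc i) \<noteq> Neg" by simp
    then show ?case using e[of i] step by (cases "s (Suc i)") auto
  qed (use last in simp)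
  have noOp: "s i \<noteq> Op" if "1 \<le> i" "i \<le> n" for i
    using that(2,1)
  proof (induction i rule: inc_induct)
    case (step i)
    then have "s (Suc i) \<noteq> Op" "s (Suc i) \<noteq> Neg" using noNeg by simp_all
    then show ?case using e[of i] step admissible_pair[OF s, of i] by (cases "s (Suc i)") auto
  qed (use last in simp)
  have st: "s i = Void \<or> s i = Pos \<or> s i = Cl" if "1 \<le> i" "i \<le> n" for i
    using noNeg[OF that] noOp[OF that] by (cases "s i") auto
  have out: "s i = Void" if "i \<notin> {1..n}" for i by (rule admissibleD(1)[OF s that])
  have "\<exists>k\<le>n. {i. s i = Pos} = {1..k}"
  proof (rule downward_closed_interval)
    show "{i. s i = Pos} \<subseteq> {1..n}" using out by fastforce
    fix i assume i: "1 \<le> i" "Suc i \<in> {i. s i = Pos}"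
    then have "Suc i \<le> n" using out[of "Suc i"] by (cases "Suc i \<le> n") auto
    then have "i < n" by simp
    then show "i \<in> {i. s i = Pos}" using e[of i] i st[of i] by auto
  qed
  then obtain k where k: "k \<le> n" "{i. s i = Pos} = {1..k}" by blast
  have "\<exists>r\<le>n. {i. s i = Pos \<or> s i = Cl} = {1..r}"
  proof (rule downward_closed_interval)
    show "{i. s i = Pos \<or> s i = Cl} \<subseteq> {1..n}" using out by fastforce
    fix i assume i: "1 \<le> i" "Suc i \<in> {i. s i = Pos \<or> s i = Cl}"
    then have "Suc i \<le> n" using out[of "Suc i"] by (cases "Suc i \<le> n") auto
    then have "i < n" by simp
    then show "i \<in> {i. s i = Pos \<or> s i = Cl}" using e[of i] i st[of i] admissible_pair[OF s, of i] by auto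
  qed
  then obtain r where r: "r \<le> n" "{i. s i = Pos \<or> s i = Cl} = {1..r}" by blast
  have "{1..k} \<subseteq> {1..r}" unfolding k(2)[symmetric] r(2)[symmetric] by blast
  then have kr: "k \<le> r" by (cases "k = 0") simp_all
  have "s i = hw k r i" for i
  proof -
    have "s i = Pos \<longleftrightarrow> 1 \<le> i \<and> i \<le> k" using k(2) by (auto simp: set_eq_iff)
    moreover have "s i = Pos \<or> s i = Cl \<longleftrightarrow> 1 \<le> i \<and> i \<le> r" using r(2) by (auto simp: set_eq_iff)
    moreover have "s i = Void \<or> s i = Pos \<or> s i = Cl" using st[of i] out[of i] by (cases "i \<in> {1..n}") auto
    ultimately show ?thesis using kr by (auto simp: hw_def)
  qed
  then show ?thesis using kr r(1) by (intro exI[of _ k] exI[of _ r]) (simp add: fun_eq_iff)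
qed

lemma ht_hw: "k \<le> r \<Longrightarrow> ht (hw k r) j = (if j \<le> k then 0 else if j \<le> r then int j - int k else int r - int k)"
  by (induction j) (auto simp: hw_def)

lemma left_hw: "k \<le> r \<Longrightarrow> r \<le> n \<Longrightarrow> left n (hw k r) = {1..k} \<union> {r<..2*n - k}"
  and right_hw: "k \<le> r \<Longrightarrow> r \<le> n \<Longrightarrow> right n (hw k r) = {1..r}"
  by (auto simp: left_def right_def letters_of_def hw_def)

lemma admissible_hw: "k \<le> r \<Longrightarrow> r \<le> n \<Longrightarrow> admissible n (hw k r)"
  by (auto simp: admissible_def ht_hw) (auto simp: hw_def split: if_splits)

lemma enc_hw_ambient: 
  assumes "k \<le> r" "r \<le> n"
  shows "enc n (hw k r) \<in> ambient n r"
proof -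
  have "card ({1..k} \<union> {r<..2*n - k}) = card {1..k} + card {r<..2*n - k}"
    by (rule card_Un_disjoint) (use assms in auto)
  also have "\<dots> = 2*n - r" using assms by simp
  finally have "card (left n (hw k r)) = 2*n - r" by (simp add: left_hw[OF assms])
  moreover have "card (right n (hw k r)) = r" by (simp add: right_hw[OF assms])
  ultimately show ?thesis
    unfolding enc_def ambient_def
    by (intro SigmaI) (simp_all add: columns_col[OF enc_subset(1)] columns_col[OF enc_subset(2)])
qed


section \<open>Virtual operators\<close>

abbreviation ve :: "nat \<Rightarrow> nat \<Rightarrow> word \<times> word \<Rightarrow> (word \<times> word) option" where
  "ve n \<equiv> virtual n (tens_e n)"

abbreviation vf :: "nat \<Rightarrow> nat \<Rightarrow> word \<times> word \<Rightarrow> (word \<times> word) option" where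
  "vf n \<equiv> virtual n (tens_f n)"

text \<open>For indices \<open>1 \<le> i \<le> n\<close> all virtual operators have the same form, since \<open>2n - n = n\<close>.\<close>

lemma virtual_finite:
  assumes "1 \<le> i" "i \<le> n"
  shows "virtual n g i b = Option.bind (g i b) (g (2*n - i))" "1 \<le> 2*n - i" "2*n - i \<le> 2*n - 1" "i \<le> 2*n - 1"
  using assms by (cases "i = n"; simp add: virtual_def mult_2)+

lemma virtual_ambient:
  assumes b: "b \<in> ambient n r" and n: "1 \<le> n" and i: "i \<le> n" and v: "vf n i b = Some c \<or> ve n i b = Some c"
  shows "c \<in> ambient n r"
proof -
  have step: "d \<in> ambient n r"
    if "b \<in> ambient n r" "k \<le> 2*n - 1" "tens_f n k b = Some d \<or> tens_e n k b = Some d" for b k d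
    using tens_ambient[OF that(1,2) n, of d] that(3) by blast
  show ?thesis
  proof (cases "i = 0")
    case True
    show ?thesis by (rule step[OF b, of 0]) (use v True in \<open>simp_all add: virtual_def\<close>)
  next
    case False
    then have i': "1 \<le> i" by simp
    obtain d where d: "tens_f n i b = Some d \<or> tens_e n i b = Some d"
      "tens_f n (2*n - i) d = Some c \<or> tens_e n (2*n - i) d = Some c"
      using v unfolding virtual_finite(1)[OF i' i] by (auto simp: bind_eq_Some_conv)
    show ?thesis by (rule step[OF step[OF b virtual_finite(4)[OF i' i] d(1)] virtual_finite(3)[OF i' i] d(2)])
  qed
qed

lemma kn_bind:
  assumes "rel_option kn x y" "\<And>b c. x = Some b \<Longrightarrow> y = Some c \<Longrightarrow> kn b c \<Longrightarrow> rel_option kn (g b) (g c)"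
  shows "rel_option kn (Option.bind x g) (Option.bind y g)"
  using assms by (cases x; cases y) simp_all

lemma kn_virtual:
  assumes b: "b \<in> ambient n r" and c: "c \<in> ambient n s" and k: "kn b c" and i: "1 \<le> i" "i \<le> n"
  shows "rel_option kn (vf n i b) (vf n i c)" "rel_option kn (ve n i b) (ve n i c)"
proof -
  note I = virtual_finite(2-4)[OF i]
  have n: "1 \<le> n" using i by simp
  note K = kn_ops[OF b c k i(1) I(3)]
  note Tb = tens_ambient[OF b I(3) n] and Tc = tens_ambient[OF c I(3) n]
  show "rel_option kn (vf n i b) (vf n i c)"
    unfolding virtual_finite(1)[OF i]
  proof (rule kn_bind[OF K(1)])
    fix b' c' assume "tens_f n i b = Some b'" "tens_f n i c = Some c'" "kn b' c'"
    then show "rel_option kn (tens_f n (2*n - i) b') (tens_f n (2*n - i) c')"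
      by (intro kn_ops(1)[OF Tb(1)[THEN conjunct1] Tc(1)[THEN conjunct1] _ I(1,2)])
  qed
  show "rel_option kn (ve n i b) (ve n i c)"
    unfolding virtual_finite(1)[OF i]
  proof (rule kn_bind[OF K(2)])
    fix b' c' assume "tens_e n i b = Some b'" "tens_e n i c = Some c'" "kn b' c'"
    then show "rel_option kn (tens_e n (2*n - i) b') (tens_e n (2*n - i) c')"
      by (intro kn_ops(2)[OF Tb(2)[THEN conjunct1] Tc(2)[THEN conjunct1] _ I(1,2)])
  qed
qed

lemma virtual_words:
  assumes b: "b \<in> ambient n r" and i: "1 \<le> i" "i \<le> n"
  shows "virtual n (word_f n) i (to_word b) = map_option to_word (vf n i b)"
    and "virtual n (word_e n) i (to_word b) = map_option to_word (ve n i b)"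
proof -
  note I = virtual_finite(2-4)[OF i]
  have n: "1 \<le> n" using i by simp
  note T = tens_ambient[OF b I(3) n]
  show "virtual n (word_f n) i (to_word b) = map_option to_word (vf n i b)"
    unfolding virtual_finite(1)[OF i] to_word_tens[OF b i(1) I(3)]
    by (cases "tens_f n i b") (use to_word_tens[OF T(1)[THEN conjunct1] I(1,2)] in simp_all)
  show "virtual n (word_e n) i (to_word b) = map_option to_word (ve n i b)"
    unfolding virtual_finite(1)[OF i] to_word_tens[OF b i(1) I(3)]
    by (cases "tens_e n i b") (use to_word_tens[OF T(2)[THEN conjunct1] I(1,2)] in simp_all)
qed

lemma sum_word_e: "word_e n i w = Some w' \<Longrightarrow> sum_list w = Suc (sum_list w')"
proof (induction w arbitrary: w')
  case (Cons x w)
  show ?case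
  proof (cases "wphi n i w < leps n i x")
    case True
    then show ?thesis using Cons.prems by (auto simp: letter_e_def split: if_splits)
  next
    case False
    then obtain v where "word_e n i w = Some v" "w' = x # v" using Cons.prems by auto
    then show ?thesis using Cons.IH by simp
  qed
qed simp

text \<open>Ensures that repeated raising ends in a highest weight element.\<close>

lemma sum_ve:
  assumes b: "b \<in> ambient n r" and i: "1 \<le> i" "i \<le> n" and c: "ve n i b = Some c"
  shows "sum_list (to_word c) < sum_list (to_word b)"
proof -
  have "virtual n (word_e n) i (to_word b) = Some (to_word c)" using virtual_words(2)[OF b i] c by simp
  then obtain v where "word_e n i (to_word b) = Some v" "word_e n (2*n - i) v = Some (to_word c)"
    unfolding virtual_finite(1)[OF i] by (auto simp: bind_eq_Some_conv)
  then show ?thesis using sum_word_e by force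
qed

section \<open>Components of the virtual crystal\<close>

text \<open>Will turn out to be the component of \<open>V n r\<close> isomorphic to the crystal of highest weight
  \<open>\<Lambda>\<^sub>k\<close>; for \<open>r = k\<close> it consists of tableaux.\<close>

definition comp :: "nat \<Rightarrow> nat \<Rightarrow> nat \<Rightarrow> (word \<times> word) set" where
  "comp n k r = generated {1..n} (ve n) (vf n) (enc n (hw k r))"

lemma generated_step:
  "b \<in> generated I e f b0 \<Longrightarrow> i \<in> I \<Longrightarrow> e i b = Some c \<or> f i b = Some c \<Longrightarrow> c \<in> generated I e f b0"
  using generated.e_step generated.f_step by metis

lemma generated_op_induct [consumes 1, case_names start step]:
  assumes "b \<in> generated I e f b0" and "P b0"
    and "\<And>b i c. b \<in> generated I e f b0 \<Longrightarrow> P b \<Longrightarrow> i \<in> I \<Longrightarrow> e i b = Some c \<or> f i b = Some c \<Longrightarrow> P c"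
  shows "P b"
  using assms(1) by (induction rule: generated.induct) (use assms(2,3) in blast)+

lemma generated_trans:
  assumes "x \<in> generated I e f b" "b \<in> generated J e f a" "I \<subseteq> J"
  shows "x \<in> generated J e f a"
  using assms(1)
proof (induction rule: generated_op_induct)
  case (step b i c)
  then show ?case using generated_step[OF step.IH] assms(3) by blast
qed (rule assms(2))

lemma comp_step:
  "b \<in> comp n k r \<Longrightarrow> i \<in> {1..n} \<Longrightarrow> ve n i b = Some c \<or> vf n i b = Some c \<Longrightarrow> c \<in> comp n k r"
  unfolding comp_def by (rule generated_step)

lemma comp_induct [consumes 1, case_names start step]:
  assumes "b \<in> comp n k r" and "P (enc n (hw k r))"
    and "\<And>b i c. b \<in> comp n k r \<Longrightarrow> P b \<Longrightarrow> 1 \<le> i \<Longrightarrow> i \<le> n \<Longrightarrow> ve n i b = Some c \<or> vf n i b = Some c \<Longrightarrow> P c"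
  shows "P b"
  using assms(1) unfolding comp_def
proof (induction rule: generated_op_induct)
  case (step b i c)
  then show ?case using assms(3)[of b i c] by (simp add: comp_def)
qed (rule assms(2))

lemma comp_ambient:
  assumes "k \<le> r" "r \<le> n" "1 \<le> n" "b \<in> comp n k r"
  shows "b \<in> ambient n r"
  using assms(4)
proof (induction rule: comp_induct)
  case (step b i c)
  then show ?case using virtual_ambient[OF step.IH assms(3) step.hyps(3)] by blast
qed (rule enc_hw_ambient[OF assms(1,2)])

text \<open>A letter inserted into a column that contains it bumps itself, so each letter of \<open>A\<close> passes
  through \<open>col C\<close>.\<close>

lemma col_commute:
  assumes "finite A" "finite C" "A \<subseteq> C"
  shows "knuth (col A @ col C) (col C @ col A)"
  using assms(1,3)
proof (induction rule: finite_linorder_min_induct)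
  case empty
  show ?case by (simp add: knuth.refl)
next
  case (insert a A)
  have A: "col (insert a A) = col A @ [a]" using col_Un[of A "{a}"] insert.hyps by simp
  have "knuth (a # col C) (col (insert a (C - {a})) @ [a])"
    by (rule knuth_column_insert) (use assms(2) insert.prems in auto)
  moreover have "insert a (C - {a}) = C" using insert.prems by auto
  ultimately have "knuth (a # col C) (col C @ [a])" by simp
  from knuth_context[OF this, of "col A" "[]"]
  have 1: "knuth (col (insert a A) @ col C) (col A @ col C @ [a])" by (simp add: A)
  have "knuth (col A @ col C) (col C @ col A)" using insert.IH insert.prems by simp
  from knuth_context[OF this, of "[]" "[a]"]
  have 2: "knuth (col A @ col C @ [a]) (col C @ col (insert a A))" by (simp add: A)
  show ?case by (rule knuth.trans[OF 1 2])
qed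

text \<open>The first column consists of \<open>{r<..2n - k}\<close> on top of \<open>{1..k}\<close>; exchanging \<open>{1..k}\<close> with the second
  column \<open>{1..r}\<close> gives the tableau.\<close>

lemma kn_hw:
  assumes "k \<le> r" "r \<le> n"
  shows "kn (enc n (hw k r)) (enc n (hw k k))"
proof -
  have "k \<le> n" using assms by simp
  have e: "to_word (enc n (hw k r)) = col ({1..k} \<union> {r<..2*n - k}) @ col {1..r}" if "k \<le> r" "r \<le> n" for r
    by (simp add: enc_def to_word_def left_hw[OF that] right_hw[OF that])
  have c1: "col ({r<..2*n - k} \<union> {1..k}) = col {r<..2*n - k} @ col {1..k}"
    by (rule col_Un) (use assms in auto)
  have c2: "col ({r<..2*n - k} \<union> {1..r}) = col {r<..2*n - k} @ col {1..r}"
    by (rule col_Un) auto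
  have "knuth (col {1..k} @ col {1..r}) (col {1..r} @ col {1..k})"
    by (rule col_commute) (use assms in auto)
  from knuth_context[OF this, of "col {r<..2*n - k}" "[]"]
  have "knuth (col ({r<..2*n - k} \<union> {1..k}) @ col {1..r}) (col ({r<..2*n - k} \<union> {1..r}) @ col {1..k})"
    unfolding c1 c2 by simp
  moreover have "{r<..2*n - k} \<union> {1..r} = {1..k} \<union> {k<..2*n - k}" using assms by auto
  ultimately show ?thesis
    using e[OF assms] e[OF order.refl \<open>k \<le> n\<close>] by (simp only: Un_commute)
qed

text \<open>The highest weight elements are equivalent, and operators preserve equivalence.\<close>

lemma comp_kn:
  assumes n: "1 \<le> n" and r: "k \<le> r" "r \<le> n" and s: "k \<le> s" "s \<le> n" and b: "b \<in> comp n k r"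
  shows "\<exists>c\<in>comp n k s. kn b c"
  using b
proof (induction rule: comp_induct)
  case start
  have "kn (enc n (hw k r)) (enc n (hw k s))"
    by (rule knuth.trans[OF kn_hw[OF r] knuth.sym[OF kn_hw[OF s]]])
  then show ?case unfolding comp_def by (rule bexI[OF _ generated.start])
next
  case (step b i b')
  obtain c where c: "c \<in> comp n k s" "kn b c" using step.IH by blast
  note K = kn_virtual[OF comp_ambient[OF r n step.hyps(1)] comp_ambient[OF s n c(1)] c(2) step.hyps(2,3)]
  obtain c' where c': "ve n i c = Some c' \<or> vf n i c = Some c'" "kn b' c'"
    using step.hyps(4)
  proof
    assume "ve n i b = Some b'"
    then obtain c' where "ve n i c = Some c'" "kn b' c'" using K(2) by (cases "ve n i c") simp_all
    then show ?thesis using that by blast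
  next
    assume "vf n i b = Some b'"
    then obtain c' where "vf n i c = Some c'" "kn b' c'" using K(1) by (cases "vf n i c") simp_all
    then show ?thesis using that by blast
  qed
  have "c' \<in> comp n k s" by (rule comp_step[OF c(1) _ c'(1)]) (use step.hyps(2,3) in simp)
  then show ?case using c'(2) by blast
qed

abbreviation is_ballot :: "word \<times> word \<Rightarrow> bool" where
  "is_ballot b \<equiv> ballot (set (fst b)) (set (snd b))"

text \<open>If the result were not a tableau, it would be equivalent to a pair with a longer first column.
  The inverse operator would turn this pair into one equivalent to \<open>b\<close>, against \<open>ballot_le\<close>.\<close>

lemma ballot_op:
  assumes b: "b \<in> ambient n k" "is_ballot b" and k: "k \<le> n" and i: "1 \<le> i" "i \<le> 2*n - 1"
    and c: "tens_f n i b = Some c \<or> tens_e n i b = Some c"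
  shows "c \<in> ambient n k \<and> is_ballot c"
proof -
  have n: "n \<ge> 1" using i by simp
  note T = tens_ambient[OF b(1) i(2) n]
  have amb: "c \<in> ambient n k" using c T by blast
  have inv: "tens_e n i c = Some b \<or> tens_f n i c = Some b" using c T by blast
  have "is_ballot c"
  proof (rule ccontr)
    assume nb: "\<not> is_ballot c"
    have "k \<noteq> 0"
    proof
      assume "k = 0"
      then have "snd c = []" using amb by (auto simp: ambient_def columns_def)
      then show False using nb by (simp add: ballot_def)
    qed
    then obtain j where j: "k = Suc j" by (cases k) auto
    obtain c' where c': "c' \<in> ambient n j" "kn c c'"
      using kn_lower[OF amb[unfolded j] _ nb] k j by auto
    note K = kn_ops(1,2)[OF amb c' i]
    obtain b' where b': "kn b b'" "tens_e n i c' = Some b' \<or> tens_f n i c' = Some b'"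
      using inv K by (auto elim: option.rel_cases)
    have "b' \<in> ambient n j" using tens_ambient[OF c'(1) i(2) n] b'(2) by blast
    then have "k \<le> j" using ballot_le[OF b _ b'(1)] j k by simp
    then show False using j by simp
  qed
  then show ?thesis using amb by blast
qed

lemma ballot_hw: "k \<le> n \<Longrightarrow> is_ballot (enc n (hw k k))"
proof -
  assume k: "k \<le> n"
  have "{1..k} \<union> {k<..2*n - k} = {1..2*n - k}" using k by auto
  then have e: "left n (hw k k) = {1..2*n - k}" "right n (hw k k) = {1..k}"
    using left_hw[OF order.refl k] right_hw[OF order.refl k] by simp_all
  have "card ({1..k} \<inter> {..x}) \<le> card ({1..2*n - k} \<inter> {..x})" for x
    by (rule card_mono) (use k in auto)
  then show ?thesis by (simp add: enc_def e ballot_def)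
qed

lemma comp_ballot:
  assumes n: "1 \<le> n" and k: "k \<le> n" and b: "b \<in> comp n k k"
  shows "is_ballot b"
  using b
proof (induction rule: comp_induct)
  case start
  show ?case by (rule ballot_hw[OF k])
next
  case (step b i c)
  note i = step.hyps(2,3)
  obtain d where d: "tens_f n i b = Some d \<and> tens_f n (2*n - i) d = Some c \<or>
      tens_e n i b = Some d \<and> tens_e n (2*n - i) d = Some c"
    using step.hyps(4) unfolding virtual_finite(1)[OF i] by (auto simp: bind_eq_Some_conv)
  have 1: "d \<in> ambient n k \<and> is_ballot d"
    by (rule ballot_op[OF comp_ambient[OF order.refl k n step.hyps(1)] step.IH k i(1) virtual_finite(4)[OF i]])
      (use d in blast)
  show ?case
    using ballot_op[OF 1[THEN conjunct1] 1[THEN conjunct2] k virtual_finite(2,3)[OF i]] d by blast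
qed

text \<open>Raising ends in some \<open>hw k r\<close>, and \<open>k\<close> can be read off from the height \<open>ht s n\<close>, which does not
  change on the way. The path is recorded in both directions, because \<open>hw_in_V\<close> walks it upwards.\<close>

lemma reach_hw:
  assumes "admissible n s" "enc n s \<in> ambient n r" "1 \<le> n"
  shows "\<exists>k\<le>r. enc n s \<in> comp n k r \<and> enc n (hw k r) \<in> generated {1..n} (ve n) (vf n) (enc n s) \<and>
    ht s n = int r - int k \<and> r \<le> n"
  using assms(1,2)
proof (induction "sum_list (to_word (enc n s))" arbitrary: s rule: less_induct)
  case less
  note s = less.prems(1) and amb = less.prems(2)
  show ?case
  proof (cases "\<exists>i t. 1 \<le> i \<and> i \<le> n \<and> st_e n i s = Some t")
    case True
    then obtain i t where i: "1 \<le> i" "i \<le> n" "st_e n i s = Some t" by blast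
    have e: "ve n i (enc n s) = Some (enc n t)" using virtual_enc(2)[OF assms(3) i(2)] i(3) by simp
    have t: "admissible n t" "ht t n = ht s n" using st_closed[OF s i(1,2)] i(3) by simp_all
    have ambt: "enc n t \<in> ambient n r" by (rule virtual_ambient[OF amb assms(3) i(2) disjI2[OF e]])
    have f: "vf n i (enc n t) = Some (enc n s)"
      using virtual_enc(1)[OF assms(3) i(2)] st_inverse[OF i] by simp
    obtain k where k: "k \<le> r" "enc n t \<in> comp n k r"
      "enc n (hw k r) \<in> generated {1..n} (ve n) (vf n) (enc n t)" "ht t n = int r - int k" "r \<le> n"
      using less.hyps[OF sum_ve[OF amb i(1,2) e] t(1) ambt] by blast
    have "enc n s \<in> comp n k r"
      by (rule comp_step[OF k(2), of i]) (use i f in simp_all)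
    moreover have "enc n t \<in> generated {1..n} (ve n) (vf n) (enc n s)"
      by (rule generated.e_step[where i = i and b = "enc n s"]) (use i e generated.start in simp_all)
    then have "enc n (hw k r) \<in> generated {1..n} (ve n) (vf n) (enc n s)"
      using generated_trans[OF k(3)] by blast
    ultimately show ?thesis using k(1,4,5) t(2) by (intro exI[of _ k]) simp
  next
    case False
    then have "st_e n i s = None" if "1 \<le> i" "i \<le> n" for i using that by (cases "st_e n i s") auto
    then obtain k r' where h: "k \<le> r'" "r' \<le> n" "s = hw k r'" using highest_weight_word[OF s assms(3)] by blast
    have "card (right n s) = r" using amb by (simp add: enc_def ambient_def columns_def)
    then have r: "r' = r" using right_hw[OF h(1,2)] h(3) by simp
    have "ht s n = int r - int k" using ht_hw[OF h(1), of n] h r by auto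
    then show ?thesis using h r generated.start unfolding comp_def by (intro exI[of _ k]) simp
  qed
qed

lemma top_column_col: "top_column m = col {1..m}"
  unfolding top_column_def by (rule sorted_gt_unique) (auto simp: sorted_wrt_rev simp del: upt_Suc)

lemma top_columns:
  assumes "k \<le> n"
  shows "(top_column (2*n - k), top_column k) = enc n (hw k k)"
proof -
  have "{1..k} \<union> {k<..2*n - k} = {1..2*n - k}" using assms by auto
  then show ?thesis by (simp add: enc_def left_hw[OF order.refl assms] right_hw[OF order.refl assms] top_column_col)
qed

lemma Elts_V: "r \<le> n \<Longrightarrow> Elts (V n r) = generated {0..n} (ve n) (vf n) (enc n (hw r r))"
  by (simp add: V_def top_columns)

lemma V_admissible:
  assumes n: "1 \<le> n" and r: "r \<le> n" and b: "b \<in> Elts (V n r)"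
  shows "\<exists>s. admissible n s \<and> b = enc n s \<and> b \<in> ambient n r"
  using b unfolding Elts_V[OF r]
proof (induction rule: generated_op_induct)
  case start
  show ?case using admissible_hw[OF order.refl r] enc_hw_ambient[OF order.refl r] by blast
next
  case (step b i c)
  obtain s where s: "admissible n s" "b = enc n s" "b \<in> ambient n r" using step.IH by blast
  have i: "i \<le> n" using step.hyps(2) by simp
  obtain t where t: "st_f n i s = Some t \<or> st_e n i s = Some t" "c = enc n t"
    using step.hyps(3) virtual_enc[OF n i] s(2) by auto
  have "admissible n t" using st_closed[OF s(1) _ i] st_closed_zero[OF s(1) n] t(1) by (cases "i = 0") auto
  then show ?case using t(2) virtual_ambient[OF s(3) n i, of c] step.hyps(3) by blast
qed

text \<open>From \<open>hw (Suc k) r\<close> the operator \<open>e\<^sub>0\<close> turns the first \<open>Pos\<close> into \<open>Cl\<close> and thereby increases the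
  height by one. Raising the result by the other operators must therefore end in \<open>hw k r\<close>.\<close>

lemma hw_in_V:
  assumes n: "1 \<le> n" and k: "k \<le> r" "r \<le> n"
  shows "enc n (hw k r) \<in> Elts (V n r)"
  using k(1)
proof (induction k rule: inc_induct)
  case base
  show ?case unfolding Elts_V[OF k(2)] by (rule generated.start)
next
  case (step k)
  have kr: "Suc k \<le> r" using step.hyps by simp
  define t where "t = (hw (Suc k) r)(1 := Cl)"
  note adm = admissible_hw[OF kr k(2)]
  have "st_e n 0 (hw (Suc k) r) = Some t" by (simp add: st_e_def t_def hw_def)
  then have e: "ve n 0 (enc n (hw (Suc k) r)) = Some (enc n t)" and t: "admissible n t"
    using virtual_enc(2)[OF n] st_closed_zero[OF adm n] by auto
  have tV: "enc n t \<in> Elts (V n r)"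
    using generated.e_step[OF step.IH[unfolded Elts_V[OF k(2)]] _ e] by (simp add: Elts_V[OF k(2)])
  have ambt: "enc n t \<in> ambient n r"
    using virtual_ambient[OF enc_hw_ambient[OF kr k(2)] n _ disjI2[OF e]] by simp
  obtain k' where k': "k' \<le> r" "enc n (hw k' r) \<in> generated {1..n} (ve n) (vf n) (enc n t)" "ht t n = int r - int k'"
    using reach_hw[OF t ambt n] by blast
  have "ht t n = ht (hw (Suc k) r) n + 1"
    using ht_upd[of 1 "hw (Suc k) r" Cl n] n by (simp add: t_def hw_def)
  then have "k' = k" using k'(3) ht_hw[OF kr, of n] k kr by (simp split: if_splits)
  then show ?case
    using generated_trans[OF k'(2)] tV unfolding Elts_V[OF k(2)] by auto
qed

lemma comp_subset_V:
  assumes n: "1 \<le> n" and k: "k \<le> r" "r \<le> n" and b: "b \<in> comp n k r"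
  shows "b \<in> Elts (V n r)"
  using generated_trans[OF b[unfolded comp_def]] hw_in_V[OF n k] unfolding Elts_V[OF k(2)] by auto

lemma V_comp:
  assumes "1 \<le> n" "r \<le> n" "b \<in> Elts (V n r)"
  shows "\<exists>k\<le>r. b \<in> comp n k r"
  using V_admissible[OF assms] reach_hw[OF _ _ assms(1)] by blast

lemma Elts_V_Lambda:
  assumes n: "1 \<le> n" and k: "k \<le> n"
  shows "Elts (V_Lambda n k) = to_word ` comp n k k"
proof -
  have E: "Elts (V_Lambda n k) = generated {1..n} (virtual n (word_e n)) (virtual n (word_f n)) (to_word (enc n (hw k k)))"
    by (simp add: V_Lambda_def top_columns[OF k, symmetric] to_word_def)
  note W = virtual_words[OF comp_ambient[OF order.refl k n]]
  show ?thesis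
  proof (intro equalityI subsetI)
    fix t assume "t \<in> Elts (V_Lambda n k)"
    then show "t \<in> to_word ` comp n k k"
      unfolding E
    proof (induction rule: generated_op_induct)
      case start
      show ?case unfolding comp_def by (rule imageI) (rule generated.start)
    next
      case (step t i t')
      obtain a where a: "t = to_word a" "a \<in> comp n k k" using step.IH by blast
      obtain a' where a': "ve n i a = Some a' \<or> vf n i a = Some a'" "t' = to_word a'"
        using W[OF a(2), of i] step.hyps(2,3) a(1) by auto
      show ?case unfolding a'(2) by (rule imageI) (rule comp_step[OF a(2) step.hyps(2) a'(1)])
    qed
  next
    fix t assume "t \<in> to_word ` comp n k k"
    then obtain a where a: "t = to_word a" "a \<in> comp n k k" by blast
    show "t \<in> Elts (V_Lambda n k)"
      using a(2) unfolding a(1)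
    proof (induction rule: comp_induct)
      case start
      show ?case unfolding E by (rule generated.start)
    next
      case (step b i c)
      have "virtual n (word_e n) i (to_word b) = Some (to_word c) \<or> virtual n (word_f n) i (to_word b) = Some (to_word c)"
        using step.hyps(4) by (elim disjE) (simp_all add: W[OF step.hyps(1,2,3)])
      then show ?case using generated_step[OF step.IH[unfolded E], of i] step.hyps(2,3) by (simp add: E)
    qed
  qed
qed


section \<open>The embeddings and the decomposition\<close>

text \<open>The element of \<open>ambient n r\<close> with a given Schensted tableau is the one in the class of this
  tableau, and so is the image under the composite of the maps \<open>i_map\<close>, each of which preserves
  classes.\<close>

lemma iota_tableau:
  assumes n: "1 \<le> n" and k: "k \<le> r" "r \<le> n" and a: "a \<in> comp n k k"
  shows "b \<in> ambient n r \<and> schensted (to_word b) = to_word a \<longleftrightarrow> b = transport n r a"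
    and "iota n r (to_word a) = transport n r a"
    and "i_composite n k r (to_word a) = transport n r a"
    and "iota n r (to_word a) \<in> comp n k r" and "kn a (iota n r (to_word a))"
proof -
  have kn: "k \<le> n" using k by simp
  have amb: "a \<in> ambient n k" by (rule comp_ambient[OF order.refl kn n a])
  have tab: "tableau_word (to_word a)"
    by (rule ballot_tableau_word[OF amb kn n comp_ballot[OF n kn a]])
  note T = transport_class[OF amb k]
  show iff: "b \<in> ambient n r \<and> schensted (to_word b) = to_word a \<longleftrightarrow> b = transport n r a" for b
  proof
    assume b: "b \<in> ambient n r \<and> schensted (to_word b) = to_word a"
    then have "kn b a" using schensted_iff[of b n r "to_word a"] k(2) n by simp
    then show "b = transport n r a" using transport_eq[of b n r a] b kn_sym by simp
  next
    assume "b = transport n r a"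
    then show "b \<in> ambient n r \<and> schensted (to_word b) = to_word a"
      using T schensted_iff[OF T(1) k(2) n, of "to_word a"] tab kn_sym by simp
  qed
  show iota: "iota n r (to_word a) = transport n r a"
    unfolding iota_def using iff by simp
  have "length (fst a) = 2*n - k" using amb by (auto simp: ambient_def columns_def)
  then have "as_tensor n k (to_word a) = a" by (simp add: as_tensor_def to_word_def)
  then show "i_composite n k r (to_word a) = transport n r a"
    unfolding i_composite_def using i_maps[OF amb k] by simp
  obtain c where c: "c \<in> comp n k r" "kn a c" using comp_kn[OF n order.refl kn k a] by blast
  have "transport n r a = c" by (rule transport_eq[OF comp_ambient[OF k n c(1)] c(2)])
  then show "iota n r (to_word a) \<in> comp n k r" "kn a (iota n r (to_word a))" using iota c by simp_all
qed

lemma V_Lambda_closed: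
  assumes "t \<in> Elts (V_Lambda n k)" "i \<in> {1..n}"
  shows "Eop (V_Lambda n k) i t = Some t' \<Longrightarrow> t' \<in> Elts (V_Lambda n k)"
    and "Fop (V_Lambda n k) i t = Some t' \<Longrightarrow> t' \<in> Elts (V_Lambda n k)"
proof -
  have E: "Elts (V_Lambda n k) = generated {1..n} (Eop (V_Lambda n k)) (Fop (V_Lambda n k))
      (top_column (2*n - k) @ top_column k)" by (simp add: V_Lambda_def)
  show "t' \<in> Elts (V_Lambda n k)" if "Eop (V_Lambda n k) i t = Some t'"
    unfolding E by (rule generated.e_step[OF assms(1)[unfolded E] assms(2) that])
  show "t' \<in> Elts (V_Lambda n k)" if "Fop (V_Lambda n k) i t = Some t'"
    unfolding E by (rule generated.f_step[OF assms(1)[unfolded E] assms(2) that])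
qed

lemma virtual_wt_kn: "knuth w w' \<Longrightarrow> virtual_wt n w = virtual_wt n w'"
proof -
  assume "knuth w w'"
  then have "count_list w = count_list w'" by (intro ext knuth_count)
  then show ?thesis by (simp only: virtual_wt_def wt_A_def)
qed

lemma iota_operators:
  assumes n: "1 \<le> n" and k: "k \<le> r" "r \<le> n" and t: "t \<in> Elts (V_Lambda n k)" and i: "i \<in> {1..n}"
  shows "Eop (V n r) i (iota n r t) = map_option (iota n r) (Eop (V_Lambda n k) i t)"
    and "Fop (V n r) i (iota n r t) = map_option (iota n r) (Fop (V_Lambda n k) i t)"
proof -
  have kn: "k \<le> n" using k by simp
  have i': "1 \<le> i" "i \<le> n" using i by simp_all
  obtain a where a: "t = to_word a" "a \<in> comp n k k" using t Elts_V_Lambda[OF n kn] by blast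
  note amb = comp_ambient[OF order.refl kn n a(2)]
  note I = iota_tableau[OF n k a(2)]
  have ambI: "iota n r t \<in> ambient n r" using comp_ambient[OF k n I(4)] a(1) by simp
  note K = kn_virtual[OF amb ambI _ i'] 
  have kI: "kn a (iota n r t)" using I(5) a(1) by simp
  have E: "ve n i (iota n r t) = map_option (iota n r \<circ> to_word) (ve n i a)"
  proof (rule kn_intertwine[OF K(2)[OF kI]])
    fix b assume "ve n i a = Some b"
    then have b: "b \<in> comp n k k" using comp_step[OF a(2) i] by blast
    show "(iota n r \<circ> to_word) b \<in> ambient n r \<and> kn b ((iota n r \<circ> to_word) b)"
      using iota_tableau(4,5)[OF n k b] comp_ambient[OF k n] by simp
  qed (rule virtual_ambient[OF ambI n i'(2) disjI2])
  have F: "vf n i (iota n r t) = map_option (iota n r \<circ> to_word) (vf n i a)"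
  proof (rule kn_intertwine[OF K(1)[OF kI]])
    fix b assume "vf n i a = Some b"
    then have b: "b \<in> comp n k k" using comp_step[OF a(2) i] by blast
    show "(iota n r \<circ> to_word) b \<in> ambient n r \<and> kn b ((iota n r \<circ> to_word) b)"
      using iota_tableau(4,5)[OF n k b] comp_ambient[OF k n] by simp
  qed (rule virtual_ambient[OF ambI n i'(2) disjI1])
  show "Eop (V n r) i (iota n r t) = map_option (iota n r) (Eop (V_Lambda n k) i t)"
    using E virtual_words(2)[OF amb i'] a(1) by (simp add: V_def V_Lambda_def option.map_comp)
  show "Fop (V n r) i (iota n r t) = map_option (iota n r) (Fop (V_Lambda n k) i t)"
    using F virtual_words(1)[OF amb i'] a(1) by (simp add: V_def V_Lambda_def option.map_comp)
qed

text \<open>Equal images mean equivalent tableaux, which have the same shape by \<open>ballot_le\<close>.\<close>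

lemma iota_inj:
  assumes n: "1 \<le> n" and k: "k \<le> r" "k' \<le> r" "r \<le> n"
    and t: "t \<in> Elts (V_Lambda n k)" "t' \<in> Elts (V_Lambda n k')" and eq: "iota n r t = iota n r t'"
  shows "k = k' \<and> t = t'"
proof -
  have kn: "k \<le> n" "k' \<le> n" using k by simp_all
  obtain a where a: "t = to_word a" "a \<in> comp n k k" using t(1) Elts_V_Lambda[OF n kn(1)] by blast
  obtain a' where a': "t' = to_word a'" "a' \<in> comp n k' k'" using t(2) Elts_V_Lambda[OF n kn(2)] by blast
  note amb = comp_ambient[OF order.refl kn(1) n a(2)] comp_ambient[OF order.refl kn(2) n a'(2)]
  have "kn a (iota n r t)" "kn a' (iota n r t')"
    using iota_tableau(5)[OF n k(1,3) a(2)] iota_tableau(5)[OF n k(2,3) a'(2)] a(1) a'(1) by simp_all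
  then have K: "kn a a'" using eq kn_trans kn_sym by metis
  have "k \<le> k'" "k' \<le> k"
    using ballot_le[OF amb(1) comp_ballot[OF n kn(1) a(2)] amb(2) K]
      ballot_le[OF amb(2) comp_ballot[OF n kn(2) a'(2)] amb(1) kn_sym[OF K]] kn by simp_all
  then have "k = k'" by simp
  moreover have "a = a'" using kn_inj[OF amb(1) _ K] amb(2) \<open>k = k'\<close> by simp
  ultimately show ?thesis using a(1) a'(1) by simp
qed

lemma iota_embedding:
  assumes n: "1 \<le> n" and k: "k \<le> r" "r \<le> n"
  shows "crystal_embedding {1..n} (V_Lambda n k) (V n r) (iota n r)"
  unfolding crystal_embedding_def
proof (intro conjI ballI)
  have kn: "k \<le> n" using k by simp
  show "iota n r ` Elts (V_Lambda n k) \<subseteq> Elts (V n r)"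
  proof (rule image_subsetI)
    fix t assume "t \<in> Elts (V_Lambda n k)"
    then obtain a where "t = to_word a" "a \<in> comp n k k" using Elts_V_Lambda[OF n kn] by blast
    then show "iota n r t \<in> Elts (V n r)" using iota_tableau(4)[OF n k] comp_subset_V[OF n k] by simp
  qed
  show "inj_on (iota n r) (Elts (V_Lambda n k))"
    by (rule inj_onI) (use iota_inj[OF n k(1,1,2)] in blast)
  fix t assume t: "t \<in> Elts (V_Lambda n k)"
  obtain a where a: "t = to_word a" "a \<in> comp n k k" using t Elts_V_Lambda[OF n kn] by blast
  show "Wt (V n r) (iota n r t) = Wt (V_Lambda n k) t"
    using virtual_wt_kn[OF iota_tableau(5)[OF n k a(2)], of n] a(1) by (simp add: V_def V_Lambda_def)
  fix i assume i: "i \<in> {1..n}"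
  show "Eop (V n r) i (iota n r t) = map_option (iota n r) (Eop (V_Lambda n k) i t)"
    "Fop (V n r) i (iota n r t) = map_option (iota n r) (Fop (V_Lambda n k) i t)"
    by (rule iota_operators[OF n k t i])+
  show "depth (Eop (V n r) i) (iota n r t) = depth (Eop (V_Lambda n k) i) t"
    by (rule depth_intertwine[where S = "Elts (V_Lambda n k)" and \<psi> = "iota n r" and h = "Eop (V n r) i"
          and g = "Eop (V_Lambda n k) i", OF iota_operators(1)[OF n k _ i] V_Lambda_closed(1)[OF _ i] t])
  show "depth (Fop (V n r) i) (iota n r t) = depth (Fop (V_Lambda n k) i) t"
    by (rule depth_intertwine[where S = "Elts (V_Lambda n k)" and \<psi> = "iota n r" and h = "Fop (V n r) i"
          and g = "Fop (V_Lambda n k) i", OF iota_operators(2)[OF n k _ i] V_Lambda_closed(2)[OF _ i] t])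
qed

lemma crystal_isomorphic_inverse:
  assumes emb: "crystal_embedding I X Y \<psi>" and onto: "\<psi> ` Elts X = Elts Y"
    and closed: "\<And>i b c. i \<in> I \<Longrightarrow> b \<in> Elts X \<Longrightarrow> Eop X i b = Some c \<or> Fop X i b = Some c \<Longrightarrow> c \<in> Elts X"
  shows "crystal_isomorphic I Y X"
proof -
  define \<phi> where "\<phi> = inv_into (Elts X) \<psi>"
  have inj: "inj_on \<psi> (Elts X)" using emb by (simp add: crystal_embedding_def)
  have \<phi>: "\<phi> (\<psi> b) = b" if "b \<in> Elts X" for b unfolding \<phi>_def by (rule inv_into_f_f[OF inj that])
  have "crystal_embedding I Y X \<phi>"
    unfolding crystal_embedding_def onto[symmetric]
  proof (intro conjI ballI)
    show "\<phi> ` \<psi> ` Elts X \<subseteq> Elts X" using \<phi> by auto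
    show "inj_on \<phi> (\<psi> ` Elts X)" unfolding \<phi>_def by (rule inj_on_inv_into) simp
    fix c assume "c \<in> \<psi> ` Elts X"
    then obtain b where b: "c = \<psi> b" "b \<in> Elts X" by blast
    show "Wt X (\<phi> c) = Wt Y c" using emb b \<phi> by (simp add: crystal_embedding_def)
    fix i assume i: "i \<in> I"
    have B: "Eop Y i (\<psi> b) = map_option \<psi> (Eop X i b)" "Fop Y i (\<psi> b) = map_option \<psi> (Fop X i b)"
      "depth (Eop Y i) (\<psi> b) = depth (Eop X i) b" "depth (Fop Y i) (\<psi> b) = depth (Fop X i) b"
      using emb b(2) i by (simp_all add: crystal_embedding_def)
    have id: "map_option (\<lambda>x. \<phi> (\<psi> x)) z = z" if "\<And>x. z = Some x \<Longrightarrow> x \<in> Elts X" for z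
      using that \<phi> by (cases z) simp_all
    show "Eop X i (\<phi> c) = map_option \<phi> (Eop Y i c)"
      using id[of "Eop X i b"] closed[OF i b(2)] by (simp add: b(1) B \<phi>[OF b(2)] option.map_comp o_def)
    show "Fop X i (\<phi> c) = map_option \<phi> (Fop Y i c)"
      using id[of "Fop X i b"] closed[OF i b(2)] by (simp add: b(1) B \<phi>[OF b(2)] option.map_comp o_def)
    show "depth (Eop X i) (\<phi> c) = depth (Eop Y i) c" "depth (Fop X i) (\<phi> c) = depth (Fop Y i) c"
      using B(3,4) by (simp_all add: b(1) \<phi>[OF b(2)])
  qed
  moreover have "\<phi> ` Elts Y = Elts X" unfolding onto[symmetric] by (simp add: image_image \<phi>)
  ultimately show ?thesis unfolding crystal_isomorphic_def by blast
qed

text \<open>The maps \<open>iota\<close> together form an embedding of the direct sum. It is onto, since every element of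
  \<open>V n r\<close> lies in some \<open>comp n k r\<close> and is thus equivalent to a tableau in \<open>comp n k k\<close>.\<close>

lemma V_decomposition:
  assumes n: "1 \<le> n" and r: "r \<le> n"
  shows "crystal_isomorphic {1..n} (V n r) (direct_sum {0..r} (V_Lambda n))"
proof (rule crystal_isomorphic_inverse)
  let ?S = "direct_sum {0..r} (V_Lambda n)"
  let ?\<psi> = "\<lambda>(k, t). iota n r t"
  have elts: "Elts ?S = Sigma {0..r} (\<lambda>k. Elts (V_Lambda n k))" by (simp add: direct_sum_def)
  have op: "Eop ?S i (k, t) = map_option (Pair k) (Eop (V_Lambda n k) i t)"
    "Fop ?S i (k, t) = map_option (Pair k) (Fop (V_Lambda n k) i t)" for i k t
    by (simp_all add: direct_sum_def)
  have into: "?\<psi> b \<in> Elts (V n r)" if hb: "b \<in> Elts ?S" for b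
  proof -
    obtain k t where b: "b = (k, t)" "k \<le> r" "t \<in> Elts (V_Lambda n k)" using hb unfolding elts by auto
    show ?thesis
      using iota_embedding[OF n b(2) r, unfolded crystal_embedding_def, THEN conjunct1] b(1,3) by auto
  qed
  show "c \<in> Elts ?S" if i: "i \<in> {1..n}" and "b \<in> Elts ?S" and o: "Eop ?S i b = Some c \<or> Fop ?S i b = Some c" for i b c
  proof -
    obtain k t where b: "b = (k, t)" "k \<in> {0..r}" "t \<in> Elts (V_Lambda n k)" using \<open>b \<in> Elts ?S\<close> unfolding elts by blast
    obtain t' where "c = (k, t')" "Eop (V_Lambda n k) i t = Some t' \<or> Fop (V_Lambda n k) i t = Some t'"
      using o unfolding b(1) op by auto
    then show ?thesis using V_Lambda_closed[OF b(3) i] b(2) unfolding elts by blast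
  qed
  show "crystal_embedding {1..n} ?S (V n r) ?\<psi>"
    unfolding crystal_embedding_def
  proof (intro conjI ballI)
    show "?\<psi> ` Elts ?S \<subseteq> Elts (V n r)"
      using into by (rule image_subsetI)
    show "inj_on ?\<psi> (Elts ?S)"
    proof (rule inj_onI)
      fix b b' assume "b \<in> Elts ?S" "b' \<in> Elts ?S" and eq: "?\<psi> b = ?\<psi> b'"
      then obtain k t k' t' where b: "b = (k, t)" "k \<le> r" "t \<in> Elts (V_Lambda n k)"
        "b' = (k', t')" "k' \<le> r" "t' \<in> Elts (V_Lambda n k')" unfolding elts by auto
      have "iota n r t = iota n r t'" using eq b(1,4) by simp
      then show "b = b'" using iota_inj[OF n b(2,5) r b(3,6)] b(1,4) by simp
    qed
    fix b assume "b \<in> Elts ?S"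
    then obtain k t where b: "b = (k, t)" "k \<le> r" "t \<in> Elts (V_Lambda n k)" by (auto simp: elts)
    note E = iota_embedding[OF n b(2) r, unfolded crystal_embedding_def]
    show "Wt (V n r) (?\<psi> b) = Wt ?S b" using E b by (simp add: direct_sum_def)
    fix i assume i: "i \<in> {1..n}"
    have d: "depth (Eop ?S i) (k, t) = depth (Eop (V_Lambda n k) i) t"
      by (rule depth_intertwine[where S = "Elts (V_Lambda n k)" and \<psi> = "Pair k" and h = "Eop ?S i"
            and g = "Eop (V_Lambda n k) i", OF op(1) V_Lambda_closed(1)[OF _ i] b(3)])
    have d': "depth (Fop ?S i) (k, t) = depth (Fop (V_Lambda n k) i) t"
      by (rule depth_intertwine[where S = "Elts (V_Lambda n k)" and \<psi> = "Pair k" and h = "Fop ?S i"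
            and g = "Fop (V_Lambda n k) i", OF op(2) V_Lambda_closed(2)[OF _ i] b(3)])
    show "Eop (V n r) i (?\<psi> b) = map_option ?\<psi> (Eop ?S i b)" "Fop (V n r) i (?\<psi> b) = map_option ?\<psi> (Fop ?S i b)"
      "depth (Eop (V n r) i) (?\<psi> b) = depth (Eop ?S i) b" "depth (Fop (V n r) i) (?\<psi> b) = depth (Fop ?S i) b"
      using E b(3) i by (simp_all add: b(1) op d d' option.map_comp o_def)
  qed
  show "?\<psi> ` Elts ?S = Elts (V n r)"
  proof (intro equalityI subsetI)
    fix c assume "c \<in> ?\<psi> ` Elts ?S"
    then show "c \<in> Elts (V n r)" using into by (elim imageE) simp
  next
    fix c assume "c \<in> Elts (V n r)"
    then obtain k where k: "k \<le> r" "c \<in> comp n k r" using V_comp[OF n r] by blast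
    have kn: "k \<le> n" using k(1) r by simp
    obtain a where a: "a \<in> comp n k k" "kn c a" using comp_kn[OF n k(1) r order.refl kn k(2)] by blast
    have "iota n r (to_word a) = c"
      using iota_tableau(2)[OF n k(1) r a(1)] transport_eq[OF comp_ambient[OF k(1) r n k(2)] kn_sym[OF a(2)]] by simp
    moreover have "(k, to_word a) \<in> Elts ?S" using k(1) a(1) Elts_V_Lambda[OF n kn] by (simp add: elts)
    ultimately show "c \<in> ?\<psi> ` Elts ?S" by force
  qed
qed

lemma V_aligned:
  assumes n: "1 \<le> n" and r: "r \<le> n"
  shows "aligned n r"
  unfolding aligned_def
proof (intro ballI conjI)
  fix b assume "b \<in> Elts (V n r)"
  then obtain s where s: "admissible n s" "b = enc n s" "enc n s \<in> ambient n r" using V_admissible[OF n r] by blast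
  note A = aligned_enc[OF s(1,3) n]
  show "even (depth (tens_f n n) b)" "even (depth (tens_e n n) b)" using A(3,4) s(2) by simp_all
  fix i assume "i \<in> {1..n - 1}"
  then have "1 \<le> i" "i < n" by auto
  then show "depth (tens_f n i) b = depth (tens_f n (2*n - i)) b" "depth (tens_e n i) b = depth (tens_e n (2*n - i)) b"
    using A(1,2) s(2) by simp_all
qed

theorem theorem6p25:
  fixes n r :: nat
  assumes "n \<ge> 1" and "1 \<le> r" and "r \<le> n"
  shows "aligned n r \<and>
    crystal_isomorphic {1..n} (V n r) (direct_sum {0..r} (V_Lambda n)) \<and>
    (\<forall>k\<in>{0..r}.
       (\<forall>t\<in>Elts (V_Lambda n k). \<exists>!b. b \<in> ambient n r \<and> schensted (to_word b) = t) \<and>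
       crystal_embedding {1..n} (V_Lambda n k) (V n r) (iota n r) \<and>
       (\<forall>t\<in>Elts (V_Lambda n k). iota n r t = i_composite n k r t))"
proof (intro conjI ballI)
  show "aligned n r" by (rule V_aligned[OF assms(1,3)])
  show "crystal_isomorphic {1..n} (V n r) (direct_sum {0..r} (V_Lambda n))"
    by (rule V_decomposition[OF assms(1,3)])
  fix k assume "k \<in> {0..r}"
  then have k: "k \<le> r" "r \<le> n" using assms(3) by simp_all
  show "crystal_embedding {1..n} (V_Lambda n k) (V n r) (iota n r)"
    by (rule iota_embedding[OF assms(1) k])
  fix t assume "t \<in> Elts (V_Lambda n k)"
  then obtain a where a: "t = to_word a" "a \<in> comp n k k"
    using Elts_V_Lambda[OF assms(1), of k] k by auto
  note I = iota_tableau[OF assms(1) k a(2)]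
  show "\<exists>!b. b \<in> ambient n r \<and> schensted (to_word b) = t" unfolding a(1) I(1) by blast
  show "iota n r t = i_composite n k r t" unfolding a(1) I(2,3) ..
qed

end
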